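(* Assume that: (i) the set $\{(x,y):\rho(x,y)>0\}$ is open in $(\mathbb R^d\cup\{x_{\mathrm{init}}\})\times\mathbb R^d$; (ii) the chain is pseudo-uniform (as defined in the context); (iii) $\mathrm{Leb}(\partial C)=0$, where $C=\bigcup_{j\in\mathcal J}C_j$ is the union of the communicating classes; (iv) for every $\mu\in\mathcal P(\mathbb R^d)$ with $\mu(C)<1$ there is a neighborhood $V$ of $\mu$ in the weak topology such that $\lim_{n\to\infty}\frac1n\log\mathbb P(L_n\in V)=-\infty$. Then $(L_n)_{n\ge1}$ satisfies the weak large deviation principle in $\mathcal P(\mathbb R^d)$ (weak topology) with a lower semicontinuous rate function $I:\mathcal P(\mathbb R^d)\to[0,\infty]$ satisfying, with $\mathcal A$ the set of admissible measures and the convention $0\cdot\infty=0$: 1. if $\mu\notin\mathcal A$, then $I(\mu)=\infty$; 2. if $\mu_1,\mu_2\in\mathcal A$ and $\lambda\in[0,1]$ are such that $\lambda\mu_1+(1-\lambda)\mu_2\in\mathcal A$, then $I(\lambda\mu_1+(1-\lambda)\mu_2)\le\lambda I(\mu_1)+(1-\lambda)I(\mu_2)$; 3. if $\mu_1,\mu_2\in\mathcal A$ and $\lambda\in[0,1]$ are such that $\lambda\mu_1+(1-\lambda)\mu_2\in\mathcal A$, and if no class $C_j$ satisfies $\mu_1(C_j)\mu_2(C_j)>0$, then $I(\lambda\mu_1+(1-\lambda)\mu_2)=\lambda I(\mu_1)+(1-\lambda)I(\mu_2)$.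
   Context: Setting. Let $d\ge1$, $\mathrm{Leb}$ the Lebesgue measure on $\mathbb R^d$, and $\mathcal P(\mathbb R^d)$ the set of Borel probability measures with the weak topology. Let $\beta\in\mathcal P(\mathbb R^d)$ and let $p$ be a stochastic kernel on $\mathbb R^d$. Adjoin an extra point $x_{\mathrm{init}}\notin\mathbb R^d$ (an isolated point of $\mathbb R^d\cup\{x_{\mathrm{init}}\}$) and put $p(x_{\mathrm{init}},\cdot)=\beta$. Standing assumption: $p(x,\cdot)\ll\mathrm{Leb}$ for every $x\in\mathbb R^d\cup\{x_{\mathrm{init}}\}$; fix a jointly measurable density $\rho:(\mathbb R^d\cup\{x_{\mathrm{init}}\})\times\mathbb R^d\to[0,\infty)$, so $p(x,A)=\int_A\rho(x,y)\,\mathrm{Leb}(dy)$. $(X_n)_{n\ge1}$ is the Markov chain with $X_1\sim\beta$ and kernel $p$, with law $\mathbb P$, and $L_n=\frac1n\sum_{i=1}^n\delta_{X_i}$. Iterates. $\rho^1=\rho$, $\rho^{k+1}(x,y)=\int_{\mathbb R^d}\rho^k(x,z)\rho(z,y)\,\mathrm{Leb}(dz)$, $\tilde\rho=\sum_{k\ge1}2^{-k}\rho^k$ (values in $[0,\infty]$), $\tilde p(x,A)=\int_A\tilde\rho(x,y)\,\mathrm{Leb}(dy)$. Communicating classes. A communicating class is a maximal nonempty set $A\subseteq\mathbb R^d$ such that $\tilde\rho(x,y)>0$ for all $x,y\in A$. The family of all classes is $(C_j)_{j\in\mathcal J}$, and $C=\bigcup_{j\in\mathcal J}C_j$. For $j_1,j_2\in\mathcal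 J$, $j_1\leadsto j_2$ means $\tilde p(x,C_{j_2})>0$ for all $x\in C_{j_1}$; and $\beta\leadsto j$ means $\tilde p(x_{\mathrm{init}},C_j)>0$. (When $\{\rho>0\}$ is open, the classes are open, pairwise disjoint and at most countably many, and $\leadsto$ is a partial order on $\mathcal J$.) Pseudo-uniformity. For a compact set $K\subseteq C$ put $K_j=K\cap C_j$ ($j\in\mathcal J$), $K_\beta=\{x_{\mathrm{init}}\}$, $\mathcal J_K=\{\beta\}\cup\{j\in\mathcal J: K_j\ne\emptyset\}$, and, for $j\in\mathcal J_K\setminus\{\beta\}$, $K_j^-=\bigcup_{j'\in\mathcal J_K,\ j'\leadsto j}K_{j'}$. The compact set $K$ is admissible if $\mathcal J_K$ is finite and totally ordered by $\leadsto$ (with $\beta$ as least element, i.e. $\beta\leadsto j$ for all $j\in\mathcal J_K\setminus\{\beta\}$). The chain is pseudo-uniform if for every admissible compact $K\subseteq C$ there exist a constant $c_K$, an integer $\tau_K$ and a measurable function $\tau:\bigcup_{j\in\mathcal J_K\setminus\{\beta\}}K_j^-\times K_j\to\{1,\dots,\tau_K\}$ such that for all $j\in\mathcal J_K\setminus\{\beta\}$ and all $(x_2,y)\in K_j^-\times K_j$, $\sup_{x_1\in K_j^-}\sup_{k\ge1}\rho^k(x_1,y)\le c_K\,\rho^{\tau(x_2,y)}(x_2,y)$. Admissible measures. $\mu\in\mathcal P(\mathbb R^d)$ is admissible if: $\mu\ll\mathrm{Leb}$; $\operatorname{supp}\mu\subseteq\overline C$; $\beta\leadsto j$ for every $j\in\mathcal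 J$ with $\mu(C_j)>0$; and $\leadsto$ is a total order on $\{j\in\mathcal J:\mu(C_j)>0\}$. $\mathcal A$ is the set of admissible measures. Weak LDP. $(L_n)$ satisfies the weak LDP with lower semicontinuous rate function $I$ if $\liminf_n\frac1n\log\mathbb P(L_n\in O)\ge-\inf_OI$ for all open $O\subseteq\mathcal P(\mathbb R^d)$ and $\limsup_n\frac1n\log\mathbb P(L_n\in F)\le-\inf_FI$ for all compact $F\subseteq\mathcal P(\mathbb R^d)$. *)

theory Defs
  imports "HOL-Probability.Probability"
begin

text \<open>
  The state space \<open>\<real>\<^sup>d\<close> is an arbitrary Euclidean space \<open>'a\<close>, with \<open>lborel\<close> for Lebesgue measure.
  The extended state space \<open>\<real>\<^sup>d \<union> {x\<^sub>i\<^sub>n\<^sub>i\<^sub>t}\<close> is \<open>'a option\<close> with \<open>None\<close> in the role of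
  \<open>x\<^sub>i\<^sub>n\<^sub>i\<^sub>t\<close>, topologised so that \<open>None\<close> is isolated and \<open>Some\<close> is an open embedding.
\<close>

instantiation option :: (topological_space) topological_space
begin

definition open_option :: "'a option set \<Rightarrow> bool"
  where "open_option U \<longleftrightarrow> open (Some -` U)"

instance
  by standard (auto simp: open_option_def vimage_Union)

end

lemma open_singleton_None: "open {None :: 'a::topological_space option}"
proof -
  have "Some -` {None :: 'a option} = {}" by auto
  then show ?thesis by (simp add: open_option_def)
qed

lemma open_image_Some_iff: "open (Some ` U) \<longleftrightarrow> open U"
  by (simp add: open_option_def inj_vimage_image_eq)


section \<open>Probability measures and the weak topology\<close>

abbreviation prob_measures :: "'a::topological_space measure set"
  where "prob_measures \<equiv> space (prob_algebra borel)"

text \<open>The coarsest topology making \<open>\<mu> \<mapsto> \<integral>f d\<mu>\<close> continuous for all bounded continuous \<open>f\<close>.\<close>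

definition weak_topology :: "'a::topological_space measure topology"
  where "weak_topology = topology_generated_by
    {{\<mu> \<in> prob_measures. (\<integral>x. f x \<partial>\<mu>) \<in> U} | (f :: 'a \<Rightarrow> real) U.
       continuous_on UNIV f \<and> bounded (range f) \<and> open U}"

lemma topspace_weak_topology: "topspace weak_topology = prob_measures"
proof -
  have "\<exists>(f :: 'a \<Rightarrow> real) U. (prob_measures :: 'a measure set) =
      {\<mu> \<in> prob_measures. (\<integral>x. f x \<partial>\<mu>) \<in> U} \<and>
      continuous_on UNIV f \<and> bounded (range f) \<and> open U"
    by (rule exI[of _ "\<lambda>_. 0"], rule exI[of _ UNIV]) auto
  then show ?thesis
    unfolding weak_topology_def topology_generated_by_topspace by blast
qed

definition measure_support :: "'a::topological_space measure \<Rightarrow> 'a set"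
  where "measure_support \<mu> = {x. \<forall>U. open U \<and> x \<in> U \<longrightarrow> emeasure \<mu> U > 0}"

text \<open>The mixture \<open>l \<mu> + (1 - l) \<nu>\<close>, for \<open>0 \<le> l \<le> 1\<close>.\<close>

definition mixture :: "real \<Rightarrow> 'a::topological_space measure \<Rightarrow> 'a measure \<Rightarrow> 'a measure"
  where "mixture l \<mu> \<nu> = measure_of UNIV (sets borel)
    (\<lambda>A. ennreal l * emeasure \<mu> A + ennreal (1 - l) * emeasure \<nu> A)"

lemma sets_mixture: "sets (mixture l \<mu> \<nu>) = sets borel"
  using sets.sigma_sets_eq[of "borel :: 'a::topological_space measure"] by (simp add: mixture_def)

lemma emeasure_mixture:
  assumes "sets \<mu> = sets borel" "sets \<nu> = sets borel" "A \<in> sets borel"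
  shows "emeasure (mixture l \<mu> \<nu>) A = ennreal l * emeasure \<mu> A + ennreal (1 - l) * emeasure \<nu> A"
proof (rule emeasure_measure_of[OF mixture_def])
  show "countably_additive (sets (mixture l \<mu> \<nu>))
      (\<lambda>A. ennreal l * emeasure \<mu> A + ennreal (1 - l) * emeasure \<nu> A)"
  proof (rule countably_additiveI)
    fix B :: "nat \<Rightarrow> 'a set"
    assume B: "range B \<subseteq> sets (mixture l \<mu> \<nu>)" "disjoint_family B"
    with assms have "range B \<subseteq> sets \<mu>" "range B \<subseteq> sets \<nu>" by (simp_all add: sets_mixture)
    then have "(\<Sum>i. emeasure \<mu> (B i)) = emeasure \<mu> (\<Union>i. B i)"
      "(\<Sum>i. emeasure \<nu> (B i)) = emeasure \<nu> (\<Union>i. B i)"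
      by (simp_all add: suminf_emeasure B)
    then show "(\<Sum>i. ennreal l * emeasure \<mu> (B i) + ennreal (1 - l) * emeasure \<nu> (B i)) =
        ennreal l * emeasure \<mu> (\<Union>i. B i) + ennreal (1 - l) * emeasure \<nu> (\<Union>i. B i)"
      by (simp add: suminf_add[symmetric])
  qed
  show "A \<in> sets (mixture l \<mu> \<nu>)"
    using assms(3) by (simp add: sets_mixture)
qed (simp_all add: positive_def)


section \<open>Markov chains and empirical measures\<close>

text \<open>
  The chain is indexed from 1: \<open>X 0\<close> plays no role. Its law is pinned down by
  \<open>X 1 \<sim> \<beta>\<close> and \<open>P(X (n+1) \<in> A | X 1, \<dots>, X n) = p (X n) A\<close> almost surely.
\<close>

definition past :: "'w measure \<Rightarrow> (nat \<Rightarrow> 'w \<Rightarrow> 'a::topological_space) \<Rightarrow> nat \<Rightarrow> 'w measure"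
  where "past M X n =
    vimage_algebra (space M) (\<lambda>\<omega>. \<lambda>i\<in>{1..n}. X i \<omega>) (\<Pi>\<^sub>M i\<in>{1..n}. borel)"

definition markov_chain ::
  "'w measure \<Rightarrow> (nat \<Rightarrow> 'w \<Rightarrow> 'a::topological_space) \<Rightarrow> 'a measure \<Rightarrow> ('a \<Rightarrow> 'a measure) \<Rightarrow> bool"
  where "markov_chain M X \<beta> p \<longleftrightarrow>
    prob_space M \<and>
    (\<forall>n\<ge>1. X n \<in> M \<rightarrow>\<^sub>M borel) \<and>
    distr M borel (X 1) = \<beta> \<and>
    (\<forall>n\<ge>1. \<forall>A\<in>sets borel. AE \<omega> in M.
       real_cond_exp M (past M X n) (indicator (X (Suc n) -` A)) \<omega> = measure (p (X n \<omega>)) A)"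

definition empirical :: "(nat \<Rightarrow> 'w \<Rightarrow> 'a::topological_space) \<Rightarrow> nat \<Rightarrow> 'w \<Rightarrow> 'a measure"
  where "empirical X n \<omega> = distr (uniform_count_measure {1..n}) borel (\<lambda>i. X i \<omega>)"

lemma emeasure_empirical:
  assumes "A \<in> sets borel"
  shows "emeasure (empirical X n \<omega>) A = ennreal (1 / n) * (\<Sum>i=1..n. emeasure (return borel (X i \<omega>)) A)"
proof -
  have "(\<Sum>i=1..n. emeasure (return borel (X i \<omega>)) A) = (\<Sum>i=1..n. if X i \<omega> \<in> A then 1 else 0)"
    using assms by (intro sum.cong) (auto simp: indicator_def)
  also have "\<dots> = of_nat (card {i \<in> {1..n}. X i \<omega> \<in> A})"
    by (subst sum.inter_filter[symmetric]) simp_all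
  finally have count: "(\<Sum>i=1..n. emeasure (return borel (X i \<omega>)) A) =
    ennreal (card {i \<in> {1..n}. X i \<omega> \<in> A})"
    by (simp only: ennreal_of_nat_eq_real_of_nat)
  have "emeasure (empirical X n \<omega>) A =
      emeasure (uniform_count_measure {1..n}) ((\<lambda>i. X i \<omega>) -` A \<inter> {1..n})"
    unfolding empirical_def
    by (subst emeasure_distr)
      (auto simp: assms measurable_def space_uniform_count_measure sets_uniform_count_measure)
  also have "(\<lambda>i. X i \<omega>) -` A \<inter> {1..n} = {i \<in> {1..n}. X i \<omega> \<in> A}" by auto
  also have "emeasure (uniform_count_measure {1..n}) \<dots> = ennreal (card {i \<in> {1..n}. X i \<omega> \<in> A} / n)"
    by (subst emeasure_uniform_count_measure) auto
  also have "\<dots> = ennreal (1 / n) * ennreal (card {i \<in> {1..n}. X i \<omega> \<in> A})"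
    by (subst ennreal_mult[symmetric]) auto
  finally show ?thesis
    by (simp only: count)
qed


section \<open>Weak large deviation principle\<close>

definition elog :: "real \<Rightarrow> ereal"
  where "elog x = (if x = 0 then - \<infinity> else ereal (ln x))"

text \<open>\<open>(1/n) log P(L\<^sub>n \<in> S)\<close>\<close>

definition log_rate :: "'w measure \<Rightarrow> (nat \<Rightarrow> 'w \<Rightarrow> 'm) \<Rightarrow> 'm set \<Rightarrow> nat \<Rightarrow> ereal"
  where "log_rate M L S n = ereal (1 / n) * elog (measure M {\<omega> \<in> space M. L n \<omega> \<in> S})"

definition lower_semicontinuous :: "'m topology \<Rightarrow> ('m \<Rightarrow> ennreal) \<Rightarrow> bool"
  where "lower_semicontinuous T I \<longleftrightarrow> (\<forall>a. closedin T {x \<in> topspace T. I x \<le> a})"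

definition weak_LDP ::
  "'w measure \<Rightarrow> (nat \<Rightarrow> 'w \<Rightarrow> 'm) \<Rightarrow> 'm topology \<Rightarrow> ('m \<Rightarrow> ennreal) \<Rightarrow> bool"
  where "weak_LDP M L T I \<longleftrightarrow>
    lower_semicontinuous T I \<and>
    (\<forall>G. openin T G \<longrightarrow> liminf (log_rate M L G) \<ge> - (INF x\<in>G. enn2ereal (I x))) \<and>
    (\<forall>F. compactin T F \<longrightarrow> limsup (log_rate M L F) \<le> - (INF x\<in>F. enn2ereal (I x)))"


section \<open>Iterated densities and communicating classes\<close>

text \<open>The value at 0 is a dummy; \<open>iter_density \<rho> k\<close> is \<open>\<rho>\<^sup>k\<close> for \<open>k \<ge> 1\<close>.\<close>

fun iter_density ::
  "('a::euclidean_space option \<Rightarrow> 'a \<Rightarrow> real) \<Rightarrow> nat \<Rightarrow> 'a option \<Rightarrow> 'a \<Rightarrow> ennreal"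
  where
    "iter_density \<rho> 0 x y = 0"
  | "iter_density \<rho> (Suc 0) x y = ennreal (\<rho> x y)"
  | "iter_density \<rho> (Suc (Suc k)) x y =
       (\<integral>\<^sup>+z. iter_density \<rho> (Suc k) x z * ennreal (\<rho> (Some z) y) \<partial>lborel)"

definition sum_density ::
  "('a::euclidean_space option \<Rightarrow> 'a \<Rightarrow> real) \<Rightarrow> 'a option \<Rightarrow> 'a \<Rightarrow> ennreal"
  where "sum_density \<rho> x y = (\<Sum>k. ennreal (1 / 2 ^ Suc k) * iter_density \<rho> (Suc k) x y)"

definition sum_kernel ::
  "('a::euclidean_space option \<Rightarrow> 'a \<Rightarrow> real) \<Rightarrow> 'a option \<Rightarrow> 'a set \<Rightarrow> ennreal"
  where "sum_kernel \<rho> x A = (\<integral>\<^sup>+y\<in>A. sum_density \<rho> x y \<partial>lborel)"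

definition communicating :: "('a::euclidean_space option \<Rightarrow> 'a \<Rightarrow> real) \<Rightarrow> 'a set \<Rightarrow> bool"
  where "communicating \<rho> A \<longleftrightarrow> A \<noteq> {} \<and> (\<forall>x\<in>A. \<forall>y\<in>A. sum_density \<rho> (Some x) y > 0)"

text \<open>The family of classes is indexed by itself: an index \<open>j\<close> is the class \<open>C\<^sub>j\<close>.\<close>

definition comm_classes :: "('a::euclidean_space option \<Rightarrow> 'a \<Rightarrow> real) \<Rightarrow> 'a set set"
  where "comm_classes \<rho> = {A. communicating \<rho> A \<and> (\<forall>B. communicating \<rho> B \<and> A \<subseteq> B \<longrightarrow> B = A)}"

text \<open>
  The index set extended by \<open>\<beta>\<close> is represented in \<open>'a set option\<close>: \<open>None\<close> is \<open>\<beta>\<close>, whose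
  set of points is \<open>{x\<^sub>i\<^sub>n\<^sub>i\<^sub>t}\<close>, and \<open>Some A\<close> is the class \<open>A\<close>. The clause
  \<open>leads_to \<rho> s None\<close> makes \<open>\<beta> \<leadsto> \<beta>\<close> true, as needed for a reflexive order with
  least element \<open>\<beta>\<close>, and never lets a class lead to \<open>\<beta>\<close>.
\<close>

fun node_points :: "'a set option \<Rightarrow> 'a option set"
  where
    "node_points None = {None}"
  | "node_points (Some A) = Some ` A"

fun leads_to ::
  "('a::euclidean_space option \<Rightarrow> 'a \<Rightarrow> real) \<Rightarrow> 'a set option \<Rightarrow> 'a set option \<Rightarrow> bool"
  where
    "leads_to \<rho> s (Some B) \<longleftrightarrow> (\<forall>x\<in>node_points s. sum_kernel \<rho> x B > 0)"
  | "leads_to \<rho> s None \<longleftrightarrow> s = None"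

definition totally_ordered ::
  "('a::euclidean_space option \<Rightarrow> 'a \<Rightarrow> real) \<Rightarrow> 'a set option set \<Rightarrow> bool"
  where "totally_ordered \<rho> J \<longleftrightarrow>
    linear_order_on J {(s, t). s \<in> J \<and> t \<in> J \<and> leads_to \<rho> s t}"


section \<open>Pseudo-uniformity\<close>

definition classes_of ::
  "('a::euclidean_space option \<Rightarrow> 'a \<Rightarrow> real) \<Rightarrow> 'a set \<Rightarrow> 'a set set"
  where "classes_of \<rho> K = {A \<in> comm_classes \<rho>. K \<inter> A \<noteq> {}}"

text \<open>\<open>\<J>\<^sub>K\<close>, the pieces \<open>K\<^sub>s\<close> for \<open>s \<in> \<J>\<^sub>K\<close>, and \<open>K\<^sub>j\<^sup>-\<close> for a class \<open>j\<close>.\<close>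

definition nodes_of ::
  "('a::euclidean_space option \<Rightarrow> 'a \<Rightarrow> real) \<Rightarrow> 'a set \<Rightarrow> 'a set option set"
  where "nodes_of \<rho> K = insert None (Some ` classes_of \<rho> K)"

definition piece :: "'a set \<Rightarrow> 'a set option \<Rightarrow> 'a option set"
  where "piece K s = node_points (map_option (\<lambda>A. K \<inter> A) s)"

definition piece_minus ::
  "('a::euclidean_space option \<Rightarrow> 'a \<Rightarrow> real) \<Rightarrow> 'a set \<Rightarrow> 'a set \<Rightarrow> 'a option set"
  where "piece_minus \<rho> K A = (\<Union>s \<in> {s \<in> nodes_of \<rho> K. leads_to \<rho> s (Some A)}. piece K s)"

definition admissible_compact ::
  "('a::euclidean_space option \<Rightarrow> 'a \<Rightarrow> real) \<Rightarrow> 'a set \<Rightarrow> bool"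
  where "admissible_compact \<rho> K \<longleftrightarrow>
    compact K \<and> K \<subseteq> \<Union>(comm_classes \<rho>) \<and>
    finite (nodes_of \<rho> K) \<and> totally_ordered \<rho> (nodes_of \<rho> K) \<and>
    (\<forall>s\<in>nodes_of \<rho> K. leads_to \<rho> None s)"

definition pseudo_uniform :: "('a::euclidean_space option \<Rightarrow> 'a \<Rightarrow> real) \<Rightarrow> bool"
  where "pseudo_uniform \<rho> \<longleftrightarrow>
    (\<forall>K. admissible_compact \<rho> K \<longrightarrow>
      (\<exists>(c::real) (N::nat) \<tau>.
        0 \<le> c \<and>
        \<tau> \<in> restrict_space (borel \<Otimes>\<^sub>M borel) (\<Union>A\<in>classes_of \<rho> K. piece_minus \<rho> K A \<times> (K \<inter> A))
            \<rightarrow>\<^sub>M count_space {1..N} \<and>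
        (\<forall>A\<in>classes_of \<rho> K. \<forall>x\<^sub>2\<in>piece_minus \<rho> K A. \<forall>y\<in>K \<inter> A.
           (SUP x\<^sub>1\<in>piece_minus \<rho> K A. SUP k\<in>{1..}. iter_density \<rho> k x\<^sub>1 y)
             \<le> ennreal c * iter_density \<rho> (\<tau> (x\<^sub>2, y)) x\<^sub>2 y)))"


section \<open>Admissible measures\<close>

definition admissible_measures ::
  "('a::euclidean_space option \<Rightarrow> 'a \<Rightarrow> real) \<Rightarrow> 'a measure set"
  where "admissible_measures \<rho> = {\<mu> \<in> prob_measures.
    absolutely_continuous lborel \<mu> \<and>
    measure_support \<mu> \<subseteq> closure (\<Union>(comm_classes \<rho>)) \<and>
    (\<forall>A\<in>comm_classes \<rho>. measure \<mu> A > 0 \<longrightarrow> leads_to \<rho> None (Some A)) \<and>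
    totally_ordered \<rho> (Some ` {A \<in> comm_classes \<rho>. measure \<mu> A > 0})}"

end

theory Submission
  imports Defs
begin

text \<open>
  A trajectory that leaves a class never returns to it. Hence, when the empirical measure is close
  to \<open>\<mu>\<close>, the trajectory visits the classes charged by \<open>\<mu>\<close> one after the other and contains one
  block for each of them, from the first to the last visit to a compact part of the class.
  Pseudo-uniformity decouples the blocks: up to a constant factor and a bounded waiting time, a block
  has the same probability after any past that leads to it. So the probabilities of blocks inside one
  class are supermultiplicative under concatenation, which gives every class an exponential rate that
  is homogeneous and subadditive in the unnormalised occupation measure. The rate function is the sum
  over the classes of the rates of the restrictions of \<open>\<mu>\<close>, and its behaviour on mixtures is read
  off class by class.

  Measures outside the admissible set cost infinitely much: forbidden passages between classes have
  probability zero, and by decoupling the probability of being in a small neighbourhood of a null set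
  at \<open>k\<close> given times is at most \<open>\<eta>\<^sup>k\<close> with \<open>\<eta>\<close> arbitrarily small.
\<close>

section \<open>The weak topology and exponential rates\<close>

definition test_functions :: "('a::topological_space \<Rightarrow> real) set \<Rightarrow> bool"
  where "test_functions F \<longleftrightarrow> finite F \<and> (\<forall>f\<in>F. continuous_on UNIV f \<and> bounded (range f))"

lemma openin_weak_topology_integral:
  fixes f :: "'a::topological_space \<Rightarrow> real"
  assumes "continuous_on UNIV f" "bounded (range f)" "open U"
  shows "openin weak_topology {\<mu> \<in> prob_measures. (\<integral>x. f x \<partial>\<mu>) \<in> U}"
  unfolding weak_topology_def
  by (rule topology_generated_by_Basis) (use assms in blast)

lemma openin_weak_topologyD:
  fixes G :: "'a::topological_space measure set"
  assumes "openin weak_topology G" "\<mu> \<in> G"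
  obtains F \<epsilon> where "test_functions F" "\<epsilon> > 0"
    "{\<nu> \<in> prob_measures. \<forall>f\<in>F. \<bar>(\<integral>x. f x \<partial>\<nu>) - (\<integral>x. f x \<partial>\<mu>)\<bar> < \<epsilon>} \<subseteq> G"
proof -
  let ?B = "\<lambda>F \<epsilon> \<mu>. {\<nu> \<in> prob_measures. \<forall>f\<in>F. \<bar>(\<integral>x. f x \<partial>\<nu>) - (\<integral>x. f x \<partial>\<mu>)\<bar> < \<epsilon>}"
  have "generate_topology_on {{\<mu> \<in> prob_measures. (\<integral>x. f x \<partial>\<mu>) \<in> U} | (f :: 'a \<Rightarrow> real) U.
       continuous_on UNIV f \<and> bounded (range f) \<and> open U} G"
    using assms(1) unfolding weak_topology_def openin_topology_generated_by_iff .
  then have "\<forall>\<mu>\<in>G. \<exists>F \<epsilon>. test_functions F \<and> \<epsilon> > 0 \<and> ?B F \<epsilon> \<mu> \<subseteq> G"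
  proof induction
    case Empty
    then show ?case by simp
  next
    case (Int A B)
    show ?case
    proof
      fix \<mu> assume "\<mu> \<in> A \<inter> B"
      then have "\<mu> \<in> A" "\<mu> \<in> B" by auto
      from bspec[OF Int.IH(1) this(1)] bspec[OF Int.IH(2) this(2)]
      obtain F \<epsilon> F' \<epsilon>' where *: "test_functions F" "\<epsilon> > 0" "?B F \<epsilon> \<mu> \<subseteq> A"
        "test_functions F'" "\<epsilon>' > 0" "?B F' \<epsilon>' \<mu> \<subseteq> B"
        by (elim exE conjE)
      have "?B (F \<union> F') (min \<epsilon> \<epsilon>') \<mu> \<subseteq> ?B F \<epsilon> \<mu> \<inter> ?B F' \<epsilon>' \<mu>" by auto
      then show "\<exists>F \<epsilon>. test_functions F \<and> \<epsilon> > 0 \<and> ?B F \<epsilon> \<mu> \<subseteq> A \<inter> B"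
        using * by (intro exI[of _ "F \<union> F'"] exI[of _ "min \<epsilon> \<epsilon>'"])
          (auto simp: test_functions_def)
    qed
  next
    case (UN K)
    show ?case
    proof
      fix \<mu> assume "\<mu> \<in> \<Union>K"
      then obtain k where k: "k \<in> K" "\<mu> \<in> k" by blast
      from bspec[OF UN.IH[OF k(1)] k(2)] obtain F \<epsilon>
        where "test_functions F" "\<epsilon> > 0" "?B F \<epsilon> \<mu> \<subseteq> k" by (elim exE conjE)
      moreover have "k \<subseteq> \<Union>K" using k by blast
      ultimately show "\<exists>F \<epsilon>. test_functions F \<and> \<epsilon> > 0 \<and> ?B F \<epsilon> \<mu> \<subseteq> \<Union>K"
        by (meson subset_trans)
    qed
  next
    case (Basis s)
    then obtain f :: "'a \<Rightarrow> real" and U where s: "s = {\<mu> \<in> prob_measures. (\<integral>x. f x \<partial>\<mu>) \<in> U}"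
      "continuous_on UNIV f" "bounded (range f)" "open U" by blast
    show ?case
    proof
      fix \<mu> assume "\<mu> \<in> s"
      then have "(\<integral>x. f x \<partial>\<mu>) \<in> U" using s(1) by simp
      from openE[OF s(4) this] obtain e where e: "e > 0" "ball (\<integral>x. f x \<partial>\<mu>) e \<subseteq> U" .
      then have "?B {f} e \<mu> \<subseteq> s"
        unfolding s by (auto simp: dist_real_def subset_eq abs_minus_commute)
      then show "\<exists>F \<epsilon>. test_functions F \<and> \<epsilon> > 0 \<and> ?B F \<epsilon> \<mu> \<subseteq> s"
        using e s by (intro exI[of _ "{f}"] exI[of _ e]) (auto simp: test_functions_def)
    qed
  qed
  from bspec[OF this assms(2)] that show thesis by (elim exE conjE)
qed

lemma prob_space_empirical:
  assumes "n \<ge> 1"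
  shows "prob_space (empirical X n \<omega>)"
proof -
  interpret prob_space "uniform_count_measure {1..n}"
    using assms by (intro prob_space_uniform_count_measure) auto
  show ?thesis unfolding empirical_def
    by (rule prob_space_distr) (auto simp: measurable_def sets_uniform_count_measure space_uniform_count_measure)
qed

lemma sets_empirical [measurable_cong]: "sets (empirical X n \<omega>) = sets borel"
  by (simp add: empirical_def)

lemma empirical_in_prob_measures: "n \<ge> 1 \<Longrightarrow> empirical X n \<omega> \<in> prob_measures"
  by (simp add: space_prob_algebra prob_space_empirical sets_empirical)

lemma integral_empirical:
  fixes f :: "'a::topological_space \<Rightarrow> real"
  assumes [measurable]: "f \<in> borel_measurable borel"
  shows "(\<integral>x. f x \<partial>empirical X n \<omega>) = (\<Sum>i=1..n. f (X i \<omega>)) / n"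
proof -
  have "(\<integral>x. f x \<partial>empirical X n \<omega>) = (\<integral>i. f (X i \<omega>) \<partial>uniform_count_measure {1..n})"
    unfolding empirical_def
    by (rule integral_distr[OF _ assms]) (auto simp: measurable_def sets_uniform_count_measure space_uniform_count_measure)
  also have "\<dots> = (\<Sum>i=1..n. f (X i \<omega>)) / n"
    unfolding uniform_count_measure_def
    by (simp add: lebesgue_integral_point_measure_finite sum_divide_distrib)
  finally show ?thesis .
qed

text \<open>The empirical measure is a continuous function of the trajectory, so weakly open sets of
  empirical measures are events although the weak topology is not shown to be second countable.\<close>

lemma measurable_empirical_open:
  fixes X :: "nat \<Rightarrow> 'w \<Rightarrow> 'a::second_countable_topology"
  assumes [measurable]: "\<And>i. i \<ge> 1 \<Longrightarrow> X i \<in> M \<rightarrow>\<^sub>M borel" and G: "openin weak_topology G" and "n \<ge> 1"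
  shows "{\<omega> \<in> space M. empirical X n \<omega> \<in> G} \<in> sets M"
proof -
  define e :: "(nat \<Rightarrow> 'a) \<Rightarrow> 'a measure" where "e u = empirical (\<lambda>i u. u i) n u" for u
  have eX: "empirical X n \<omega> = e (\<lambda>i. X (max 1 i) \<omega>)" for \<omega>
    unfolding e_def empirical_def
    by (intro distr_cong) (auto simp: space_uniform_count_measure max_absorb2)
  have "continuous_map euclidean weak_topology e"
    unfolding weak_topology_def
  proof (rule continuous_on_generated_topo)
    fix U :: "'a measure set"
    assume "U \<in> {{\<mu> \<in> prob_measures. (\<integral>x. f x \<partial>\<mu>) \<in> U} |f U.
            continuous_on UNIV (f :: 'a \<Rightarrow> real) \<and> bounded (range f) \<and> open U}"
    then obtain f :: "'a \<Rightarrow> real" and V where U: "U = {\<mu> \<in> prob_measures. (\<integral>x. f x \<partial>\<mu>) \<in> V}"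
      and f: "continuous_on UNIV f" and V: "open V" by blast
    have fm: "f \<in> borel_measurable borel" using f by (rule borel_measurable_continuous_onI)
    have "e -` U = (\<lambda>u. (\<Sum>i=1..n. f (u i)) / n) -` V"
      using \<open>n \<ge> 1\<close> by (auto simp: U e_def empirical_in_prob_measures integral_empirical[OF fm])
    moreover have "continuous_on UNIV (\<lambda>u::nat\<Rightarrow>'a. (\<Sum>i=1..n. f (u i)) / n)"
      using \<open>n \<ge> 1\<close>
      by (intro continuous_intros continuous_on_compose2[OF f] continuous_on_product_coordinates) auto
    ultimately show "openin euclidean (e -` U \<inter> topspace euclidean)"
      using V by (simp add: open_vimage)
  next
    show "e ` topspace euclidean \<subseteq> \<Union>{{\<mu> \<in> prob_measures. (\<integral>x. f x \<partial>\<mu>) \<in> U} |f U.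
            continuous_on UNIV (f :: 'a \<Rightarrow> real) \<and> bounded (range f) \<and> open U}"
    proof (rule image_subsetI)
      fix u
      have "e u \<in> topspace weak_topology"
        using \<open>n \<ge> 1\<close> by (simp add: e_def topspace_weak_topology empirical_in_prob_measures)
      then show "e u \<in> \<Union>{{\<mu> \<in> prob_measures. (\<integral>x. f x \<partial>\<mu>) \<in> U} |f U.
            continuous_on UNIV (f :: 'a \<Rightarrow> real) \<and> bounded (range f) \<and> open U}"
        by (simp only: weak_topology_def topology_generated_by_topspace)
    qed
  qed
  then have "open (e -` G)"
    using G by (auto simp: continuous_map_def vimage_def)
  then have [measurable]: "e -` G \<in> sets borel" by simp
  have "(\<lambda>\<omega>. \<lambda>i. X (max 1 i) \<omega>) \<in> M \<rightarrow>\<^sub>M (\<Pi>\<^sub>M i\<in>UNIV. borel)"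
    by (rule measurable_PiM_single') (auto intro!: assms(1))
  then have [measurable]: "(\<lambda>\<omega>. \<lambda>i. X (max 1 i) \<omega>) \<in> M \<rightarrow>\<^sub>M borel"
    by (simp add: sets_PiM_equal_borel cong: measurable_cong_sets)
  have "(\<lambda>\<omega>. \<lambda>i. X (max 1 i) \<omega>) -` (e -` G) \<inter> space M \<in> sets M"
    by measurable
  moreover have "{\<omega> \<in> space M. empirical X n \<omega> \<in> G} = (\<lambda>\<omega>. \<lambda>i. X (max 1 i) \<omega>) -` (e -` G) \<inter> space M"
    by (auto simp: eX)
  ultimately show ?thesis by simp
qed

lemma log_rate_less:
  fixes a :: real
  assumes "\<forall>\<^sub>F n in sequentially. measure M {\<omega> \<in> space M. L n \<omega> \<in> S} \<le> exp (- a * n)"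
  shows "limsup (log_rate M L S) \<le> - ereal a"
proof (rule Limsup_bounded)
  show "\<forall>\<^sub>F n in sequentially. log_rate M L S n \<le> - ereal a"
    using assms eventually_gt_at_top[of 0]
  proof eventually_elim
    case (elim n)
    let ?m = "measure M {\<omega> \<in> space M. L n \<omega> \<in> S}"
    show ?case
    proof (cases "?m = 0")
      case True
      then show ?thesis using elim by (simp add: log_rate_def elog_def)
    next
      case False
      then have "ln ?m \<le> - a * n" using elim ln_le_cancel_iff[of ?m "exp (- a * n)"]
        by (simp add: zero_less_measure_iff)
      then have "ln ?m / n \<le> - a" using elim by (simp add: divide_le_eq)
      then show ?thesis using False by (simp add: log_rate_def elog_def)
    qed
  qed
qed

lemma log_rate_greater:
  fixes a :: real
  assumes "\<forall>\<^sub>F n in sequentially. exp (- a * n) \<le> measure M {\<omega> \<in> space M. L n \<omega> \<in> S}"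
  shows "- ereal a \<le> liminf (log_rate M L S)"
proof (rule Liminf_bounded)
  show "\<forall>\<^sub>F n in sequentially. - ereal a \<le> log_rate M L S n"
    using assms eventually_gt_at_top[of 0]
  proof eventually_elim
    case (elim n)
    let ?m = "measure M {\<omega> \<in> space M. L n \<omega> \<in> S}"
    have "?m > 0" using elim by (meson exp_gt_zero less_le_trans)
    then have "- a * n \<le> ln ?m" using elim ln_le_cancel_iff[of "exp (- a * n)" ?m] by simp
    then have "- a \<le> ln ?m / n" using elim by (simp add: le_divide_eq)
    then show ?case using \<open>?m > 0\<close> by (simp add: log_rate_def elog_def)
  qed
qed

lemma log_rate_tendsto_MInfty:
  fixes a :: real
  assumes "log_rate M L S \<longlonglongrightarrow> - \<infinity>"
  shows "\<forall>\<^sub>F n in sequentially. measure M {\<omega> \<in> space M. L n \<omega> \<in> S} \<le> exp (- a * n)"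
proof -
  have "\<forall>\<^sub>F n in sequentially. log_rate M L S n < ereal (- a)"
    using assms by (simp add: tendsto_MInfty)
  then show ?thesis using eventually_gt_at_top[of 0]
  proof eventually_elim
    case (elim n)
    let ?m = "measure M {\<omega> \<in> space M. L n \<omega> \<in> S}"
    show ?case
    proof (cases "?m = 0")
      case False
      then have "?m > 0" by (simp add: zero_less_measure_iff)
      have "ln ?m / n < - a" using elim False by (simp add: log_rate_def elog_def)
      then have "ln ?m \<le> - a * n" using elim by (simp add: divide_less_eq)
      then show ?thesis using \<open>?m > 0\<close> by (metis exp_le_cancel_iff exp_ln)
    qed simp
  qed
qed

lemma eventually_power_times_exp_le:
  fixes a b C :: real
  assumes "a < b"
  shows "\<forall>\<^sub>F n in sequentially. C * real n ^ k * exp (- b * n) \<le> exp (- a * n)"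
proof -
  have "filterlim (\<lambda>n. (b - a) * real n) at_top sequentially"
    using assms by (intro filterlim_tendsto_pos_mult_at_top[OF tendsto_const] filterlim_real_sequentially) auto
  then have "(\<lambda>n. ((b - a) * real n) ^ k / exp ((b - a) * real n)) \<longlonglongrightarrow> 0"
    by (rule filterlim_compose[OF tendsto_power_div_exp_0])
  then have "(\<lambda>n. C / (b - a) ^ k * (((b - a) * real n) ^ k / exp ((b - a) * real n))) \<longlonglongrightarrow> 0"
    by (rule tendsto_mult_right_zero)
  then have "\<forall>\<^sub>F n in sequentially. C / (b - a) ^ k * (((b - a) * real n) ^ k / exp ((b - a) * real n)) < 1"
    by (rule order_tendstoD) simp
  then show ?thesis
  proof eventually_elim
    case (elim n)
    have e: "exp (- b * n) / exp (- a * n) = 1 / exp ((b - a) * real n)"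
      unfolding exp_diff[symmetric] by (simp add: exp_minus[symmetric] inverse_eq_divide[symmetric] algebra_simps)
    have "(b - a) ^ k \<noteq> 0" using assms by simp
    then have "C / (b - a) ^ k * (((b - a) * real n) ^ k / exp ((b - a) * real n)) =
        C * real n ^ k * (1 / exp ((b - a) * real n))"
      using assms by (simp add: power_mult_distrib)
    with elim have "C * real n ^ k * exp (- b * n) / exp (- a * n) < 1"
      unfolding e[symmetric] by simp
    then show ?case by (simp add: divide_less_eq)
  qed
qed

lemma weak_LDP_localI:
  fixes I :: "'m \<Rightarrow> ennreal"
  assumes "prob_space M"
    and meas: "\<And>V. openin T V \<Longrightarrow> \<forall>\<^sub>F n in sequentially. {\<omega> \<in> space M. L n \<omega> \<in> V} \<in> sets M"
    and lower: "\<And>x V (a::real). x \<in> V \<Longrightarrow> openin T V \<Longrightarrow> a \<ge> 0 \<Longrightarrow> I x < ennreal a \<Longrightarrow>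
      \<forall>\<^sub>F n in sequentially. exp (- a * n) \<le> measure M {\<omega> \<in> space M. L n \<omega> \<in> V}"
    and upper: "\<And>x (a::real). x \<in> topspace T \<Longrightarrow> a \<ge> 0 \<Longrightarrow> ennreal a < I x \<Longrightarrow>
      \<exists>V. openin T V \<and> x \<in> V \<and>
        (\<forall>\<^sub>F n in sequentially. measure M {\<omega> \<in> space M. L n \<omega> \<in> V} \<le> exp (- a * n))"
  shows "weak_LDP M L T I"
  unfolding weak_LDP_def
proof (intro conjI allI impI)
  interpret prob_space M by fact
  show "lower_semicontinuous T I"
    unfolding lower_semicontinuous_def
  proof
    fix b :: ennreal
    have "openin T (topspace T - {x \<in> topspace T. I x \<le> b})"
    proof (subst openin_subopen, intro ballI)
      fix x assume "x \<in> topspace T - {x \<in> topspace T. I x \<le> b}"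
      then have x: "x \<in> topspace T" "b < I x" by auto
      then obtain c where c: "b < c" "c < I x" using dense by blast
      then obtain a where a: "c = ennreal a" "a \<ge> 0" by (cases c) auto
      obtain d where d: "b < d" "d < c" using dense c by blast
      then obtain a' where a': "d = ennreal a'" "a' \<ge> 0" by (cases d) auto
      have aa: "a' < a" using d a a' by (simp add: ennreal_less_iff)
      obtain V where V: "openin T V" "x \<in> V"
        "\<forall>\<^sub>F n in sequentially. measure M {\<omega> \<in> space M. L n \<omega> \<in> V} \<le> exp (- a * n)"
        using upper[OF x(1), of a] c a by auto
      have "V \<subseteq> topspace T - {x \<in> topspace T. I x \<le> b}"
      proof
        fix y assume y: "y \<in> V"
        have "\<not> I y \<le> b"
        proof
          assume "I y \<le> b"
          then have "I y < ennreal a'" using d a' by simp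
          from lower[OF y V(1) a'(2) this] V(3) eventually_gt_at_top[of 0]
          have "\<forall>\<^sub>F n::nat in sequentially. False"
          proof eventually_elim
            case (elim n)
            then have "exp (- a' * n) \<le> exp (- a * n)" by linarith
            with aa elim(3) show ?case by simp
          qed
          then show False by simp
        qed
        then show "y \<in> topspace T - {x \<in> topspace T. I x \<le> b}"
          using y openin_subset[OF V(1)] by auto
      qed
      with V show "\<exists>V. openin T V \<and> x \<in> V \<and> V \<subseteq> topspace T - {x \<in> topspace T. I x \<le> b}" by blast
    qed
    then show "closedin T {x \<in> topspace T. I x \<le> b}"
      by (simp add: closedin_def)
  qed
  show "- (INF x\<in>G. enn2ereal (I x)) \<le> liminf (log_rate M L G)" if G: "openin T G" for G
  proof -
    have "- liminf (log_rate M L G) \<le> enn2ereal (I x)" if x: "x \<in> G" for x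
    proof (rule dense_ge)
      fix z assume z: "enn2ereal (I x) < z"
      then have "z > 0" by (meson enn2ereal_nonneg le_less_trans)
      show "- liminf (log_rate M L G) \<le> z"
      proof (cases z)
        case (real a)
        then have "a \<ge> 0" "I x < ennreal a"
          using z \<open>z > 0\<close> by (auto simp: less_ennreal.rep_eq enn2ereal_ennreal)
        from log_rate_greater[OF lower[OF x G this]] real
        show ?thesis by (metis ereal_minus_le_minus ereal_uminus_uminus)
      qed (use \<open>z > 0\<close> in auto)
    qed
    then have "- liminf (log_rate M L G) \<le> (INF x\<in>G. enn2ereal (I x))" by (rule INF_greatest)
    then show ?thesis by (metis ereal_minus_le_minus ereal_uminus_uminus)
  qed
  show "limsup (log_rate M L F) \<le> - (INF x\<in>F. enn2ereal (I x))" if F: "compactin T F" for F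
  proof (rule dense_ge)
    fix z assume z: "- (INF x\<in>F. enn2ereal (I x)) < z"
    define w where "w = - z"
    have w: "w < (INF x\<in>F. enn2ereal (I x))" using z by (simp add: w_def ereal_uminus_less_reorder)
    show "limsup (log_rate M L F) \<le> z"
    proof (cases "w \<le> 0")
      case True
      have "limsup (log_rate M L F) \<le> - ereal 0" by (rule log_rate_less) simp
      also have "- ereal 0 \<le> z" using True unfolding w_def by (cases z) auto
      finally show ?thesis .
    next
      case False
      show ?thesis
      proof (cases w)
        case (real a)
        then have a: "a > 0" using False by simp
        have "\<exists>b>a. ereal b < (INF x\<in>F. enn2ereal (I x))"
          using w real ereal_dense2[of w] by (metis ereal_less(2) less_ereal.simps(1))
        then obtain b where b: "b > a" "ereal b < (INF x\<in>F. enn2ereal (I x))" by blast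
        have "\<forall>x\<in>F. \<exists>V. openin T V \<and> x \<in> V \<and>
          (\<forall>\<^sub>F n in sequentially. measure M {\<omega> \<in> space M. L n \<omega> \<in> V} \<le> exp (- b * n))"
        proof (intro ballI upper)
          fix x assume x: "x \<in> F"
          show "x \<in> topspace T" using F x by (auto simp: compactin_def)
          show "b \<ge> 0" using a b by simp
          have "ereal b < enn2ereal (I x)" using b(2) x by (meson INF_lower less_le_trans)
          then show "ennreal b < I x"
            using \<open>b \<ge> 0\<close> by (simp add: less_ennreal.rep_eq enn2ereal_ennreal)
        qed
        then obtain V where V: "\<forall>x\<in>F. openin T (V x) \<and> x \<in> V x \<and>
          (\<forall>\<^sub>F n in sequentially. measure M {\<omega> \<in> space M. L n \<omega> \<in> V x} \<le> exp (- b * n))"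
          by (rule bchoice[THEN exE])
        have "\<forall>U\<in>V ` F. openin T U" "F \<subseteq> \<Union>(V ` F)" using V by auto
        then have "\<exists>D. finite D \<and> D \<subseteq> V ` F \<and> F \<subseteq> \<Union>D"
          using F unfolding compactin_def by blast
        then obtain H where H: "finite H" "H \<subseteq> F" "F \<subseteq> (\<Union>x\<in>H. V x)"
          by (metis finite_subset_image)
        have "\<forall>\<^sub>F n in sequentially. \<forall>x\<in>H. {\<omega> \<in> space M. L n \<omega> \<in> V x} \<in> sets M \<and>
            measure M {\<omega> \<in> space M. L n \<omega> \<in> V x} \<le> exp (- b * n)"
          using H V meas by (intro eventually_ball_finite ballI eventually_conj) blast+
        moreover have "\<forall>\<^sub>F n in sequentially. real (card H) * real n ^ 0 * exp (- b * n) \<le> exp (- a * n)"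
          using b(1) by (rule eventually_power_times_exp_le)
        ultimately have "\<forall>\<^sub>F n in sequentially. measure M {\<omega> \<in> space M. L n \<omega> \<in> F} \<le> exp (- a * n)"
        proof eventually_elim
          case (elim n)
          have "measure M {\<omega> \<in> space M. L n \<omega> \<in> F} \<le> measure M (\<Union>x\<in>H. {\<omega> \<in> space M. L n \<omega> \<in> V x})"
            using H elim by (intro finite_measure_mono sets.finite_UN) blast+
          also have "\<dots> \<le> (\<Sum>x\<in>H. measure M {\<omega> \<in> space M. L n \<omega> \<in> V x})"
            using H elim by (intro finite_measure_subadditive_finite image_subsetI) blast+
          also have "\<dots> \<le> real (card H) * exp (- b * n)"
            using elim by (intro sum_bounded_above) blast
          also have "\<dots> \<le> exp (- a * n)" using elim(2) by simp
          finally show ?case .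
        qed
        from log_rate_less[OF this] show ?thesis
          using real unfolding w_def by (cases z) auto
      next
        case PInf
        then show ?thesis using w by simp
      qed (use False in auto)
    qed
  qed
qed

section \<open>The Markov property in terms of the densities\<close>

lemma continuous_on_Some: "continuous_on UNIV (Some :: 'a::topological_space \<Rightarrow> 'a option)"
  by (simp add: continuous_on_open_vimage open_option_def)

lemma measurable_Some_borel [measurable]:
  "(Some :: 'a::topological_space \<Rightarrow> 'a option) \<in> borel \<rightarrow>\<^sub>M borel"
  by (rule borel_measurable_continuous_onI[OF continuous_on_Some])

lemma measurable_pathI:
  fixes f :: "'b \<Rightarrow> nat \<Rightarrow> 'a::second_countable_topology"
  assumes "\<And>i. (\<lambda>x. f x i) \<in> N \<rightarrow>\<^sub>M borel"
  shows "f \<in> N \<rightarrow>\<^sub>M borel"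
proof -
  have "f \<in> N \<rightarrow>\<^sub>M (\<Pi>\<^sub>M i\<in>UNIV. borel)"
    by (rule measurable_PiM_single') (auto intro!: assms)
  then show ?thesis by (simp add: sets_PiM_equal_borel cong: measurable_cong_sets)
qed

lemma measurable_path_component:
  "(\<lambda>u :: nat \<Rightarrow> 'a::topological_space. u i) \<in> borel \<rightarrow>\<^sub>M borel"
  by (intro borel_measurable_continuous_onI continuous_on_product_coordinates)

locale density_chain =
  fixes \<beta> :: "'a::euclidean_space measure"
    and p :: "'a \<Rightarrow> 'a measure"
    and \<rho> :: "'a option \<Rightarrow> 'a \<Rightarrow> real"
    and M :: "'w measure"
    and X :: "nat \<Rightarrow> 'w \<Rightarrow> 'a"
  assumes initial_law: "\<beta> \<in> prob_measures"
    and kernel: "p \<in> borel \<rightarrow>\<^sub>M prob_algebra borel"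
    and density_nonneg: "\<And>x y. \<rho> x y \<ge> 0"
    and density_measurable: "(\<lambda>(x, y). \<rho> x y) \<in> borel_measurable (borel \<Otimes>\<^sub>M borel)"
    and density: "\<And>x A. A \<in> sets borel \<Longrightarrow>
          emeasure (case x of None \<Rightarrow> \<beta> | Some z \<Rightarrow> p z) A = (\<integral>\<^sup>+y\<in>A. ennreal (\<rho> x y) \<partial>lborel)"
    and chain: "markov_chain M X \<beta> p"
begin

sublocale prob_space M
  using chain unfolding markov_chain_def by blast

text \<open>Starting \<open>Y\<close> at time 0 from the extra point makes the initial law a transition like any
  other; the value of \<open>X 0\<close> is never used.\<close>

definition Y :: "nat \<Rightarrow> 'w \<Rightarrow> 'a option"
  where "Y n \<omega> = (if n = 0 then None else Some (X n \<omega>))"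

lemma measurable_density [measurable]:
  assumes [measurable]: "f \<in> N \<rightarrow>\<^sub>M borel" "g \<in> N \<rightarrow>\<^sub>M borel"
  shows "(\<lambda>x. \<rho> (f x) (g x)) \<in> borel_measurable N"
proof -
  have "(\<lambda>x. (f x, g x)) \<in> N \<rightarrow>\<^sub>M borel \<Otimes>\<^sub>M borel" by simp
  from measurable_compose[OF this density_measurable] show ?thesis by simp
qed

lemma measurable_iter_density:
  "(\<lambda>(x, y). iter_density \<rho> k x y) \<in> borel_measurable (borel \<Otimes>\<^sub>M borel)"
proof (induction k rule: induct_nat_012)
  case (ge2 k)
  have [measurable]: "(\<lambda>z. iter_density \<rho> (Suc k) (f z) (g z)) \<in> borel_measurable N"
    if [measurable]: "f \<in> N \<rightarrow>\<^sub>M borel" "g \<in> N \<rightarrow>\<^sub>M borel" for f g and N :: "(('a option \<times> 'a) \<times> 'a) measure"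
  proof -
    have "(\<lambda>x. (f x, g x)) \<in> N \<rightarrow>\<^sub>M borel \<Otimes>\<^sub>M borel" by simp
    from measurable_compose[OF this ge2(2)] show ?thesis by simp
  qed
  show ?case by simp
qed simp_all

lemma measurable_iter_density' [measurable]:
  assumes [measurable]: "f \<in> N \<rightarrow>\<^sub>M borel" "g \<in> N \<rightarrow>\<^sub>M borel"
  shows "(\<lambda>x. iter_density \<rho> k (f x) (g x)) \<in> borel_measurable N"
proof -
  have "(\<lambda>x. (f x, g x)) \<in> N \<rightarrow>\<^sub>M borel \<Otimes>\<^sub>M borel" by simp
  from measurable_compose[OF this measurable_iter_density] show ?thesis by simp
qed

lemma measurable_X [measurable]: "n \<ge> 1 \<Longrightarrow> X n \<in> M \<rightarrow>\<^sub>M borel"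
  using chain unfolding markov_chain_def by blast

lemma space_past [simp]: "space (past M X n) = space M"
  by (simp add: past_def)

lemma measurable_X_past:
  assumes "1 \<le> i" "i \<le> n" shows "X i \<in> past M X n \<rightarrow>\<^sub>M borel"
proof -
  have "(\<lambda>\<omega>. \<lambda>i\<in>{1..n}. X i \<omega>) \<in> past M X n \<rightarrow>\<^sub>M (\<Pi>\<^sub>M i\<in>{1..n}. borel)"
    unfolding past_def by (rule measurable_vimage_algebra1) (auto simp: space_PiM)
  from measurable_compose[OF this measurable_component_singleton[of i "{1..n}" "\<lambda>_. borel"]]
  show ?thesis using assms by simp
qed

lemma sets_past_le:
  assumes "space N = space M" "\<And>i. 1 \<le> i \<Longrightarrow> i \<le> n \<Longrightarrow> X i \<in> N \<rightarrow>\<^sub>M borel"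
  shows "sets (past M X n) \<subseteq> sets N"
proof -
  have "(\<lambda>\<omega>. \<lambda>i\<in>{1..n}. X i \<omega>) \<in> N \<rightarrow>\<^sub>M (\<Pi>\<^sub>M i\<in>{1..n}. borel)"
    by (rule measurable_restrict) (use assms in auto)
  then show ?thesis unfolding past_def measurable_iff_sets assms(1) by blast
qed

lemma sets_past_mono: "m \<le> n \<Longrightarrow> sets (past M X m) \<subseteq> sets (past M X n)"
  by (rule sets_past_le) (auto intro: measurable_X_past)

lemma sets_past_subset: "sets (past M X n) \<subseteq> sets M"
  by (rule sets_past_le) auto

lemma subalgebra_past: "subalgebra M (past M X n)"
  by (simp add: subalgebra_def sets_past_subset)

lemma past_event [simp]: "A \<in> sets (past M X n) \<Longrightarrow> A \<in> sets M"
  using sets_past_subset by blast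

lemma measurable_Y_past [measurable]: "Y n \<in> past M X n \<rightarrow>\<^sub>M borel"
proof (cases "n = 0")
  case False
  then have [measurable]: "X n \<in> past M X n \<rightarrow>\<^sub>M borel" by (intro measurable_X_past) auto
  show ?thesis using False unfolding Y_def by simp
qed (simp add: Y_def[abs_def])

lemma sets_past_0: "sets (past M X 0) = {{}, space M}"
proof -
  have "past M X 0 = vimage_algebra (space M) (\<lambda>\<omega> (k :: nat). undefined) (\<Pi>\<^sub>M i\<in>{}. borel :: 'a measure)"
    by (simp add: past_def restrict_def)
  also have "sets \<dots> = {(\<lambda>\<omega> (k :: nat). undefined) -` A \<inter> space M | A. A \<in> sets (\<Pi>\<^sub>M i\<in>{}. borel :: 'a measure)}"
    by (rule sets_vimage_algebra2) (simp add: space_PiM_empty)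
  also have "\<dots> = {{}, space M}"
    by (auto simp: sets_PiM_empty)
  finally show ?thesis .
qed

lemma measurable_from_past: "f \<in> past M X n \<rightarrow>\<^sub>M N \<Longrightarrow> f \<in> M \<rightarrow>\<^sub>M N"
  using measurable_from_subalg[OF subalgebra_past] .

lemma measurable_Y [measurable]: "Y n \<in> M \<rightarrow>\<^sub>M borel"
  by (rule measurable_from_past) (rule measurable_Y_past)

lemma transition_rectangle:
  assumes A: "A \<in> sets (past M X n)" and B [measurable]: "B \<in> sets borel"
  shows "emeasure M (A \<inter> (X (Suc n) -` B \<inter> space M)) =
    (\<integral>\<^sup>+\<omega>\<in>A. (\<integral>\<^sup>+z\<in>B. ennreal (\<rho> (Y n \<omega>) z) \<partial>lborel) \<partial>M)"
proof (cases "n = 0")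
  case True
  have "emeasure M (X 1 -` B \<inter> space M) = emeasure \<beta> B"
  proof -
    have "distr M borel (X 1) = \<beta>" using chain unfolding markov_chain_def by blast
    then show ?thesis using emeasure_distr[of "X 1" M borel B] by simp
  qed
  then have "emeasure M (X 1 -` B \<inter> space M) = (\<integral>\<^sup>+z\<in>B. ennreal (\<rho> None z) \<partial>lborel)"
    using density[of B None] by simp
  moreover have "A = {} \<or> A = space M" using A True by (simp add: sets_past_0)
  ultimately show ?thesis using True
    by (auto simp: Y_def Int_absorb1 emeasure_space_1 cong: nn_integral_cong)
next
  case False
  have [measurable]: "X (Suc n) \<in> M \<rightarrow>\<^sub>M borel" "X n \<in> M \<rightarrow>\<^sub>M borel" using False by auto
  have AM [measurable]: "A \<in> sets M" using A by simp
  interpret fs: finite_measure_subalgebra M "past M X n"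
    by unfold_locales (rule subalgebra_past)
  have c: "AE \<omega> in M. real_cond_exp M (past M X n) (indicator (X (Suc n) -` B)) \<omega> = measure (p (X n \<omega>)) B"
  proof -
    have "\<forall>n\<ge>1. \<forall>A\<in>sets borel. AE \<omega> in M.
        real_cond_exp M (past M X n) (indicator (X (Suc n) -` A)) \<omega> = measure (p (X n \<omega>)) A"
      using chain unfolding markov_chain_def by blast
    from this[rule_format, OF _ B, of n] False show ?thesis by linarith
  qed
  have pX: "prob_space (p x)" "sets (p x) = sets borel" for x
    using measurable_space[OF kernel, of x] by (auto simp: space_prob_algebra)
  have pm: "emeasure (p x) B = ennreal (measure (p x) B)" for x
  proof -
    interpret q: prob_space "p x" by (rule pX)
    show ?thesis by (rule q.emeasure_eq_measure)
  qed
  have [measurable]: "(\<lambda>x. measure (p x) B) \<in> borel_measurable borel"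
  proof -
    have "(\<lambda>x. emeasure (p x) B) \<in> borel_measurable borel"
      by (rule measurable_compose[OF measurable_prob_algebraD[OF kernel] measurable_emeasure_subprob_algebra[OF B]])
    then show ?thesis unfolding measure_def by measurable
  qed
  have le1: "measure (p x) B \<le> 1" for x
    using prob_space.prob_le_1[OF pX(1)] .
  have im: "integrable M (indicator (X (Suc n) -` B) :: 'w \<Rightarrow> real)"
  proof -
    have "integrable M (indicator (X (Suc n) -` B \<inter> space M) :: 'w \<Rightarrow> real)"
      by (rule integrable_real_indicator) (auto simp: emeasure_eq_measure)
    moreover have "integrable M (indicator (X (Suc n) -` B \<inter> space M) :: 'w \<Rightarrow> real) \<longleftrightarrow>
        integrable M (indicator (X (Suc n) -` B) :: 'w \<Rightarrow> real)"
      by (rule Bochner_Integration.integrable_cong[OF refl]) (auto simp: indicator_def)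
    ultimately show ?thesis by blast
  qed
  have "measure M (A \<inter> (X (Suc n) -` B \<inter> space M)) = (\<integral>\<omega>\<in>A. indicator (X (Suc n) -` B) \<omega> \<partial>M)"
  proof -
    have "(\<integral>\<omega>\<in>A. indicator (X (Suc n) -` B) \<omega> \<partial>M) =
        (\<integral>\<omega>. indicator (A \<inter> (X (Suc n) -` B \<inter> space M)) \<omega> \<partial>M)"
      unfolding set_lebesgue_integral_def
      by (intro Bochner_Integration.integral_cong) (auto simp: indicator_def)
    also have "\<dots> = measure M (A \<inter> (X (Suc n) -` B \<inter> space M))"
      by (simp add: Int_assoc)
    finally show ?thesis by simp
  qed
  also have "\<dots> = (\<integral>\<omega>\<in>A. real_cond_exp M (past M X n) (indicator (X (Suc n) -` B)) \<omega> \<partial>M)"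
    by (rule fs.real_cond_exp_intA[OF im A])
  also have "\<dots> = (\<integral>\<omega>\<in>A. measure (p (X n \<omega>)) B \<partial>M)"
    unfolding set_lebesgue_integral_def
    by (intro integral_cong_AE) (use c in \<open>auto intro: measurable_from_past[OF borel_measurable_cond_exp]\<close>)
  finally have "emeasure M (A \<inter> (X (Suc n) -` B \<inter> space M)) = ennreal (\<integral>\<omega>\<in>A. measure (p (X n \<omega>)) B \<partial>M)"
    by (simp add: emeasure_eq_measure)
  also have "\<dots> = (\<integral>\<^sup>+\<omega>. ennreal (indicator A \<omega> * measure (p (X n \<omega>)) B) \<partial>M)"
    unfolding set_lebesgue_integral_def real_scaleR_def
    by (subst nn_integral_eq_integral)
      (auto intro!: integrable_const_bound[where B=1] simp: le1 indicator_def)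
  also have "\<dots> = (\<integral>\<^sup>+\<omega>\<in>A. emeasure (p (X n \<omega>)) B \<partial>M)"
    by (intro nn_integral_cong) (auto simp: pm indicator_def)
  also have "\<dots> = (\<integral>\<^sup>+\<omega>\<in>A. (\<integral>\<^sup>+z\<in>B. ennreal (\<rho> (Y n \<omega>) z) \<partial>lborel) \<partial>M)"
    using density[of B "Some _"] False by (simp add: Y_def)
  finally show ?thesis .
qed

lemma one_step:
  fixes h :: "'w \<times> 'a \<Rightarrow> ennreal"
  assumes h: "h \<in> borel_measurable (past M X n \<Otimes>\<^sub>M borel)"
  shows "(\<integral>\<^sup>+\<omega>. h (\<omega>, X (Suc n) \<omega>) \<partial>M) =
    (\<integral>\<^sup>+\<omega>. (\<integral>\<^sup>+z. ennreal (\<rho> (Y n \<omega>) z) * h (\<omega>, z) \<partial>lborel) \<partial>M)"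
proof -
  let ?P = "past M X n"
  define R where "R = restr_to_subalg M ?P"
  have sR [measurable_cong]: "sets R = sets ?P" and spR: "space R = space M"
    using sets_restr_to_subalg[OF subalgebra_past] by (simp_all add: R_def space_restr_to_subalg)
  have [measurable]: "h \<in> borel_measurable (R \<Otimes>\<^sub>M borel)"
    using h by (simp cong: measurable_cong_sets)
  have Xm: "(\<lambda>\<omega>. (\<omega>, X (Suc n) \<omega>)) \<in> M \<rightarrow>\<^sub>M R \<Otimes>\<^sub>M borel"
  proof (rule measurable_Pair)
    show "(\<lambda>\<omega>. \<omega>) \<in> M \<rightarrow>\<^sub>M R"
      by (rule measurableI) (use sets_past_subset in \<open>auto simp: spR sR Int_absorb2 sets.sets_into_space\<close>)
  qed simp
  have Ym [measurable]: "Y n \<in> R \<rightarrow>\<^sub>M borel" using measurable_Y_past by (simp cong: measurable_cong_sets)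
  have sub: "(\<integral>\<^sup>+x. f x \<partial>R) = (\<integral>\<^sup>+x. f x \<partial>M)" if "f \<in> borel_measurable R" for f
    unfolding R_def using that by (intro nn_integral_subalgebra2[OF subalgebra_past]) (simp cong: measurable_cong_sets)
  define \<nu>1 where "\<nu>1 = distr M (R \<Otimes>\<^sub>M borel) (\<lambda>\<omega>. (\<omega>, X (Suc n) \<omega>))"
  define \<nu>2 where "\<nu>2 = density (R \<Otimes>\<^sub>M lborel) (\<lambda>(\<omega>, z). ennreal (\<rho> (Y n \<omega>) z))"
  let ?E = "{a \<times> b | a b. a \<in> sets R \<and> b \<in> sets (borel :: 'a measure)}"
  have "\<nu>1 = \<nu>2"
  proof (rule measure_eqI_generator_eq[where E = ?E and \<Omega> = "space R \<times> UNIV" and A = "\<lambda>_. space R \<times> UNIV"])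
    show "Int_stable ?E" using Int_stable_pair_measure_generator[of R borel] by simp
    show "?E \<subseteq> Pow (space R \<times> UNIV)" using sets.space_closed[of R] by auto
    show "sets \<nu>1 = sigma_sets (space R \<times> UNIV) ?E"
      by (simp add: \<nu>1_def sets_pair_measure)
    show "sets \<nu>2 = sigma_sets (space R \<times> UNIV) ?E"
      by (simp add: \<nu>2_def sets_pair_measure)
    show "range (\<lambda>_. space R \<times> UNIV) \<subseteq> ?E"
      by (intro image_subsetI CollectI exI[of _ "space R"] exI[of _ UNIV] conjI) simp_all
    show "(\<Union>i. space R \<times> UNIV) = space R \<times> (UNIV :: 'a set)" by simp
    show "emeasure \<nu>1 (space R \<times> UNIV) \<noteq> \<infinity>" for i :: nat
      using emeasure_distr[OF Xm, of "space R \<times> UNIV"] by (simp add: \<nu>1_def emeasure_eq_measure)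
    fix Z assume "Z \<in> ?E"
    then obtain a b where Z: "Z = a \<times> b" and a: "a \<in> sets R" and b [measurable]: "b \<in> sets borel" by blast
    have [measurable]: "a \<in> sets R" by (rule a)
    have "emeasure \<nu>1 Z = emeasure M (a \<inter> (X (Suc n) -` b \<inter> space M))"
      unfolding \<nu>1_def Z by (subst emeasure_distr[OF Xm]) (auto intro!: arg_cong[where f = "emeasure M"])
    also have "\<dots> = (\<integral>\<^sup>+\<omega>\<in>a. (\<integral>\<^sup>+z\<in>b. ennreal (\<rho> (Y n \<omega>) z) \<partial>lborel) \<partial>M)"
      using a by (intro transition_rectangle) (simp_all add: sR)
    also have "\<dots> = (\<integral>\<^sup>+\<omega>\<in>a. (\<integral>\<^sup>+z\<in>b. ennreal (\<rho> (Y n \<omega>) z) \<partial>lborel) \<partial>R)"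
      by (rule sub[symmetric]) simp
    also have "\<dots> = (\<integral>\<^sup>+\<omega>. (\<integral>\<^sup>+z. ennreal (\<rho> (Y n \<omega>) z) * indicator Z (\<omega>, z) \<partial>lborel) \<partial>R)"
      by (intro nn_integral_cong) (auto simp: Z indicator_def)
    also have "\<dots> = emeasure \<nu>2 Z"
      unfolding \<nu>2_def
      by (subst emeasure_density) (simp_all add: lborel.nn_integral_fst[symmetric] Z split_beta)
    finally show "emeasure \<nu>1 Z = emeasure \<nu>2 Z" .
  qed
  have "(\<integral>\<^sup>+\<omega>. h (\<omega>, X (Suc n) \<omega>) \<partial>M) = (\<integral>\<^sup>+z. h z \<partial>\<nu>1)"
    unfolding \<nu>1_def by (rule nn_integral_distr[symmetric, OF Xm]) simp
  also have "\<dots> = (\<integral>\<^sup>+z. h z \<partial>\<nu>2)" using \<open>\<nu>1 = \<nu>2\<close> by simp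
  also have "\<dots> = (\<integral>\<^sup>+\<omega>. (\<integral>\<^sup>+z. ennreal (\<rho> (Y n \<omega>) z) * h (\<omega>, z) \<partial>lborel) \<partial>R)"
    unfolding \<nu>2_def
    by (subst nn_integral_density) (simp_all add: lborel.nn_integral_fst[symmetric] split_beta)
  also have "\<dots> = (\<integral>\<^sup>+\<omega>. (\<integral>\<^sup>+z. ennreal (\<rho> (Y n \<omega>) z) * h (\<omega>, z) \<partial>lborel) \<partial>M)"
    by (rule sub) simp
  finally show ?thesis .
qed

lemma multi_step:
  assumes A: "A \<in> sets (past M X n)" and s: "s \<ge> 1" and [measurable]: "h \<in> borel_measurable borel"
  shows "(\<integral>\<^sup>+\<omega>\<in>A. h (X (n + s) \<omega>) \<partial>M) =
    (\<integral>\<^sup>+\<omega>\<in>A. (\<integral>\<^sup>+y. iter_density \<rho> s (Y n \<omega>) y * h y \<partial>lborel) \<partial>M)"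
proof -
  obtain r where "s = Suc r" using s by (cases s) auto
  have [measurable]: "A \<in> sets (past M X n)" by fact
  have "(\<integral>\<^sup>+\<omega>\<in>A. h (X (n + Suc r) \<omega>) \<partial>M) =
      (\<integral>\<^sup>+\<omega>\<in>A. (\<integral>\<^sup>+y. iter_density \<rho> (Suc r) (Y n \<omega>) y * h y \<partial>lborel) \<partial>M)"
    using assms(3)
  proof (induction r arbitrary: h)
    case 0
    note [measurable] = 0
    have "(\<integral>\<^sup>+\<omega>\<in>A. h (X (n + Suc 0) \<omega>) \<partial>M) =
        (\<integral>\<^sup>+\<omega>. (\<integral>\<^sup>+z. ennreal (\<rho> (Y n \<omega>) z) * (h z * indicator A \<omega>) \<partial>lborel) \<partial>M)"
      using one_step[of "\<lambda>(\<omega>, z). h z * indicator A \<omega>" n] by simp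
    also have "\<dots> = (\<integral>\<^sup>+\<omega>\<in>A. (\<integral>\<^sup>+z. ennreal (\<rho> (Y n \<omega>) z) * h z \<partial>lborel) \<partial>M)"
      by (intro nn_integral_cong) (auto simp: indicator_def)
    finally show ?case by simp
  next
    case (Suc s')
    note [measurable] = Suc.prems
    define s where s': "s = Suc s'"
    have [measurable]: "A \<in> sets (past M X (n + s))"
      using A sets_past_mono[of n "n + s"] by auto
    have [measurable]: "Y (n + s) \<in> past M X (n + s) \<rightarrow>\<^sub>M borel" by simp
    have "(\<integral>\<^sup>+\<omega>\<in>A. h (X (n + Suc s) \<omega>) \<partial>M) =
        (\<integral>\<^sup>+\<omega>. (\<integral>\<^sup>+z. ennreal (\<rho> (Y (n + s) \<omega>) z) * (h z * indicator A \<omega>) \<partial>lborel) \<partial>M)"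
      using one_step[of "\<lambda>(\<omega>, z). h z * indicator A \<omega>" "n + s"] by simp
    also have "\<dots> = (\<integral>\<^sup>+\<omega>\<in>A. (\<integral>\<^sup>+z. ennreal (\<rho> (Some (X (n + s) \<omega>)) z) * h z \<partial>lborel) \<partial>M)"
      using s' by (intro nn_integral_cong) (auto simp: indicator_def Y_def)
    also have "\<dots> = (\<integral>\<^sup>+\<omega>\<in>A. (\<integral>\<^sup>+y. iter_density \<rho> s (Y n \<omega>) y *
        (\<integral>\<^sup>+z. ennreal (\<rho> (Some y) z) * h z \<partial>lborel) \<partial>lborel) \<partial>M)"
      unfolding s' by (rule Suc.IH) simp
    also have "\<dots> = (\<integral>\<^sup>+\<omega>\<in>A. (\<integral>\<^sup>+z. iter_density \<rho> (Suc s) (Y n \<omega>) z * h z \<partial>lborel) \<partial>M)"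
    proof (rule nn_integral_cong, rule arg_cong2[where f = "(*)"])
      fix \<omega>
      have "(\<integral>\<^sup>+y. iter_density \<rho> s (Y n \<omega>) y * (\<integral>\<^sup>+z. ennreal (\<rho> (Some y) z) * h z \<partial>lborel) \<partial>lborel) =
          (\<integral>\<^sup>+y. (\<integral>\<^sup>+z. iter_density \<rho> s (Y n \<omega>) y * (ennreal (\<rho> (Some y) z) * h z) \<partial>lborel) \<partial>lborel)"
        by (intro nn_integral_cong nn_integral_cmult[symmetric]) simp
      also have "\<dots> = (\<integral>\<^sup>+z. (\<integral>\<^sup>+y. iter_density \<rho> s (Y n \<omega>) y * (ennreal (\<rho> (Some y) z) * h z) \<partial>lborel) \<partial>lborel)"
        by (rule lborel_pair.Fubini') simp
      also have "\<dots> = (\<integral>\<^sup>+z. iter_density \<rho> (Suc s) (Y n \<omega>) z * h z \<partial>lborel)"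
        by (intro nn_integral_cong) (simp add: s' nn_integral_multc[symmetric] mult.assoc)
      finally show "(\<integral>\<^sup>+y. iter_density \<rho> s (Y n \<omega>) y * (\<integral>\<^sup>+z. ennreal (\<rho> (Some y) z) * h z \<partial>lborel) \<partial>lborel) =
          (\<integral>\<^sup>+z. iter_density \<rho> (Suc s) (Y n \<omega>) z * h z \<partial>lborel)" .
    qed (rule refl)
    finally show ?case by (simp only: s')
  qed
  then show ?thesis by (simp only: \<open>s = Suc r\<close>)
qed

lemma path_functional:
  fixes H :: "(nat \<Rightarrow> 'a) \<Rightarrow> ennreal"
  assumes "H \<in> borel_measurable borel" "\<And>u v. (\<And>i. i \<le> b \<Longrightarrow> u i = v i) \<Longrightarrow> H u = H v"
  shows "\<exists>g \<in> borel_measurable borel.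
    \<forall>t\<ge>1. \<forall>A\<in>sets (past M X t). (\<integral>\<^sup>+\<omega>\<in>A. H (\<lambda>i. X (t + i) \<omega>) \<partial>M) = (\<integral>\<^sup>+\<omega>\<in>A. g (X t \<omega>) \<partial>M)"
  using assms
proof (induction b arbitrary: H)
  case 0
  note [measurable] = 0(1)
  have [measurable]: "(\<lambda>y :: 'a. \<lambda>i :: nat. y) \<in> borel \<rightarrow>\<^sub>M borel" by (rule measurable_pathI) simp
  have "H (\<lambda>i. X (t + i) \<omega>) = H (\<lambda>i. X t \<omega>)" for t \<omega>
    by (rule 0(2)) simp
  then show ?case
    by (intro bexI[of _ "\<lambda>y. H (\<lambda>i. y)"]) simp_all
next
  case (Suc b)
  note [measurable] = Suc.prems(1)
  define H' where "H' u = (\<integral>\<^sup>+z. ennreal (\<rho> (Some (u b)) z) * H (u(Suc b := z)) \<partial>lborel)" for u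
  have [measurable]: "(\<lambda>(u, z). u(Suc b := z)) \<in> borel \<Otimes>\<^sub>M borel \<rightarrow>\<^sub>M (borel :: (nat \<Rightarrow> 'a) measure)"
  proof (rule measurable_pathI)
    fix i show "(\<lambda>x. (case x of (u, z) \<Rightarrow> u(Suc b := z)) i) \<in> borel \<Otimes>\<^sub>M borel \<rightarrow>\<^sub>M (borel :: 'a measure)"
      using measurable_compose[OF measurable_fst measurable_path_component]
      by (cases "i = Suc b") (simp_all add: split_beta)
  qed
  have [measurable]: "(\<lambda>x :: (nat \<Rightarrow> 'a) \<times> 'a. fst x b) \<in> borel \<Otimes>\<^sub>M borel \<rightarrow>\<^sub>M borel"
    using measurable_compose[OF measurable_fst measurable_path_component] .
  have [measurable]: "H' \<in> borel_measurable borel" unfolding H'_def by measurable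
  have "\<exists>g \<in> borel_measurable borel. \<forall>t\<ge>1. \<forall>A\<in>sets (past M X t).
      (\<integral>\<^sup>+\<omega>\<in>A. H' (\<lambda>i. X (t + i) \<omega>) \<partial>M) = (\<integral>\<^sup>+\<omega>\<in>A. g (X t \<omega>) \<partial>M)"
  proof (rule Suc.IH)
    fix u v :: "nat \<Rightarrow> 'a" assume *: "\<And>i. i \<le> b \<Longrightarrow> u i = v i"
    have "H (u(Suc b := z)) = H (v(Suc b := z))" for z
      by (rule Suc.prems(2)) (use * in \<open>auto simp: le_Suc_eq\<close>)
    then show "H' u = H' v" using * by (simp add: H'_def)
  qed simp
  moreover have "(\<integral>\<^sup>+\<omega>\<in>A. H (\<lambda>i. X (t + i) \<omega>) \<partial>M) = (\<integral>\<^sup>+\<omega>\<in>A. H' (\<lambda>i. X (t + i) \<omega>) \<partial>M)"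
    if t: "t \<ge> 1" and A: "A \<in> sets (past M X t)" for t A
  proof -
    have [measurable]: "A \<in> sets (past M X (t + b))"
      using A sets_past_mono[of t "t + b"] by auto
    define U where "U \<omega> = (\<lambda>i. X (t + min i b) \<omega>)" for \<omega>
    have [measurable]: "U \<in> past M X (t + b) \<rightarrow>\<^sub>M borel"
      unfolding U_def by (rule measurable_pathI, rule measurable_X_past) (use t in auto)
    have eq: "H (\<lambda>i. X (t + i) \<omega>) = H ((U \<omega>)(Suc b := X (Suc (t + b)) \<omega>))" for \<omega>
      by (rule Suc.prems(2)) (auto simp: U_def le_Suc_eq)
    have eq': "H ((U \<omega>)(Suc b := z)) = H ((\<lambda>i. X (t + i) \<omega>)(Suc b := z))" for \<omega> z
      by (rule Suc.prems(2)) (auto simp: U_def le_Suc_eq)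
    have "(\<integral>\<^sup>+\<omega>\<in>A. H (\<lambda>i. X (t + i) \<omega>) \<partial>M) = (\<integral>\<^sup>+\<omega>.
        (\<integral>\<^sup>+z. ennreal (\<rho> (Y (t + b) \<omega>) z) * (H ((U \<omega>)(Suc b := z)) * indicator A \<omega>) \<partial>lborel) \<partial>M)"
      using one_step[of "\<lambda>(\<omega>, z). H ((U \<omega>)(Suc b := z)) * indicator A \<omega>" "t + b"]
      by (simp add: eq)
    also have "\<dots> = (\<integral>\<^sup>+\<omega>\<in>A. H' (\<lambda>i. X (t + i) \<omega>) \<partial>M)"
      using t by (intro nn_integral_cong) (auto simp: H'_def eq' Y_def indicator_def)
    finally show ?thesis .
  qed
  ultimately show ?case by auto
qed

text \<open>The function \<open>g y\<close> is the probability that the chain started at \<open>y\<close> follows a path in \<open>B\<close>.\<close>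

lemma markov_property:
  fixes B :: "(nat \<Rightarrow> 'a) set"
  assumes [measurable]: "B \<in> sets borel" and "\<And>u v. (\<And>i. i \<le> b \<Longrightarrow> u i = v i) \<Longrightarrow> u \<in> B \<longleftrightarrow> v \<in> B"
    and [measurable]: "K \<in> sets borel" and K: "\<And>u. u \<in> B \<Longrightarrow> u 0 \<in> K"
  shows "\<exists>g \<in> borel_measurable borel. \<forall>n. \<forall>s\<ge>1. \<forall>A\<in>sets (past M X n).
    emeasure M (A \<inter> {\<omega> \<in> space M. (\<lambda>i. X (n + s + i) \<omega>) \<in> B}) =
    (\<integral>\<^sup>+\<omega>\<in>A. (\<integral>\<^sup>+y\<in>K. iter_density \<rho> s (Y n \<omega>) y * g y \<partial>lborel) \<partial>M)"
proof -
  have "\<exists>g \<in> borel_measurable borel. \<forall>t\<ge>1. \<forall>A\<in>sets (past M X t).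
      (\<integral>\<^sup>+\<omega>\<in>A. indicator B (\<lambda>i. X (t + i) \<omega>) \<partial>M) = (\<integral>\<^sup>+\<omega>\<in>A. g (X t \<omega>) \<partial>M)"
  proof (rule path_functional[where b = b])
    fix u v :: "nat \<Rightarrow> 'a" assume "\<And>i. i \<le> b \<Longrightarrow> u i = v i"
    from assms(2)[OF this] show "(indicator B u :: ennreal) = indicator B v" by (simp add: indicator_def)
  qed simp
  then obtain g where g [measurable]: "g \<in> borel_measurable borel"
    and gI: "\<And>t A. t \<ge> 1 \<Longrightarrow> A \<in> sets (past M X t) \<Longrightarrow>
      (\<integral>\<^sup>+\<omega>\<in>A. indicator B (\<lambda>i. X (t + i) \<omega>) \<partial>M) = (\<integral>\<^sup>+\<omega>\<in>A. g (X t \<omega>) \<partial>M)" by blast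
  show ?thesis
  proof (intro bexI[of _ g] allI impI ballI g)
    fix n s :: nat and A assume s: "s \<ge> 1" and A: "A \<in> sets (past M X n)"
    have AM [measurable]: "A \<in> sets M" using A by simp
    have [measurable]: "X (n + s) \<in> past M X (n + s) \<rightarrow>\<^sub>M borel"
      using s by (intro measurable_X_past) auto
    have "X (n + s) -` K \<inter> space (past M X (n + s)) \<in> sets (past M X (n + s))" by measurable
    moreover have "A \<in> sets (past M X (n + s))"
      using A sets_past_mono[of n "n + s"] by auto
    ultimately have AK: "A \<inter> (X (n + s) -` K \<inter> space M) \<in> sets (past M X (n + s))"
      unfolding space_past by (rule sets.Int[rotated])
    have [measurable]: "(\<lambda>\<omega>. \<lambda>i. X (n + s + i) \<omega>) \<in> M \<rightarrow>\<^sub>M borel"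
      by (rule measurable_pathI) (use s in auto)
    have "emeasure M (A \<inter> {\<omega> \<in> space M. (\<lambda>i. X (n + s + i) \<omega>) \<in> B}) =
        (\<integral>\<^sup>+\<omega>. indicator (A \<inter> {\<omega> \<in> space M. (\<lambda>i. X (n + s + i) \<omega>) \<in> B}) \<omega> \<partial>M)"
      by (rule nn_integral_indicator[symmetric]) simp
    also have "\<dots> = (\<integral>\<^sup>+\<omega>\<in>A \<inter> (X (n + s) -` K \<inter> space M). indicator B (\<lambda>i. X (n + s + i) \<omega>) \<partial>M)"
      by (intro nn_integral_cong) (use K in \<open>force simp: indicator_def\<close>)
    also have "\<dots> = (\<integral>\<^sup>+\<omega>\<in>A \<inter> (X (n + s) -` K \<inter> space M). g (X (n + s) \<omega>) \<partial>M)"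
      using AK s by (intro gI) auto
    also have "\<dots> = (\<integral>\<^sup>+\<omega>\<in>A. (g (X (n + s) \<omega>) * indicator K (X (n + s) \<omega>)) \<partial>M)"
      by (intro nn_integral_cong) (auto simp: indicator_def)
    also have "\<dots> = (\<integral>\<^sup>+\<omega>\<in>A. (\<integral>\<^sup>+y. iter_density \<rho> s (Y n \<omega>) y * (g y * indicator K y) \<partial>lborel) \<partial>M)"
      by (rule multi_step[OF A s]) simp
    finally show "emeasure M (A \<inter> {\<omega> \<in> space M. (\<lambda>i. X (n + s + i) \<omega>) \<in> B}) =
        (\<integral>\<^sup>+\<omega>\<in>A. (\<integral>\<^sup>+y\<in>K. iter_density \<rho> s (Y n \<omega>) y * g y \<partial>lborel) \<partial>M)"
      by (simp add: mult.assoc)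
  qed
qed

end

section \<open>Communicating classes and decoupling\<close>

lemma nn_integral_lborel_pos_open:
  fixes f :: "'a::euclidean_space \<Rightarrow> ennreal"
  assumes [measurable]: "f \<in> borel_measurable borel" and "open U" "x \<in> U"
    and pos: "\<And>z. z \<in> U \<Longrightarrow> f z > 0"
  shows "(\<integral>\<^sup>+z. f z \<partial>lborel) > 0"
proof (rule ccontr)
  assume "\<not> ?thesis"
  then have "AE z in lborel. f z = 0"
    by (simp add: nn_integral_0_iff_AE not_less)
  then obtain N where N: "{z. f z \<noteq> 0} \<subseteq> N" "emeasure lborel N = 0" "N \<in> sets lborel"
    by (elim AE_E) auto
  obtain e where e: "e > 0" "ball x e \<subseteq> U" using assms openE by blast
  have "ball x e \<subseteq> N" using e pos N(1) by force
  then have "emeasure lborel (ball x e) \<le> emeasure lborel N"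
    using N by (intro emeasure_mono) auto
  then have "measure lborel (ball x e) = 0" using N by (simp add: measure_def)
  with content_ball_pos[OF e(1), of x] show False by simp
qed

lemma open_section1: "open {(x, y). P x y} \<Longrightarrow> open {x :: 'b :: topological_space. P x (y :: 'c :: topological_space)}"
proof -
  assume o: "open {(x, y). P x y}"
  have "open ((\<lambda>x. (x, y)) -` {(x, y). P x y})"
    by (rule open_vimage[OF o]) (intro continuous_intros)
  then show ?thesis by (simp add: vimage_def)
qed

lemma open_section2: "open {(x, y). P x y} \<Longrightarrow> open {y :: 'b :: topological_space. P (x :: 'c :: topological_space) y}"
proof -
  assume o: "open {(x, y). P x y}"
  have "open ((\<lambda>y. (x, y)) -` {(x, y). P x y})"
    by (rule open_vimage[OF o]) (intro continuous_intros)
  then show ?thesis by (simp add: vimage_def)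
qed

locale class_chain = density_chain \<beta> p \<rho> M X
  for \<beta> :: "'a::euclidean_space measure" and p \<rho> and M :: "'w measure" and X +
  assumes open_positive: "open {(x, y). \<rho> x y > 0}"
    and uniform: "pseudo_uniform \<rho>"
begin

definition reach :: "'a option \<Rightarrow> 'a \<Rightarrow> bool"
  where "reach x y \<longleftrightarrow> (\<exists>k\<ge>1. iter_density \<rho> k x y > 0)"

lemma iter_density_open_pos:
  "open {(x, y). iter_density \<rho> (Suc k) x y > 0} \<and>
   (\<forall>x y. iter_density \<rho> (Suc (Suc k)) x y > 0 \<longleftrightarrow>
      (\<exists>z. iter_density \<rho> (Suc k) x z > 0 \<and> \<rho> (Some z) y > 0))"
proof (induction k)
  have step: "iter_density \<rho> (Suc (Suc k)) x y > 0 \<longleftrightarrow>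
      (\<exists>z. iter_density \<rho> (Suc k) x z > 0 \<and> \<rho> (Some z) y > 0)"
    if o: "open {(x, y). iter_density \<rho> (Suc k) x y > 0}" for k x y
  proof
    assume "iter_density \<rho> (Suc (Suc k)) x y > 0"
    then have "\<not> (AE z in lborel. iter_density \<rho> (Suc k) x z * ennreal (\<rho> (Some z) y) = 0)"
      by (subst (asm) iter_density.simps, subst nn_integral_0_iff_AE[symmetric]) auto
    then have "\<exists>z. iter_density \<rho> (Suc k) x z * ennreal (\<rho> (Some z) y) \<noteq> 0"
      by (metis (mono_tags, lifting) AE_I2)
    then show "\<exists>z. iter_density \<rho> (Suc k) x z > 0 \<and> \<rho> (Some z) y > 0"
      using density_nonneg by (auto simp: zero_less_iff_neq_zero less_le)
  next
    assume "\<exists>z. iter_density \<rho> (Suc k) x z > 0 \<and> \<rho> (Some z) y > 0"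
    then obtain z where z: "iter_density \<rho> (Suc k) x z > 0" "\<rho> (Some z) y > 0" by blast
    have "open {z. iter_density \<rho> (Suc k) x z > 0}" using open_section2[OF o] .
    moreover have "open {z. \<rho> (Some z) y > 0}"
      using open_vimage[OF open_section1[OF open_positive] continuous_on_Some] by (simp add: vimage_def)
    ultimately have "open ({z. iter_density \<rho> (Suc k) x z > 0} \<inter> {z. \<rho> (Some z) y > 0})" by blast
    from nn_integral_lborel_pos_open[OF _ this, of "\<lambda>z. iter_density \<rho> (Suc k) x z * ennreal (\<rho> (Some z) y)" z] z
    show "iter_density \<rho> (Suc (Suc k)) x y > 0"
      by (simp add: ennreal_zero_less_mult_iff)
  qed
  {
    case 0
    have "open {(x, y). iter_density \<rho> (Suc 0) x y > 0}"
      using open_positive by simp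
    with step[of 0] show ?case by blast
  next
    case (Suc k)
    let ?O = "{(x, y). iter_density \<rho> (Suc k) x y > 0}" and ?R = "{(x, y). \<rho> x y > 0}"
    have "{(x, y). iter_density \<rho> (Suc (Suc k)) x y > 0} =
      (\<Union>z. {x. iter_density \<rho> (Suc k) x z > 0} \<times> {y. \<rho> (Some z) y > 0})"
      using Suc by auto
    moreover have "open \<dots>"
      using open_section1[of "\<lambda>x y. iter_density \<rho> (Suc k) x y > 0"]
        open_section2[OF open_positive] Suc by (intro open_UN ballI open_Times) blast+
    ultimately have "open {(x, y). iter_density \<rho> (Suc (Suc k)) x y > 0}" by simp
    with step[of "Suc k"] show ?case by blast
  }
qed

lemma reach_iter_trans:
  "iter_density \<rho> (Suc k) x z > 0 \<Longrightarrow> iter_density \<rho> (Suc l) (Some z) y > 0 \<Longrightarrow>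
    iter_density \<rho> (Suc (Suc (k + l))) x y > 0"
proof (induction l arbitrary: y)
  case 0
  then have "\<rho> (Some z) y > 0" by simp
  then show ?case using 0 iter_density_open_pos[of k] by auto
next
  case (Suc l)
  then obtain w where w: "iter_density \<rho> (Suc l) (Some z) w > 0" "\<rho> (Some w) y > 0"
    using iter_density_open_pos[of l] by blast
  with Suc iter_density_open_pos[of "Suc (k + l)"] show ?case by auto
qed

lemma reach_trans: "reach x z \<Longrightarrow> reach (Some z) y \<Longrightarrow> reach x y"
proof -
  assume "reach x z" "reach (Some z) y"
  then obtain k l where "k \<ge> 1" "iter_density \<rho> k x z > 0" "l \<ge> 1" "iter_density \<rho> l (Some z) y > 0"
    by (auto simp: reach_def)
  then have "iter_density \<rho> (Suc (Suc ((k - 1) + (l - 1)))) x y > 0"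
    by (intro reach_iter_trans) auto
  then show "reach x y" unfolding reach_def by (metis le_add1 plus_1_eq_Suc)
qed

lemma sum_density_pos: "sum_density \<rho> x y > 0 \<longleftrightarrow> reach x y"
proof -
  have "sum_density \<rho> x y = 0 \<longleftrightarrow> (\<forall>k. ennreal (1 / 2 ^ Suc k) * iter_density \<rho> (Suc k) x y = 0)"
    unfolding sum_density_def by (rule suminf_eq_zero_iff) auto
  also have "\<dots> \<longleftrightarrow> (\<forall>k. iter_density \<rho> (Suc k) x y = 0)"
  proof -
    have "ennreal (1 / 2 ^ Suc k) \<noteq> 0" for k
      by (metis ennreal_eq_0_iff not_le zero_less_divide_1_iff zero_less_numeral zero_less_power)
    then show ?thesis by (simp del: iter_density.simps)
  qed
  also have "\<dots> \<longleftrightarrow> \<not> reach x y"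
    unfolding reach_def
    by (metis One_nat_def Suc_le_D Suc_le_mono le0 not_gr_zero)
  finally show ?thesis by (simp add: zero_less_iff_neq_zero)
qed

lemma open_reach: "open {y. reach x y}" "open {x. reach (Some x) y}"
proof -
  have *: "{y. reach x y} = (\<Union>k. {y. iter_density \<rho> (Suc k) x y > 0})"
    "{x. reach (Some x) y} = (\<Union>k. Some -` {x. iter_density \<rho> (Suc k) x y > 0})"
    unfolding reach_def by (auto simp del: iter_density.simps simp: Suc_le_eq gr0_conv_Suc)
  have o: "open {(x, y). iter_density \<rho> (Suc k) x y > 0}" for k
    using iter_density_open_pos by blast
  show "open {y. reach x y}" unfolding * by (intro open_UN ballI open_section2[OF o])
  show "open {x. reach (Some x) y}"
    unfolding * by (intro open_UN ballI open_vimage[OF open_section1[OF o] continuous_on_Some])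
qed

lemma measurable_sum_density [measurable]: "sum_density \<rho> x \<in> borel_measurable borel"
  unfolding sum_density_def[abs_def]
  by (intro borel_measurable_suminf_order borel_measurable_times_ennreal borel_measurable_const
      measurable_iter_density' measurable_const measurable_ident_sets) simp_all

abbreviation "classes \<equiv> comm_classes \<rho>"

lemma class_reach: "A \<in> classes \<Longrightarrow> x \<in> A \<Longrightarrow> y \<in> A \<Longrightarrow> reach (Some x) y"
  by (auto simp: comm_classes_def communicating_def sum_density_pos)

lemma class_eq:
  assumes A: "A \<in> classes" and x: "x \<in> A"
  shows "A = {z. reach (Some x) z \<and> reach (Some z) x}"
proof -
  let ?B = "{z. reach (Some x) z \<and> reach (Some z) x}"
  have "A \<subseteq> ?B" using class_reach[OF A] x by blast
  moreover have "communicating \<rho> ?B"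
    using class_reach[OF A x x] reach_trans unfolding communicating_def sum_density_pos by blast
  ultimately show ?thesis using A unfolding comm_classes_def by blast
qed

lemma class_nonempty: "A \<in> classes \<Longrightarrow> A \<noteq> {}"
  by (auto simp: comm_classes_def communicating_def)

lemma open_class: "A \<in> classes \<Longrightarrow> open A"
proof -
  assume A: "A \<in> classes"
  then obtain x where "x \<in> A" using class_nonempty by blast
  have "open ({z. reach (Some x) z} \<inter> {z. reach (Some z) x})"
    using open_reach by blast
  then show "open A" by (subst class_eq[OF A \<open>x \<in> A\<close>]) (simp add: Collect_conj_eq)
qed

lemma class_disjoint: "A \<in> classes \<Longrightarrow> B \<in> classes \<Longrightarrow> x \<in> A \<Longrightarrow> x \<in> B \<Longrightarrow> A = B"
  using class_eq[of A x] class_eq[of B x] by (rule trans[OF _ sym])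

lemma countable_classes: "countable classes"
  by (rule countable_disjoint_open_subsets)
    (auto intro: open_class simp: disjoint_def dest: class_disjoint)

lemma measurable_class [measurable]: "A \<in> classes \<Longrightarrow> A \<in> sets borel"
  by (simp add: open_class)

lemma open_Union_classes: "open (\<Union>classes)"
  by (intro open_Union ballI open_class)

lemma sum_kernel_pos:
  assumes "B \<in> classes"
  shows "sum_kernel \<rho> x B > 0 \<longleftrightarrow> (\<exists>y\<in>B. reach x y)"
proof
  assume pos: "sum_kernel \<rho> x B > 0"
  show "\<exists>y\<in>B. reach x y"
  proof (rule ccontr)
    assume "\<not> ?thesis"
    then have z: "sum_density \<rho> x y * indicator B y = 0" for y
      using sum_density_pos[of x y] by (auto simp: indicator_def zero_less_iff_neq_zero)
    have "sum_kernel \<rho> x B = (\<integral>\<^sup>+(y :: 'a). 0 \<partial>lborel)"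
      unfolding sum_kernel_def by (rule nn_integral_cong) (rule z)
    then show False using pos by simp
  qed
next
  assume "\<exists>y\<in>B. reach x y"
  then obtain y where y: "y \<in> B" "reach x y" by blast
  have "open (B \<inter> {y. reach x y})" using open_class[OF assms] open_reach by blast
  from nn_integral_lborel_pos_open[OF _ this, of "\<lambda>y. sum_density \<rho> x y * indicator B y" y] y assms
  show "sum_kernel \<rho> x B > 0"
    by (simp add: sum_kernel_def sum_density_pos)
qed

lemma root_iff: "B \<in> classes \<Longrightarrow> leads_to \<rho> None (Some B) \<longleftrightarrow> (\<exists>y\<in>B. reach None y)"
  by (simp add: sum_kernel_pos)

lemma leads_to_classI:
  assumes "A \<in> classes" "B \<in> classes" "x \<in> A" "y \<in> B" "reach (Some x) y"
  shows "leads_to \<rho> (Some A) (Some B)"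
proof -
  have "\<exists>y\<in>B. reach (Some x') y" if "x' \<in> A" for x'
    using class_reach[OF assms(1) that assms(3)] reach_trans assms by blast
  then show ?thesis using assms by (simp add: sum_kernel_pos)
qed

lemma leads_to_classD:
  assumes "A \<in> classes" "B \<in> classes" "x \<in> A" "y \<in> B" "leads_to \<rho> (Some A) (Some B)"
  shows "reach (Some x) y"
proof -
  obtain z where "z \<in> B" "reach (Some x) z" using assms by (auto simp: sum_kernel_pos)
  then show ?thesis using class_reach[OF assms(2) _ assms(4)] reach_trans by blast
qed

lemma leads_to_refl: "A \<in> classes \<Longrightarrow> leads_to \<rho> (Some A) (Some A)"
proof -
  assume A: "A \<in> classes"
  then obtain x where x: "x \<in> A" using class_nonempty by blast
  show ?thesis by (rule leads_to_classI[OF A A x x class_reach[OF A x x]])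
qed

lemma leads_to_trans:
  assumes "A \<in> classes" "B \<in> classes" "D \<in> classes"
    "leads_to \<rho> (Some A) (Some B)" "leads_to \<rho> (Some B) (Some D)"
  shows "leads_to \<rho> (Some A) (Some D)"
proof -
  obtain x y z where *: "x \<in> A" "y \<in> B" "z \<in> D" using class_nonempty assms by (metis ex_in_conv)
  show ?thesis
    using leads_to_classI[OF assms(1,3) *(1,3)] reach_trans
      leads_to_classD[OF assms(1,2) *(1,2) assms(4)] leads_to_classD[OF assms(2,3) *(2,3) assms(5)] by blast
qed

lemma leads_to_antisym:
  assumes "A \<in> classes" "B \<in> classes" "leads_to \<rho> (Some A) (Some B)" "leads_to \<rho> (Some B) (Some A)"
  shows "A = B"
proof -
  obtain x y where *: "x \<in> A" "y \<in> B" using class_nonempty assms by (metis ex_in_conv)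
  then have "y \<in> A"
    using class_eq[OF assms(1) *(1)] leads_to_classD[OF assms(1,2) * assms(3)]
      leads_to_classD[OF assms(2,1) *(2,1) assms(4)] by blast
  then show ?thesis using class_disjoint assms * by blast
qed

definition comparable :: "'a set set \<Rightarrow> bool"
  where "comparable S \<longleftrightarrow> (\<forall>A\<in>S. \<forall>B\<in>S. leads_to \<rho> (Some A) (Some B) \<or> leads_to \<rho> (Some B) (Some A))"

lemma node_trans:
  assumes "s \<in> insert None (Some ` classes)" "t \<in> insert None (Some ` classes)" "u \<in> insert None (Some ` classes)"
    and st: "leads_to \<rho> s t" and tu: "leads_to \<rho> t u"
  shows "leads_to \<rho> s u"
proof (cases u)
  case None
  then show ?thesis using st tu by simp
next
  case u: (Some D)
  show ?thesis
  proof (cases t)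
    case None
    then show ?thesis using st tu by simp
  next
    case t: (Some B)
    have BD: "B \<in> classes" "D \<in> classes" using assms t u by auto
    show ?thesis
    proof (cases s)
      case None
      then obtain y where y: "y \<in> B" "reach None y" using st t root_iff[OF BD(1)] by auto
      obtain z where z: "z \<in> D" using class_nonempty[OF BD(2)] by blast
      have "reach None z"
        using leads_to_classD[OF BD y(1) z] tu t u y(2) reach_trans by blast
      then show ?thesis using None u root_iff[OF BD(2)] z by blast
    next
      case (Some A)
      then show ?thesis using leads_to_trans[of A B D] assms t u by blast
    qed
  qed
qed

lemma totally_orderedI:
  assumes J: "J \<subseteq> insert None (Some ` classes)"
    and N: "\<And>s. None \<in> J \<Longrightarrow> s \<in> J \<Longrightarrow> leads_to \<rho> None s" and S: "comparable {A. Some A \<in> J}"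
  shows "totally_ordered \<rho> J"
  unfolding totally_ordered_def order_on_defs
proof (intro conjI)
  have refl: "leads_to \<rho> s s" if "s \<in> J" for s
    using that J leads_to_refl by (cases s) (auto simp del: leads_to.simps(1))
  then show "refl_on J {(s, t). s \<in> J \<and> t \<in> J \<and> leads_to \<rho> s t}"
    by (auto simp: refl_on_def simp del: leads_to.simps)
  show "trans {(s, t). s \<in> J \<and> t \<in> J \<and> leads_to \<rho> s t}"
  proof (rule transI, clarify)
    fix s t u assume *: "s \<in> J" "t \<in> J" "u \<in> J" "leads_to \<rho> s t" "leads_to \<rho> t u"
    show "leads_to \<rho> s u"
      using node_trans[OF subsetD[OF J *(1)] subsetD[OF J *(2)] subsetD[OF J *(3)] *(4,5)] .
  qed
  show "antisym {(s, t). s \<in> J \<and> t \<in> J \<and> leads_to \<rho> s t}"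
  proof (rule antisymI, clarify)
    fix s t assume "s \<in> J" "t \<in> J" "leads_to \<rho> s t" "leads_to \<rho> t s"
    moreover have "A = B" if "Some A \<in> J" "Some B \<in> J" "leads_to \<rho> (Some A) (Some B)"
        "leads_to \<rho> (Some B) (Some A)" for A B
      using leads_to_antisym[of A B] that J by blast
    ultimately show "s = t"
      by (cases s; cases t) (simp_all del: leads_to.simps(1))
  qed
  show "total_on J {(s, t). s \<in> J \<and> t \<in> J \<and> leads_to \<rho> s t}"
  proof (rule total_onI)
    fix s t assume "s \<in> J" "t \<in> J"
    moreover have "leads_to \<rho> (Some A) (Some B) \<or> leads_to \<rho> (Some B) (Some A)"
      if "Some A \<in> J" "Some B \<in> J" for A B
      using S that unfolding comparable_def by blast
    ultimately have "leads_to \<rho> s t \<or> leads_to \<rho> t s"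
      using N by (cases s; cases t) (simp_all del: leads_to.simps(1))
    then show "(s, t) \<in> {(s, t). s \<in> J \<and> t \<in> J \<and> leads_to \<rho> s t} \<or>
        (t, s) \<in> {(s, t). s \<in> J \<and> t \<in> J \<and> leads_to \<rho> s t}"
      using \<open>s \<in> J\<close> \<open>t \<in> J\<close> by blast
  qed
qed (auto simp del: leads_to.simps)

lemma totally_ordered_iff:
  assumes "S \<subseteq> classes"
  shows "totally_ordered \<rho> (Some ` S) \<longleftrightarrow> comparable S"
proof
  assume "totally_ordered \<rho> (Some ` S)"
  then have t: "total_on (Some ` S) {(s, t). s \<in> Some ` S \<and> t \<in> Some ` S \<and> leads_to \<rho> s t}"
    by (simp add: totally_ordered_def linear_order_on_def)
  show "comparable S"
    unfolding comparable_def
  proof (intro ballI)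
    fix A B assume AB: "A \<in> S" "B \<in> S"
    show "leads_to \<rho> (Some A) (Some B) \<or> leads_to \<rho> (Some B) (Some A)"
    proof (cases "A = B")
      case True
      then show ?thesis using AB assms leads_to_refl by blast
    next
      case False
      with t[unfolded total_on_def, rule_format, of "Some A" "Some B"] AB
      show ?thesis by (simp del: leads_to.simps)
    qed
  qed
next
  assume "comparable S"
  moreover have "{A. Some A \<in> Some ` S} = S" by auto
  ultimately show "totally_ordered \<rho> (Some ` S)"
    using assms by (intro totally_orderedI) auto
qed

lemma leads_to_None_None [simp]: "leads_to \<rho> None None" by simp

definition chain_data :: "'a set set \<Rightarrow> ('a set \<Rightarrow> 'a set) \<Rightarrow> bool"
  where "chain_data S Kf \<longleftrightarrow> finite S \<and> S \<subseteq> classes \<and> comparable S \<and>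
    (\<forall>A\<in>S. leads_to \<rho> None (Some A) \<and> compact (Kf A) \<and> Kf A \<subseteq> A)"

text \<open>The set \<open>K\<^sub>A\<^sup>-\<close> of the pseudo-uniformity condition, for \<open>K\<close> the union of the sets \<open>Kf B\<close>.\<close>

definition heads :: "'a set set \<Rightarrow> ('a set \<Rightarrow> 'a set) \<Rightarrow> 'a set \<Rightarrow> 'a option set"
  where "heads S Kf A = insert None (\<Union>B\<in>{B \<in> S. leads_to \<rho> (Some B) (Some A)}. Some ` Kf B)"

lemma chain_data_admissible:
  assumes c: "chain_data S Kf"
  defines "K \<equiv> \<Union>A\<in>S. Kf A"
  shows "admissible_compact \<rho> K" "\<And>A. A \<in> S \<Longrightarrow> K \<inter> A = Kf A"
    "classes_of \<rho> K = {A \<in> S. Kf A \<noteq> {}}" "\<And>A. A \<in> S \<Longrightarrow> piece_minus \<rho> K A = heads S Kf A"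
proof -
  have S: "finite S" "S \<subseteq> classes" "comparable S" "\<And>A. A \<in> S \<Longrightarrow> leads_to \<rho> None (Some A)"
    "\<And>A. A \<in> S \<Longrightarrow> compact (Kf A)" "\<And>A. A \<in> S \<Longrightarrow> Kf A \<subseteq> A"
    using c by (auto simp: chain_data_def simp del: leads_to.simps)
  show KA: "K \<inter> A = Kf A" if "A \<in> S" for A
    using S(6) class_disjoint S(2) that unfolding K_def by blast
  show co: "classes_of \<rho> K = {A \<in> S. Kf A \<noteq> {}}"
  proof -
    have "A \<in> S" if "A \<in> classes" "K \<inter> A \<noteq> {}" for A
      using that S(6) class_disjoint S(2) unfolding K_def by blast
    then show ?thesis using KA S(2) unfolding classes_of_def by blast
  qed
  show "piece_minus \<rho> K A = heads S Kf A" if A: "A \<in> S" for A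
  proof -
    have "piece_minus \<rho> K A = (\<Union>s \<in> insert None (Some ` {B \<in> S. Kf B \<noteq> {} \<and> leads_to \<rho> (Some B) (Some A)}). piece K s)"
      unfolding piece_minus_def nodes_of_def co using S(4)[OF A] by (auto simp del: leads_to.simps)
    also have "\<dots> = heads S Kf A"
      using KA by (auto simp: heads_def piece_def simp del: leads_to.simps)
    finally show ?thesis .
  qed
  show "admissible_compact \<rho> K"
    unfolding admissible_compact_def
  proof (intro conjI ballI)
    show "compact K" unfolding K_def using S by (intro compact_UN) auto
    show "K \<subseteq> \<Union>classes" unfolding K_def using S(2,6) by blast
    show "finite (nodes_of \<rho> K)" unfolding nodes_of_def co using S by simp
    show "leads_to \<rho> None s" if "s \<in> nodes_of \<rho> K" for s
      using that S(4) unfolding nodes_of_def co by (auto simp del: leads_to.simps)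
    show "totally_ordered \<rho> (nodes_of \<rho> K)"
    proof (rule totally_orderedI)
      show "nodes_of \<rho> K \<subseteq> insert None (Some ` classes)"
        using S(2) unfolding nodes_of_def co by blast
      show "leads_to \<rho> None s" if "s \<in> nodes_of \<rho> K" for s
        using that S(4) unfolding nodes_of_def co by (auto simp del: leads_to.simps)
      show "comparable {A. Some A \<in> nodes_of \<rho> K}"
        using S(3) unfolding nodes_of_def co comparable_def by blast
    qed
  qed
qed

lemma uniform_bound:
  assumes c: "chain_data S Kf"
  obtains c N where "(c :: real) \<ge> 1"
    "\<And>A x1 x2 y k. A \<in> S \<Longrightarrow> x1 \<in> heads S Kf A \<Longrightarrow> x2 \<in> heads S Kf A \<Longrightarrow> y \<in> Kf A \<Longrightarrow> k \<ge> 1 \<Longrightarrow>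
      iter_density \<rho> k x1 y \<le> ennreal c * (\<Sum>s=1..N. iter_density \<rho> s x2 y)"
proof -
  define K where "K = (\<Union>A\<in>S. Kf A)"
  note adm = chain_data_admissible[OF c, folded K_def]
  obtain c :: real and N :: nat and \<tau> where "0 \<le> c"
    and \<tau>: "\<tau> \<in> restrict_space (borel \<Otimes>\<^sub>M borel) (\<Union>A\<in>classes_of \<rho> K. piece_minus \<rho> K A \<times> (K \<inter> A))
            \<rightarrow>\<^sub>M count_space {1..N}"
    and le: "\<forall>A\<in>classes_of \<rho> K. \<forall>x\<^sub>2\<in>piece_minus \<rho> K A. \<forall>y\<in>K \<inter> A.
           (SUP x\<^sub>1\<in>piece_minus \<rho> K A. SUP k\<in>{1..}. iter_density \<rho> k x\<^sub>1 y)
             \<le> ennreal c * iter_density \<rho> (\<tau> (x\<^sub>2, y)) x\<^sub>2 y"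
    using uniform adm(1) unfolding pseudo_uniform_def by blast
  show thesis
  proof (rule that)
    show "max 1 c \<ge> 1" by simp
    fix A x1 x2 y k
    assume A: "A \<in> S" and x1: "x1 \<in> heads S Kf A" and x2: "x2 \<in> heads S Kf A"
      and y: "y \<in> Kf A" and k: "(k::nat) \<ge> 1"
    have Ac: "A \<in> classes_of \<rho> K" using A y adm(3) by auto
    have "(x2, y) \<in> space (restrict_space (borel \<Otimes>\<^sub>M borel) (\<Union>A\<in>classes_of \<rho> K. piece_minus \<rho> K A \<times> (K \<inter> A)))"
      using Ac x2 y adm(2,4)[OF A] by (auto simp: space_restrict_space space_pair_measure)
    from measurable_space[OF \<tau> this] have \<tau>N: "\<tau> (x2, y) \<in> {1..N}" by simp
    have "iter_density \<rho> k x1 y \<le> (SUP x\<^sub>1\<in>piece_minus \<rho> K A. SUP k\<in>{1..}. iter_density \<rho> k x\<^sub>1 y)"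
      using x1 k adm(4)[OF A] by (intro SUP_upper2[of x1] SUP_upper) auto
    also have "\<dots> \<le> ennreal c * iter_density \<rho> (\<tau> (x2, y)) x2 y"
      using le Ac x2 y adm(2,4)[OF A] by blast
    also have "\<dots> \<le> ennreal (max 1 c) * (\<Sum>s=1..N. iter_density \<rho> s x2 y)"
      using \<tau>N by (intro mult_mono ennreal_leI member_le_sum) auto
    finally show "iter_density \<rho> k x1 y \<le> ennreal (max 1 c) * (\<Sum>s=1..N. iter_density \<rho> s x2 y)" .
  qed
qed

lemma decoupling:
  assumes c: "chain_data S Kf"
  obtains c N where "(c :: real) \<ge> 1"
    "\<And>A (B :: (nat \<Rightarrow> 'a) set) b n m k A1 A2. A \<in> S \<Longrightarrow> B \<in> sets borel \<Longrightarrow>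
      (\<And>u v. (\<And>i. i \<le> b \<Longrightarrow> u i = v i) \<Longrightarrow> u \<in> B \<longleftrightarrow> v \<in> B) \<Longrightarrow> (\<And>u. u \<in> B \<Longrightarrow> u 0 \<in> Kf A) \<Longrightarrow>
      A1 \<in> sets (past M X n) \<Longrightarrow> A2 \<in> sets (past M X m) \<Longrightarrow>
      (\<And>\<omega>. \<omega> \<in> A1 \<Longrightarrow> Y n \<omega> \<in> heads S Kf A) \<Longrightarrow> (\<And>\<omega>. \<omega> \<in> A2 \<Longrightarrow> Y m \<omega> \<in> heads S Kf A) \<Longrightarrow> k \<ge> 1 \<Longrightarrow>
      prob A2 * prob (A1 \<inter> {\<omega> \<in> space M. (\<lambda>i. X (n + k + i) \<omega>) \<in> B}) \<le>
        c * prob A1 * (\<Sum>s=1..N. prob (A2 \<inter> {\<omega> \<in> space M. (\<lambda>i. X (m + s + i) \<omega>) \<in> B}))"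
proof -
  obtain c :: real and N where c1: "c \<ge> 1" and ub:
    "\<And>A x1 x2 y k. A \<in> S \<Longrightarrow> x1 \<in> heads S Kf A \<Longrightarrow> x2 \<in> heads S Kf A \<Longrightarrow> y \<in> Kf A \<Longrightarrow> k \<ge> 1 \<Longrightarrow>
      iter_density \<rho> k x1 y \<le> ennreal c * (\<Sum>s=1..N. iter_density \<rho> s x2 y)"
    using uniform_bound[OF c] by metis
  show thesis
  proof (rule that[OF c1, of N])
    fix A and B :: "(nat \<Rightarrow> 'a) set" and b n m k A1 A2
    assume A: "A \<in> S" and B [measurable]: "B \<in> sets borel"
      and dep: "\<And>u v. (\<And>i. i \<le> b \<Longrightarrow> u i = v i) \<Longrightarrow> u \<in> B \<longleftrightarrow> v \<in> B"
      and BK: "\<And>u. u \<in> B \<Longrightarrow> u 0 \<in> Kf A" and A1: "A1 \<in> sets (past M X n)" and A2: "A2 \<in> sets (past M X m)"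
      and h1: "\<And>\<omega>. \<omega> \<in> A1 \<Longrightarrow> Y n \<omega> \<in> heads S Kf A" and h2: "\<And>\<omega>. \<omega> \<in> A2 \<Longrightarrow> Y m \<omega> \<in> heads S Kf A"
      and k: "(k :: nat) \<ge> 1"
    have [measurable]: "Kf A \<in> sets borel"
      using c A by (auto simp: chain_data_def intro: borel_compact)
    have [measurable]: "A1 \<in> sets M" "A2 \<in> sets M" using A1 A2 by auto
    obtain g where [measurable]: "g \<in> borel_measurable borel" and
      g: "\<And>n s A'. s \<ge> 1 \<Longrightarrow> A' \<in> sets (past M X n) \<Longrightarrow>
        emeasure M (A' \<inter> {\<omega> \<in> space M. (\<lambda>i. X (n + s + i) \<omega>) \<in> B}) =
        (\<integral>\<^sup>+\<omega>\<in>A'. (\<integral>\<^sup>+y\<in>Kf A. iter_density \<rho> s (Y n \<omega>) y * g y \<partial>lborel) \<partial>M)"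
    proof -
      have "\<exists>g \<in> borel_measurable borel. \<forall>n. \<forall>s\<ge>1. \<forall>A'\<in>sets (past M X n).
          emeasure M (A' \<inter> {\<omega> \<in> space M. (\<lambda>i. X (n + s + i) \<omega>) \<in> B}) =
          (\<integral>\<^sup>+\<omega>\<in>A'. (\<integral>\<^sup>+y\<in>Kf A. iter_density \<rho> s (Y n \<omega>) y * g y \<partial>lborel) \<partial>M)"
        by (rule markov_property[where b = b]) (fact B dep BK | simp)+
      then show ?thesis using that by blast
    qed
    define G where "G s x = (\<integral>\<^sup>+y\<in>Kf A. iter_density \<rho> s x y * g y \<partial>lborel)" for s x
    have [measurable]: "G s \<in> borel_measurable borel" for s unfolding G_def by measurable
    have GG: "G k x1 \<le> ennreal c * (\<Sum>s=1..N. G s x2)" if "x1 \<in> heads S Kf A" "x2 \<in> heads S Kf A" for x1 x2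
    proof -
      have "G k x1 \<le> (\<integral>\<^sup>+y. ennreal c * (\<Sum>s=1..N. iter_density \<rho> s x2 y * g y * indicator (Kf A) y) \<partial>lborel)"
        unfolding G_def
      proof (rule nn_integral_mono)
        fix y
        show "iter_density \<rho> k x1 y * g y * indicator (Kf A) y \<le>
            ennreal c * (\<Sum>s=1..N. iter_density \<rho> s x2 y * g y * indicator (Kf A) y)"
        proof (cases "y \<in> Kf A")
          case True
          then have "iter_density \<rho> k x1 y * g y \<le> ennreal c * (\<Sum>s=1..N. iter_density \<rho> s x2 y) * g y"
            using ub[OF A that True k] by (intro mult_right_mono) auto
          then show ?thesis using True by (simp add: sum_distrib_right mult.assoc)
        qed simp
      qed
      also have "\<dots> = ennreal c * (\<Sum>s=1..N. G s x2)"
      proof -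
        have "(\<integral>\<^sup>+y. (\<Sum>s=1..N. iter_density \<rho> s x2 y * g y * indicator (Kf A) y) \<partial>lborel) = (\<Sum>s=1..N. G s x2)"
          unfolding G_def by (rule nn_integral_sum) simp
        then show ?thesis by (subst nn_integral_cmult) (simp, simp only:)
      qed
      finally show ?thesis .
    qed
    let ?L1 = "emeasure M (A1 \<inter> {\<omega> \<in> space M. (\<lambda>i. X (n + k + i) \<omega>) \<in> B})"
    let ?L2 = "\<lambda>s. emeasure M (A2 \<inter> {\<omega> \<in> space M. (\<lambda>i. X (m + s + i) \<omega>) \<in> B})"
    have L1: "?L1 = (\<integral>\<^sup>+\<omega>\<in>A1. G k (Y n \<omega>) \<partial>M)" using g[OF k A1] by (simp add: G_def)
    have L2: "?L2 s = (\<integral>\<^sup>+\<omega>\<in>A2. G s (Y m \<omega>) \<partial>M)" if "s \<ge> 1" for s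
      using g[OF that A2] by (simp add: G_def)
    have "?L1 \<le> emeasure M A1 * (ennreal c * (\<Sum>s=1..N. G s x2))" if "x2 \<in> heads S Kf A" for x2
    proof -
      have "?L1 \<le> (\<integral>\<^sup>+\<omega>. (ennreal c * (\<Sum>s=1..N. G s x2)) * indicator A1 \<omega> \<partial>M)"
        unfolding L1
      proof (rule nn_integral_mono)
        fix \<omega>
        show "G k (Y n \<omega>) * indicator A1 \<omega> \<le> ennreal c * (\<Sum>s=1..N. G s x2) * indicator A1 \<omega>"
          using GG[OF h1 that] by (cases "\<omega> \<in> A1") simp_all
      qed
      then show ?thesis by (subst (asm) nn_integral_cmult_indicator) (simp, simp only: mult_ac)
    qed
    then have "(\<integral>\<^sup>+\<omega>. ?L1 * indicator A2 \<omega> \<partial>M) \<le>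
        (\<integral>\<^sup>+\<omega>. (emeasure M A1 * ennreal c) * (\<Sum>s=1..N. G s (Y m \<omega>) * indicator A2 \<omega>) \<partial>M)"
      by (intro nn_integral_mono) (auto simp: indicator_def h2 mult.assoc)
    also have "\<dots> = (emeasure M A1 * ennreal c) * (\<Sum>s=1..N. \<integral>\<^sup>+\<omega>\<in>A2. G s (Y m \<omega>) \<partial>M)"
    proof -
      have "(\<integral>\<^sup>+\<omega>. (\<Sum>s=1..N. G s (Y m \<omega>) * indicator A2 \<omega>) \<partial>M) =
          (\<Sum>s=1..N. \<integral>\<^sup>+\<omega>\<in>A2. G s (Y m \<omega>) \<partial>M)"
        by (rule nn_integral_sum) simp
      then show ?thesis by (subst nn_integral_cmult) (simp, simp only:)
    qed
    also have "\<dots> = (emeasure M A1 * ennreal c) * (\<Sum>s=1..N. ?L2 s)"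
      by (intro arg_cong2[where f = "(*)"] refl sum.cong) (simp add: L2)
    finally have "emeasure M A2 * ?L1 \<le> ennreal c * emeasure M A1 * (\<Sum>s=1..N. ?L2 s)"
      by (subst (asm) nn_integral_cmult_indicator) (simp, simp only: mult_ac)
    also have "\<dots> = ennreal (c * prob A1 * (\<Sum>s=1..N. prob (A2 \<inter> {\<omega> \<in> space M. (\<lambda>i. X (m + s + i) \<omega>) \<in> B})))"
      using c1 by (simp add: emeasure_eq_measure sum_nonneg ennreal_mult)
    finally show "prob A2 * prob (A1 \<inter> {\<omega> \<in> space M. (\<lambda>i. X (n + k + i) \<omega>) \<in> B}) \<le>
        c * prob A1 * (\<Sum>s=1..N. prob (A2 \<inter> {\<omega> \<in> space M. (\<lambda>i. X (m + s + i) \<omega>) \<in> B}))"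
      using c1 by (simp add: emeasure_eq_measure ennreal_mult[symmetric] sum_nonneg)
  qed
qed

end

section \<open>Blocks of trajectories and class rates\<close>

lemma test_functions_bound:
  assumes "test_functions F"
  obtains D where "D \<ge> 1" "\<And>f x. f \<in> F \<Longrightarrow> \<bar>f x\<bar> \<le> D"
proof -
  have "\<forall>f\<in>F. \<exists>d. \<forall>x. \<bar>f x\<bar> \<le> d"
    using assms by (auto simp: test_functions_def bounded_iff)
  then obtain d where d: "\<forall>f\<in>F. \<forall>x. \<bar>f x\<bar> \<le> d f" by (rule bchoice[THEN exE])
  have "finite F" using assms by (simp add: test_functions_def)
  show thesis
  proof (rule that[of "1 + (\<Sum>f\<in>F. \<bar>d f\<bar>)"])
    fix f x assume f: "f \<in> F"
    have "\<bar>f x\<bar> \<le> \<bar>d f\<bar>" using d f by (meson abs_ge_self order_trans)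
    also have "\<dots> \<le> (\<Sum>f\<in>F. \<bar>d f\<bar>)" using f \<open>finite F\<close> by (intro member_le_sum) auto
    finally show "\<bar>f x\<bar> \<le> 1 + (\<Sum>f\<in>F. \<bar>d f\<bar>)" by simp
  qed (simp add: sum_nonneg)
qed

lemma test_functions_measurable:
  "test_functions F \<Longrightarrow> f \<in> F \<Longrightarrow> f \<in> borel_measurable borel"
  by (simp add: test_functions_def borel_measurable_continuous_onI)

lemma sum_gap:
  fixes g :: "nat \<Rightarrow> real"
  assumes "s \<ge> 1" "\<And>i. \<bar>g i\<bar> \<le> D" "m \<le> Suc T"
  shows "\<bar>(\<Sum>i=m..T + s + b. g i) - (\<Sum>i=m..T. g i) - (\<Sum>i\<le>b. g (T + s + i))\<bar> \<le> s * D"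
proof -
  have "(\<Sum>i=m..T + s + b. g i) = (\<Sum>i\<in>{m..T}. g i) + (\<Sum>i\<in>{T<..<T + s}. g i) + (\<Sum>i\<in>{T + s..T + s + b}. g i)"
    using assms(1,3) by (subst sum.union_disjoint[symmetric]; (subst sum.union_disjoint[symmetric])?)
      (auto intro!: sum.cong)
  moreover have "(\<Sum>i\<in>{T + s..T + s + b}. g i) = (\<Sum>i\<le>b. g (T + s + i))"
    by (rule sum.reindex_bij_witness[of _ "\<lambda>i. T + s + i" "\<lambda>i. i - (T + s)"]) auto
  moreover have "\<bar>\<Sum>i\<in>{T<..<T + s}. g i\<bar> \<le> s * D"
  proof -
    have D: "0 \<le> D" using assms(2)[of 0] by linarith
    have "\<bar>\<Sum>i\<in>{T<..<T + s}. g i\<bar> \<le> (\<Sum>i\<in>{T<..<T + s}. \<bar>g i\<bar>)" by (rule sum_abs)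
    also have "\<dots> \<le> real (card {T<..<T + s}) * D"
      using assms(2) by (intro sum_bounded_above) auto
    also have "\<dots> \<le> s * D" using D by (intro mult_right_mono) auto
    finally show ?thesis .
  qed
  ultimately show ?thesis by linarith
qed

context class_chain
begin

definition block_paths ::
  "'a set \<Rightarrow> ('a \<Rightarrow> real) set \<Rightarrow> (('a \<Rightarrow> real) \<Rightarrow> real) \<Rightarrow> real \<Rightarrow> nat \<Rightarrow> (nat \<Rightarrow> 'a) set"
  where "block_paths K F \<alpha> r b =
    {u. u 0 \<in> K \<and> u b \<in> K \<and> (\<forall>f\<in>F. \<bar>(\<Sum>i\<le>b. f (u i)) - \<alpha> f\<bar> \<le> r)}"

definition block ::
  "'a set \<Rightarrow> ('a \<Rightarrow> real) set \<Rightarrow> (('a \<Rightarrow> real) \<Rightarrow> real) \<Rightarrow> real \<Rightarrow> nat \<Rightarrow> nat \<Rightarrow> 'w set"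
  where "block K F \<alpha> r k b = {\<omega> \<in> space M. (\<lambda>i. X (k + i) \<omega>) \<in> block_paths K F \<alpha> r b}"

lemma block_iff:
  "\<omega> \<in> block K F \<alpha> r k b \<longleftrightarrow> \<omega> \<in> space M \<and> X k \<omega> \<in> K \<and> X (k + b) \<omega> \<in> K \<and>
    (\<forall>f\<in>F. \<bar>(\<Sum>i\<le>b. f (X (k + i) \<omega>)) - \<alpha> f\<bar> \<le> r)"
  by (auto simp: block_def block_paths_def)

lemma measurable_block_paths:
  assumes [measurable]: "K \<in> sets borel" and F: "test_functions F"
  shows "block_paths K F \<alpha> r b \<in> sets borel"
proof -
  have "finite F" using F by (simp add: test_functions_def)
  have "(\<lambda>u :: nat \<Rightarrow> 'a. f (u i)) \<in> borel_measurable borel" if "f \<in> F" for f i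
    using measurable_compose[OF measurable_path_component test_functions_measurable[OF F that]] .
  then have s: "{u \<in> space borel. \<bar>(\<Sum>i\<le>b. f (u i)) - \<alpha> f\<bar> \<le> r} \<in> sets (borel :: (nat \<Rightarrow> 'a) measure)"
    if "f \<in> F" for f
    using that by (intro borel_measurable_le borel_measurable_abs borel_measurable_diff
        borel_measurable_sum borel_measurable_const)
  have c: "{u \<in> space borel. u i \<in> K} \<in> sets (borel :: (nat \<Rightarrow> 'a) measure)" for i
    using measurable_sets[OF measurable_path_component assms(1), of i] by (simp add: vimage_def)
  have "block_paths K F \<alpha> r b = {u \<in> space borel. u 0 \<in> K} \<inter> {u \<in> space borel. u b \<in> K} \<inter>
      {u \<in> space borel. \<forall>f\<in>F. \<bar>(\<Sum>i\<le>b. f (u i)) - \<alpha> f\<bar> \<le> r}"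
    by (auto simp: block_paths_def)
  moreover have "{u \<in> space borel. \<forall>f\<in>F. \<bar>(\<Sum>i\<le>b. f (u i)) - \<alpha> f\<bar> \<le> r} \<in> sets (borel :: (nat \<Rightarrow> 'a) measure)"
    by (rule sets.sets_Collect_finite_All) (use s \<open>finite F\<close> in blast)+
  ultimately show ?thesis using c by (simp only: sets.Int)
qed

lemma block_paths_cong:
  assumes "\<And>i. i \<le> b \<Longrightarrow> u i = v i"
  shows "u \<in> block_paths K F \<alpha> r b \<longleftrightarrow> v \<in> block_paths K F \<alpha> r b"
proof -
  have "(\<Sum>i\<le>b. f (u i)) = (\<Sum>i\<le>b. f (v i))" for f :: "'a \<Rightarrow> real"
    using assms by (intro sum.cong) auto
  then show ?thesis using assms by (simp add: block_paths_def)
qed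

lemma block_past:
  assumes K: "K \<in> sets borel" and F: "test_functions F" and k: "k \<ge> 1"
  shows "block K F \<alpha> r k b \<in> sets (past M X (k + b))"
proof -
  define U where "U \<omega> = (\<lambda>i. X (k + min i b) \<omega>)" for \<omega>
  have U: "U \<in> past M X (k + b) \<rightarrow>\<^sub>M borel"
    unfolding U_def by (rule measurable_pathI, rule measurable_X_past) (use k in auto)
  have "(\<lambda>i. X (k + i) \<omega>) \<in> block_paths K F \<alpha> r b \<longleftrightarrow> U \<omega> \<in> block_paths K F \<alpha> r b" for \<omega>
    by (rule block_paths_cong) (simp add: U_def)
  then have "block K F \<alpha> r k b = U -` block_paths K F \<alpha> r b \<inter> space (past M X (k + b))"
    by (auto simp: block_def)
  then show ?thesis using measurable_sets[OF U measurable_block_paths[OF K F]] by simp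
qed

lemma block_event:
  "K \<in> sets borel \<Longrightarrow> test_functions F \<Longrightarrow> k \<ge> 1 \<Longrightarrow> block K F \<alpha> r k b \<in> sets M"
  using block_past past_event by blast

text \<open>Both inequalities say that a block may start a bounded time after any admissible past, at a
  cost that does not depend on the block.\<close>

definition decoupled :: "'a set set \<Rightarrow> ('a set \<Rightarrow> 'a set) \<Rightarrow> real \<Rightarrow> nat \<Rightarrow> bool"
  where "decoupled S Kf c N \<longleftrightarrow> 1 \<le> c \<and>
    (\<forall>A\<in>S. \<forall>K F \<alpha> r b m k A2. K \<in> sets borel \<longrightarrow> K \<subseteq> Kf A \<longrightarrow> test_functions F \<longrightarrow>
      A2 \<in> sets (past M X m) \<longrightarrow> (\<forall>\<omega>\<in>A2. Y m \<omega> \<in> heads S Kf A) \<longrightarrow> 1 \<le> k \<longrightarrow>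
      prob A2 * prob (block K F \<alpha> r k b) \<le> c * (\<Sum>s=1..N. prob (A2 \<inter> block K F \<alpha> r (m + s) b))) \<and>
    (\<forall>A\<in>S. \<forall>K F \<alpha> r b n k A1. K \<in> sets borel \<longrightarrow> K \<subseteq> Kf A \<longrightarrow> test_functions F \<longrightarrow>
      A1 \<in> sets (past M X n) \<longrightarrow> (\<forall>\<omega>\<in>A1. Y n \<omega> \<in> heads S Kf A) \<longrightarrow> 1 \<le> k \<longrightarrow>
      prob (A1 \<inter> block K F \<alpha> r (n + k) b) \<le> c * prob A1 * (\<Sum>s=1..N. prob (block K F \<alpha> r s b)))"

lemma decoupled_lower:
  assumes "decoupled S Kf c N" "A \<in> S" "K \<in> sets borel" "K \<subseteq> Kf A" "test_functions F" "A2 \<in> sets (past M X m)"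
    "\<And>\<omega>. \<omega> \<in> A2 \<Longrightarrow> Y m \<omega> \<in> heads S Kf A" "k \<ge> 1"
  shows "prob A2 * prob (block K F \<alpha> r k b) \<le> c * (\<Sum>s=1..N. prob (A2 \<inter> block K F \<alpha> r (m + s) b))"
  by (rule assms(1)[unfolded decoupled_def, THEN conjunct2, THEN conjunct1, rule_format]) (fact assms)+

lemma decoupled_upper:
  assumes "decoupled S Kf c N" "A \<in> S" "K \<in> sets borel" "K \<subseteq> Kf A" "test_functions F" "A1 \<in> sets (past M X n)"
    "\<And>\<omega>. \<omega> \<in> A1 \<Longrightarrow> Y n \<omega> \<in> heads S Kf A" "k \<ge> 1"
  shows "prob (A1 \<inter> block K F \<alpha> r (n + k) b) \<le> c * prob A1 * (\<Sum>s=1..N. prob (block K F \<alpha> r s b))"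
  by (rule assms(1)[unfolded decoupled_def, THEN conjunct2, THEN conjunct2, rule_format]) (fact assms)+

lemma decoupled_ge_1: "decoupled S Kf c N \<Longrightarrow> 1 \<le> c"
  by (simp add: decoupled_def)

lemma ex_decoupled:
  assumes c: "chain_data S Kf"
  shows "\<exists>c N. decoupled S Kf c N"
proof -
  obtain c :: real and N where c1: "c \<ge> 1" and dec:
    "\<And>A (B :: (nat \<Rightarrow> 'a) set) b n m k A1 A2. A \<in> S \<Longrightarrow> B \<in> sets borel \<Longrightarrow>
      (\<And>u v. (\<And>i. i \<le> b \<Longrightarrow> u i = v i) \<Longrightarrow> u \<in> B \<longleftrightarrow> v \<in> B) \<Longrightarrow> (\<And>u. u \<in> B \<Longrightarrow> u 0 \<in> Kf A) \<Longrightarrow>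
      A1 \<in> sets (past M X n) \<Longrightarrow> A2 \<in> sets (past M X m) \<Longrightarrow>
      (\<And>\<omega>. \<omega> \<in> A1 \<Longrightarrow> Y n \<omega> \<in> heads S Kf A) \<Longrightarrow> (\<And>\<omega>. \<omega> \<in> A2 \<Longrightarrow> Y m \<omega> \<in> heads S Kf A) \<Longrightarrow> k \<ge> 1 \<Longrightarrow>
      prob A2 * prob (A1 \<inter> {\<omega> \<in> space M. (\<lambda>i. X (n + k + i) \<omega>) \<in> B}) \<le>
        c * prob A1 * (\<Sum>s=1..N. prob (A2 \<inter> {\<omega> \<in> space M. (\<lambda>i. X (m + s + i) \<omega>) \<in> B}))"
    by (rule decoupling[OF c]) blast
  have sp: "space M \<in> sets (past M X 0)" using sets.top[of "past M X 0"] by simp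
  have None: "Y 0 \<omega> \<in> heads S Kf A" for \<omega> A by (simp add: Y_def heads_def)
  have bp0: "u 0 \<in> Kf A" if "u \<in> block_paths K F \<alpha> r b" "K \<subseteq> Kf A" for u K F \<alpha> r b A
    using that by (auto simp: block_paths_def)
  have "decoupled S Kf c N"
    unfolding decoupled_def
  proof (intro conjI allI ballI impI)
    show "1 \<le> c" by (rule c1)
  next
    fix A K and F :: "('a \<Rightarrow> real) set" and \<alpha> r b m k A2
    assume A: "A \<in> S" and K: "K \<in> sets borel" "K \<subseteq> Kf A" and F: "test_functions F"
      and A2: "A2 \<in> sets (past M X m)" and h: "\<forall>\<omega>\<in>A2. Y m \<omega> \<in> heads S Kf A" and k: "(1 :: nat) \<le> k"
    have "prob A2 * prob (space M \<inter> {\<omega> \<in> space M. (\<lambda>i. X (0 + k + i) \<omega>) \<in> block_paths K F \<alpha> r b}) \<le>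
        c * prob (space M) * (\<Sum>s=1..N. prob (A2 \<inter> {\<omega> \<in> space M. (\<lambda>i. X (m + s + i) \<omega>) \<in> block_paths K F \<alpha> r b}))"
    proof (rule dec[of A "block_paths K F \<alpha> r b" b])
      show "u \<in> block_paths K F \<alpha> r b \<longleftrightarrow> v \<in> block_paths K F \<alpha> r b" if "\<And>i. i \<le> b \<Longrightarrow> u i = v i" for u v
        using that by (rule block_paths_cong)
      show "u 0 \<in> Kf A" if "u \<in> block_paths K F \<alpha> r b" for u
        using that K(2) by (rule bp0)
      show "Y 0 \<omega> \<in> heads S Kf A" if "\<omega> \<in> space M" for \<omega> using None that by blast
      show "Y m \<omega> \<in> heads S Kf A" if "\<omega> \<in> A2" for \<omega> using h that by blast
    qed (fact A sp A2 k measurable_block_paths[OF K(1) F])+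
    moreover have "space M \<inter> {\<omega> \<in> space M. (\<lambda>i. X (0 + k + i) \<omega>) \<in> block_paths K F \<alpha> r b} = block K F \<alpha> r k b"
      by (auto simp: block_def)
    ultimately show "prob A2 * prob (block K F \<alpha> r k b) \<le> c * (\<Sum>s=1..N. prob (A2 \<inter> block K F \<alpha> r (m + s) b))"
      by (simp add: prob_space block_def)
  next
    fix A K and F :: "('a \<Rightarrow> real) set" and \<alpha> r b n k A1
    assume A: "A \<in> S" and K: "K \<in> sets borel" "K \<subseteq> Kf A" and F: "test_functions F"
      and A1: "A1 \<in> sets (past M X n)" and h: "\<forall>\<omega>\<in>A1. Y n \<omega> \<in> heads S Kf A" and k: "(1 :: nat) \<le> k"
    have "prob (space M) * prob (A1 \<inter> {\<omega> \<in> space M. (\<lambda>i. X (n + k + i) \<omega>) \<in> block_paths K F \<alpha> r b}) \<le>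
        c * prob A1 * (\<Sum>s=1..N. prob (space M \<inter> {\<omega> \<in> space M. (\<lambda>i. X (0 + s + i) \<omega>) \<in> block_paths K F \<alpha> r b}))"
    proof (rule dec[of A "block_paths K F \<alpha> r b" b])
      show "u \<in> block_paths K F \<alpha> r b \<longleftrightarrow> v \<in> block_paths K F \<alpha> r b" if "\<And>i. i \<le> b \<Longrightarrow> u i = v i" for u v
        using that by (rule block_paths_cong)
      show "u 0 \<in> Kf A" if "u \<in> block_paths K F \<alpha> r b" for u
        using that K(2) by (rule bp0)
      show "Y n \<omega> \<in> heads S Kf A" if "\<omega> \<in> A1" for \<omega> using h that by blast
      show "Y 0 \<omega> \<in> heads S Kf A" if "\<omega> \<in> space M" for \<omega> using None that by blast
    qed (fact A sp A1 k measurable_block_paths[OF K(1) F])+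
    moreover have "space M \<inter> {\<omega> \<in> space M. (\<lambda>i. X (0 + s + i) \<omega>) \<in> block_paths K F \<alpha> r b} = block K F \<alpha> r s b" for s
      by (auto simp: block_def)
    ultimately show "prob (A1 \<inter> block K F \<alpha> r (n + k) b) \<le> c * prob A1 * (\<Sum>s=1..N. prob (block K F \<alpha> r s b))"
      by (simp add: prob_space block_def)
  qed
  then show ?thesis by blast
qed

definition max_prob :: "'a set \<Rightarrow> ('a \<Rightarrow> real) set \<Rightarrow> (('a \<Rightarrow> real) \<Rightarrow> real) \<Rightarrow> real \<Rightarrow> real"
  where "max_prob K F \<alpha> r = (SUP kb\<in>{1..} \<times> UNIV. prob (block K F \<alpha> r (fst kb) (snd kb)))"

lemma max_prob_upper: "k \<ge> 1 \<Longrightarrow> prob (block K F \<alpha> r k b) \<le> max_prob K F \<alpha> r"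
  unfolding max_prob_def
  by (rule cSUP_upper2[where x = "(k, b)"]) (auto intro!: bdd_aboveI[of _ 1] prob_le_1)

lemma max_prob_least: "(\<And>k b. k \<ge> 1 \<Longrightarrow> prob (block K F \<alpha> r k b) \<le> x) \<Longrightarrow> max_prob K F \<alpha> r \<le> x"
  unfolding max_prob_def by (rule cSUP_least) auto

lemma max_prob_nonneg: "0 \<le> max_prob K F \<alpha> r"
  using max_prob_upper[of 1] measure_nonneg order_trans by blast

lemma max_prob_less:
  assumes "x < max_prob K F \<alpha> r"
  obtains k b where "k \<ge> 1" "x < prob (block K F \<alpha> r k b)"
  using max_prob_least[of K F \<alpha> r x] assms by (meson not_le)

lemma max_prob_mono:
  assumes "K \<subseteq> K'" "F' \<subseteq> F" "\<And>f. f \<in> F' \<Longrightarrow> \<bar>\<alpha> f - \<alpha>' f\<bar> \<le> r' - r"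
    and "K' \<in> sets borel" "test_functions F'"
  shows "max_prob K F \<alpha> r \<le> max_prob K' F' \<alpha>' r'"
proof (rule max_prob_least)
  fix k b :: nat assume k: "k \<ge> 1"
  have "block K F \<alpha> r k b \<subseteq> block K' F' \<alpha>' r' k b"
  proof
    fix \<omega> assume \<omega>: "\<omega> \<in> block K F \<alpha> r k b"
    have "\<bar>(\<Sum>i\<le>b. f (X (k + i) \<omega>)) - \<alpha>' f\<bar> \<le> r'" if "f \<in> F'" for f
    proof -
      have "\<bar>(\<Sum>i\<le>b. f (X (k + i) \<omega>)) - \<alpha> f\<bar> \<le> r" using \<omega> that assms(2) by (auto simp: block_iff)
      with assms(3)[OF that] show ?thesis by linarith
    qed
    then show "\<omega> \<in> block K' F' \<alpha>' r' k b" using \<omega> assms(1) by (auto simp: block_iff)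
  qed
  then have "prob (block K F \<alpha> r k b) \<le> prob (block K' F' \<alpha>' r' k b)"
    using assms k by (intro finite_measure_mono block_event)
  also have "\<dots> \<le> max_prob K' F' \<alpha>' r'" by (rule max_prob_upper[OF k])
  finally show "prob (block K F \<alpha> r k b) \<le> max_prob K' F' \<alpha>' r'" .
qed

definition regular_class :: "'a set \<Rightarrow> bool"
  where "regular_class A \<longleftrightarrow> A \<in> classes \<and> leads_to \<rho> None (Some A)"

lemma max_prob_superadditive:
  assumes A: "regular_class A" and K: "compact K1" "K1 \<subseteq> A" "compact K2" "K2 \<subseteq> A"
  obtains C N where "(C :: real) \<ge> 1"
    "\<And>F \<alpha>1 \<alpha>2 r1 r2 D. test_functions F \<Longrightarrow> (\<And>f x. f \<in> F \<Longrightarrow> \<bar>f x\<bar> \<le> D) \<Longrightarrow>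
      max_prob K1 F \<alpha>1 r1 * max_prob K2 F \<alpha>2 r2 \<le>
        C * max_prob (K1 \<union> K2) F (\<lambda>f. \<alpha>1 f + \<alpha>2 f) (r1 + r2 + real N * \<bar>D\<bar>)"
proof -
  have [measurable]: "K1 \<in> sets borel" "K2 \<in> sets borel" using K by (auto intro: borel_compact)
  have A': "A \<in> classes" "leads_to \<rho> None (Some A)" using A by (auto simp: regular_class_def)
  have cd: "chain_data {A} (\<lambda>_. K1 \<union> K2)"
    using A' K leads_to_refl[OF A'(1)] by (auto simp: chain_data_def comparable_def simp del: leads_to.simps)
  obtain c N where dec: "decoupled {A} (\<lambda>_. K1 \<union> K2) c N" using ex_decoupled[OF cd] by blast
  note c1 = decoupled_ge_1[OF dec]
  show thesis
  proof (rule that[of "max 1 (c * N)" N])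
    show "1 \<le> max 1 (c * real N)" by simp
    fix F :: "('a \<Rightarrow> real) set" and \<alpha>1 \<alpha>2 r1 r2 D
    assume F: "test_functions F" and D: "\<And>f x. f \<in> F \<Longrightarrow> \<bar>f x\<bar> \<le> D"
    let ?E = "max_prob (K1 \<union> K2) F (\<lambda>f. \<alpha>1 f + \<alpha>2 f) (r1 + r2 + real N * \<bar>D\<bar>)"
    have *: "prob (block K1 F \<alpha>1 r1 k1 b1) * prob (block K2 F \<alpha>2 r2 k2 b2) \<le> max 1 (c * N) * ?E"
      if k: "k1 \<ge> 1" "k2 \<ge> 1" for k1 b1 k2 b2
    proof -
      have "prob (block K1 F \<alpha>1 r1 k1 b1) * prob (block K2 F \<alpha>2 r2 k2 b2) \<le>
          c * (\<Sum>s=1..N. prob (block K1 F \<alpha>1 r1 k1 b1 \<inter> block K2 F \<alpha>2 r2 (k1 + b1 + s) b2))"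
      proof (rule decoupled_lower[OF dec])
        show "block K1 F \<alpha>1 r1 k1 b1 \<in> sets (past M X (k1 + b1))" by (rule block_past) (use F k in auto)
        show "Y (k1 + b1) \<omega> \<in> heads {A} (\<lambda>_. K1 \<union> K2) A" if "\<omega> \<in> block K1 F \<alpha>1 r1 k1 b1" for \<omega>
          using that k leads_to_refl[OF A'(1)] by (auto simp: block_iff Y_def heads_def simp del: leads_to.simps)
      qed (use F k in auto)
      also have "\<dots> \<le> c * (\<Sum>s=1..N. ?E)"
      proof (intro mult_left_mono sum_mono)
        fix s assume s: "s \<in> {1..N}"
        have "block K1 F \<alpha>1 r1 k1 b1 \<inter> block K2 F \<alpha>2 r2 (k1 + b1 + s) b2 \<subseteq>
          block (K1 \<union> K2) F (\<lambda>f. \<alpha>1 f + \<alpha>2 f) (r1 + r2 + real N * \<bar>D\<bar>) k1 (b1 + s + b2)"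
        proof
          fix \<omega> assume \<omega>: "\<omega> \<in> block K1 F \<alpha>1 r1 k1 b1 \<inter> block K2 F \<alpha>2 r2 (k1 + b1 + s) b2"
          have "\<bar>(\<Sum>i\<le>b1 + s + b2. f (X (k1 + i) \<omega>)) - (\<alpha>1 f + \<alpha>2 f)\<bar> \<le> r1 + r2 + real N * \<bar>D\<bar>" if f: "f \<in> F" for f
          proof -
            have "\<bar>(\<Sum>i\<le>b1. f (X (k1 + i) \<omega>)) - \<alpha>1 f\<bar> \<le> r1"
              "\<bar>(\<Sum>i\<le>b2. f (X (k1 + (b1 + s + i)) \<omega>)) - \<alpha>2 f\<bar> \<le> r2"
              using \<omega> f by (auto simp: block_iff add.assoc)
            moreover have "\<bar>(\<Sum>i\<le>b1 + s + b2. f (X (k1 + i) \<omega>)) - (\<Sum>i\<le>b1. f (X (k1 + i) \<omega>)) -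
                (\<Sum>i\<le>b2. f (X (k1 + (b1 + s + i)) \<omega>))\<bar> \<le> s * D"
              using sum_gap[of s "\<lambda>i. f (X (k1 + i) \<omega>)" D 0 b1 b2] s D f by (simp add: atMost_atLeast0 add.assoc)
            moreover have "s * D \<le> N * \<bar>D\<bar>"
            proof -
              have "s * D \<le> s * \<bar>D\<bar>" by (intro mult_left_mono) auto
              also have "\<dots> \<le> N * \<bar>D\<bar>" using s by (intro mult_right_mono) auto
              finally show ?thesis .
            qed
            ultimately show ?thesis by linarith
          qed
          moreover have "X k1 \<omega> \<in> K1" "X (k1 + b1 + s + b2) \<omega> \<in> K2" using \<omega> by (auto simp: block_iff)
          ultimately show "\<omega> \<in> block (K1 \<union> K2) F (\<lambda>f. \<alpha>1 f + \<alpha>2 f) (r1 + r2 + real N * \<bar>D\<bar>) k1 (b1 + s + b2)"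
            using \<omega> by (auto simp: block_iff add.assoc)
        qed
        then have "prob (block K1 F \<alpha>1 r1 k1 b1 \<inter> block K2 F \<alpha>2 r2 (k1 + b1 + s) b2) \<le>
            prob (block (K1 \<union> K2) F (\<lambda>f. \<alpha>1 f + \<alpha>2 f) (r1 + r2 + real N * \<bar>D\<bar>) k1 (b1 + s + b2))"
          using F k by (intro finite_measure_mono block_event) auto
        also have "\<dots> \<le> ?E" by (rule max_prob_upper[OF k(1)])
        finally show "prob (block K1 F \<alpha>1 r1 k1 b1 \<inter> block K2 F \<alpha>2 r2 (k1 + b1 + s) b2) \<le> ?E" .
      qed (use c1 in auto)
      also have "\<dots> = c * N * ?E" by simp
      also have "\<dots> \<le> max 1 (c * N) * ?E" by (rule mult_right_mono) (auto simp: max_prob_nonneg)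
      finally show ?thesis .
    qed
    have "prob (block K1 F \<alpha>1 r1 k1 b1) * max_prob K2 F \<alpha>2 r2 \<le> max 1 (c * N) * ?E" if k1: "k1 \<ge> 1" for k1 b1
    proof (cases "prob (block K1 F \<alpha>1 r1 k1 b1) = 0")
      case False
      then have pos: "prob (block K1 F \<alpha>1 r1 k1 b1) > 0" by (simp add: zero_less_measure_iff)
      have "max_prob K2 F \<alpha>2 r2 \<le> max 1 (c * N) * ?E / prob (block K1 F \<alpha>1 r1 k1 b1)"
        using *[OF k1] pos by (intro max_prob_least) (simp add: pos_le_divide_eq mult.commute)
      then show ?thesis using pos by (simp add: pos_le_divide_eq mult.commute)
    qed (simp add: max_prob_nonneg)
    note ** = this
    show "max_prob K1 F \<alpha>1 r1 * max_prob K2 F \<alpha>2 r2 \<le> max 1 (c * N) * ?E"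
    proof (cases "max_prob K2 F \<alpha>2 r2 = 0")
      case False
      then have pos: "max_prob K2 F \<alpha>2 r2 > 0" using max_prob_nonneg[of K2 F \<alpha>2 r2] by linarith
      have "max_prob K1 F \<alpha>1 r1 \<le> max 1 (c * N) * ?E / max_prob K2 F \<alpha>2 r2"
        using ** pos by (intro max_prob_least) (simp add: pos_le_divide_eq)
      then show ?thesis using pos by (simp add: pos_le_divide_eq)
    qed (simp add: max_prob_nonneg)
  qed
qed

text \<open>The functional \<open>\<Lambda>\<close> stands for an unnormalised occupation measure. The scale \<open>t\<close> is real, so
  that scaling \<open>\<Lambda>\<close> amounts to scaling \<open>t\<close>; and it is enough to ask for arbitrarily large \<open>t\<close>,
  because supermultiplicativity extends the bound to all large \<open>t\<close>.\<close>

definition recurrent_rate ::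
  "'a set \<Rightarrow> ('a \<Rightarrow> real) set \<Rightarrow> real \<Rightarrow> (('a \<Rightarrow> real) \<Rightarrow> real) \<Rightarrow> real \<Rightarrow> bool"
  where "recurrent_rate K F \<epsilon> \<Lambda> a \<longleftrightarrow>
    (\<exists>\<^sub>F t in at_top. exp (- a * t) \<le> max_prob K F (\<lambda>f. t * \<Lambda> f) (\<epsilon> * t))"

lemma max_prob_power:
  assumes C: "C \<ge> 1" and F: "test_functions F" and D: "\<And>f x. f \<in> F \<Longrightarrow> \<bar>f x\<bar> \<le> D"
    and super: "\<And>F \<alpha>1 \<alpha>2 r1 r2 D. test_functions F \<Longrightarrow> (\<And>f x. f \<in> F \<Longrightarrow> \<bar>f x\<bar> \<le> D) \<Longrightarrow>
      max_prob K F \<alpha>1 r1 * max_prob K F \<alpha>2 r2 \<le>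
        C * max_prob (K \<union> K) F (\<lambda>f. \<alpha>1 f + \<alpha>2 f) (r1 + r2 + real N * \<bar>D\<bar>)"
  shows "max_prob K F \<alpha> r ^ Suc n \<le>
    C ^ n * max_prob K F (\<lambda>f. real (Suc n) * \<alpha> f) (real (Suc n) * r + real n * (real N * \<bar>D\<bar>))"
proof (induction n)
  case 0
  then show ?case by simp
next
  case (Suc n)
  let ?E = "max_prob K F (\<lambda>f. real (Suc n) * \<alpha> f) (real (Suc n) * r + real n * (real N * \<bar>D\<bar>))"
  have "max_prob K F \<alpha> r ^ Suc (Suc n) \<le> max_prob K F \<alpha> r * (C ^ n * ?E)"
    using mult_left_mono[OF Suc.IH max_prob_nonneg[of K F \<alpha> r]] by simp
  also have "\<dots> = C ^ n * (max_prob K F \<alpha> r * ?E)" by simp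
  also have "\<dots> \<le> C ^ n * (C * max_prob (K \<union> K) F (\<lambda>f. \<alpha> f + real (Suc n) * \<alpha> f)
      (r + (real (Suc n) * r + real n * (real N * \<bar>D\<bar>)) + real N * \<bar>D\<bar>))"
    using C F D by (intro mult_left_mono super) auto
  also have "(\<lambda>f. \<alpha> f + real (Suc n) * \<alpha> f) = (\<lambda>f. real (Suc (Suc n)) * \<alpha> f)"
    by (simp add: fun_eq_iff algebra_simps)
  also have "r + (real (Suc n) * r + real n * (real N * \<bar>D\<bar>)) + real N * \<bar>D\<bar> =
      real (Suc (Suc n)) * r + real (Suc n) * (real N * \<bar>D\<bar>)" by (simp add: algebra_simps)
  finally show ?case by (simp only: power_Suc mult_ac Un_absorb)
qed

lemma recurrent_rate_eventually:
  assumes A: "regular_class A" and K: "compact K" "K \<subseteq> A" and F: "test_functions F" and e: "\<epsilon> > 0"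
    and rr: "recurrent_rate K F \<epsilon> \<Lambda> a" and a: "0 \<le> a" "a < a'"
  shows "\<forall>\<^sub>F t in at_top. exp (- a' * t) \<le> max_prob K F (\<lambda>f. t * \<Lambda> f) (4 * \<epsilon> * t)"
proof -
  obtain C N where C: "C \<ge> 1" and super: "\<And>F \<alpha>1 \<alpha>2 r1 r2 D. test_functions F \<Longrightarrow>
      (\<And>f x. f \<in> F \<Longrightarrow> \<bar>f x\<bar> \<le> D) \<Longrightarrow>
      max_prob K F \<alpha>1 r1 * max_prob K F \<alpha>2 r2 \<le>
        C * max_prob (K \<union> K) F (\<lambda>f. \<alpha>1 f + \<alpha>2 f) (r1 + r2 + real N * \<bar>D\<bar>)"
    by (rule max_prob_superadditive[OF A K K]) blast
  obtain D where D: "D \<ge> 1" "\<And>f x. f \<in> F \<Longrightarrow> \<bar>f x\<bar> \<le> D"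
    by (rule test_functions_bound[OF F]) blast
  define L where "L = (\<Sum>f\<in>F. \<bar>\<Lambda> f\<bar>)"
  have L: "\<bar>\<Lambda> f\<bar> \<le> L" if "f \<in> F" for f
    unfolding L_def using that F by (intro member_le_sum) (auto simp: test_functions_def)
  have [measurable]: "K \<in> sets borel" using K by (simp add: borel_compact)
  have "\<forall>\<^sub>F t in at_top. t \<ge> max 1 (max (ln C / (a' - a)) (N * D / \<epsilon>))"
    by (rule eventually_ge_at_top)
  then have "\<exists>\<^sub>F t in at_top. exp (- a * t) \<le> max_prob K F (\<lambda>f. t * \<Lambda> f) (\<epsilon> * t) \<and>
      t \<ge> max 1 (max (ln C / (a' - a)) (N * D / \<epsilon>))"
    using rr unfolding recurrent_rate_def by (rule frequently_eventually_frequently[rotated])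
  then obtain t0 where t0: "exp (- a * t0) \<le> max_prob K F (\<lambda>f. t0 * \<Lambda> f) (\<epsilon> * t0)"
    "t0 \<ge> 1" "ln C / (a' - a) \<le> t0" "N * D / \<epsilon> \<le> t0"
    by (auto dest!: frequently_ex)
  have CC: "C \<le> exp ((a' - a) * t0)"
  proof -
    have "ln C \<le> (a' - a) * t0" using t0(3) a by (simp add: pos_divide_le_eq mult.commute)
    then show ?thesis using C by (metis exp_le_cancel_iff exp_ln less_le_trans zero_less_one)
  qed
  have ND: "N * D \<le> \<epsilon> * t0" using t0(4) e by (simp add: pos_divide_le_eq mult.commute)
  have main: "exp (- a' * (real (Suc n) * t0)) \<le>
      max_prob K F (\<lambda>f. real (Suc n) * (t0 * \<Lambda> f)) (2 * \<epsilon> * (real (Suc n) * t0))" for n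
  proof -
    let ?E = "max_prob K F (\<lambda>f. real (Suc n) * (t0 * \<Lambda> f)) (real (Suc n) * (\<epsilon> * t0) + real n * (real N * \<bar>D\<bar>))"
    have "exp (- a * t0) ^ Suc n \<le> max_prob K F (\<lambda>f. t0 * \<Lambda> f) (\<epsilon> * t0) ^ Suc n"
      by (rule power_mono[OF t0(1)]) simp
    also have "\<dots> \<le> C ^ n * ?E"
    proof (rule max_prob_power[OF C F])
      show "\<bar>f x\<bar> \<le> D" if "f \<in> F" for f x using D(2) that .
      show "max_prob K F' \<alpha>1 r1 * max_prob K F' \<alpha>2 r2 \<le>
          C * max_prob (K \<union> K) F' (\<lambda>f. \<alpha>1 f + \<alpha>2 f) (r1 + r2 + real N * \<bar>D'\<bar>)"
        if "test_functions F'" "\<And>f x. f \<in> F' \<Longrightarrow> \<bar>f x\<bar> \<le> D'" for F' \<alpha>1 \<alpha>2 r1 r2 D'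
        by (rule super) (fact that)+
    qed
    also have "\<dots> \<le> exp ((a' - a) * t0) ^ n * ?E"
      using CC C by (intro mult_right_mono power_mono) (auto simp: max_prob_nonneg)
    also have "\<dots> \<le> exp ((a' - a) * t0) ^ Suc n * ?E"
      using a t0 by (intro mult_right_mono power_increasing) (auto simp: max_prob_nonneg)
    finally have "exp (- a * t0) ^ Suc n \<le> exp ((a' - a) * t0) ^ Suc n * ?E" .
    then have "exp (real (Suc n) * (- a * t0)) \<le> exp (real (Suc n) * ((a' - a) * t0)) * ?E"
      unfolding exp_of_nat_mult by simp
    then have "exp (- (real (Suc n) * ((a' - a) * t0))) * exp (real (Suc n) * (- a * t0)) \<le>
        exp (- (real (Suc n) * ((a' - a) * t0))) * (exp (real (Suc n) * ((a' - a) * t0)) * ?E)"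
      by (intro mult_left_mono) auto
    also have "\<dots> = ?E" by (simp add: exp_minus)
    also have "exp (- (real (Suc n) * ((a' - a) * t0))) * exp (real (Suc n) * (- a * t0)) = exp (- a' * (real (Suc n) * t0))"
      by (simp add: exp_add[symmetric] algebra_simps)
    also have "?E \<le> max_prob K F (\<lambda>f. real (Suc n) * (t0 * \<Lambda> f)) (2 * \<epsilon> * (real (Suc n) * t0))"
    proof (rule max_prob_mono)
      have "real n * (real N * \<bar>D\<bar>) \<le> real (Suc n) * (\<epsilon> * t0)"
        using ND D(1) e t0 by (intro mult_mono[of "real n" "real (Suc n)"]) auto
      then show "\<bar>real (Suc n) * (t0 * \<Lambda> f) - real (Suc n) * (t0 * \<Lambda> f)\<bar> \<le>
          2 * \<epsilon> * (real (Suc n) * t0) - (real (Suc n) * (\<epsilon> * t0) + real n * (real N * \<bar>D\<bar>))" for f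
        by (simp add: algebra_simps)
    qed (use F in auto)
    finally show ?thesis .
  qed
  have "\<forall>\<^sub>F t in at_top. t \<ge> max t0 (t0 * L / \<epsilon>)" by (rule eventually_ge_at_top)
  then show ?thesis
  proof eventually_elim
    case (elim t)
    define q where "q = nat \<lfloor>t / t0\<rfloor>"
    have tt: "t / t0 \<ge> 1" using elim t0 by simp
    then have q1: "q \<ge> 1" by (simp add: q_def le_nat_iff)
    have qt: "real q \<le> t / t0" "t / t0 < real q + 1"
    proof -
      have "real q = of_int \<lfloor>t / t0\<rfloor>" using tt by (simp add: q_def)
      then show "real q \<le> t / t0" "t / t0 < real q + 1" by linarith+
    qed
    have qt': "real q * t0 \<le> t" "t < (real q + 1) * t0"
      using qt t0 by (simp_all add: pos_le_divide_eq pos_divide_less_eq)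
    obtain n where n: "q = Suc n" using q1 by (cases q) auto
    have t: "t > 0" using elim t0 by linarith
    have LL: "t0 * L \<le> \<epsilon> * t" using elim e by (simp add: pos_divide_le_eq mult.commute)
    have "exp (- a' * t) \<le> exp (- a' * (real (Suc n) * t0))"
      using qt' a n by simp
    also have "\<dots> \<le> max_prob K F (\<lambda>f. real (Suc n) * (t0 * \<Lambda> f)) (2 * \<epsilon> * (real (Suc n) * t0))"
      by (rule main)
    also have "\<dots> \<le> max_prob K F (\<lambda>f. t * \<Lambda> f) (4 * \<epsilon> * t)"
    proof (rule max_prob_mono)
      fix f assume f: "f \<in> F"
      have "\<bar>real (Suc n) * (t0 * \<Lambda> f) - t * \<Lambda> f\<bar> = \<bar>real q * t0 - t\<bar> * \<bar>\<Lambda> f\<bar>"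
        by (simp add: n abs_mult[symmetric] algebra_simps)
      also have "\<dots> \<le> t0 * L" using qt' L[OF f] t0 by (intro mult_mono) (auto simp: algebra_simps)
      also have "\<dots> \<le> \<epsilon> * t" by (rule LL)
      finally have 1: "\<bar>real (Suc n) * (t0 * \<Lambda> f) - t * \<Lambda> f\<bar> \<le> \<epsilon> * t" .
      have 2: "\<epsilon> * (real (Suc n) * t0) \<le> \<epsilon> * t" using qt' e n by simp
      have 3: "0 \<le> \<epsilon> * t" using e t by simp
      show "\<bar>real (Suc n) * (t0 * \<Lambda> f) - t * \<Lambda> f\<bar> \<le> 4 * \<epsilon> * t - 2 * \<epsilon> * (real (Suc n) * t0)"
        using 1 2 3 by (simp add: mult.assoc)
    qed (use F in auto)
    finally show ?case .
  qed
qed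

definition rate_set :: "'a set \<Rightarrow> (('a \<Rightarrow> real) \<Rightarrow> real) \<Rightarrow> real set"
  where "rate_set A \<Lambda> = {a. 0 \<le> a \<and> (\<forall>F \<epsilon>. test_functions F \<longrightarrow> \<epsilon> > 0 \<longrightarrow>
    (\<exists>K. compact K \<and> K \<subseteq> A \<and> recurrent_rate K F \<epsilon> \<Lambda> a))}"

definition class_rate :: "'a set \<Rightarrow> (('a \<Rightarrow> real) \<Rightarrow> real) \<Rightarrow> ennreal"
  where "class_rate A \<Lambda> = (INF a\<in>rate_set A \<Lambda>. ennreal a)"

lemma class_rate_lessD:
  assumes A: "regular_class A" and less: "class_rate A \<Lambda> < ennreal a" and F: "test_functions F" and e: "\<epsilon> > 0"
  shows "\<exists>K. compact K \<and> K \<subseteq> A \<and>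
    (\<forall>\<^sub>F t in at_top. exp (- a * t) \<le> max_prob K F (\<lambda>f. t * \<Lambda> f) (\<epsilon> * t))"
proof -
  obtain a' where a': "a' \<in> rate_set A \<Lambda>" "ennreal a' < ennreal a"
    using less unfolding class_rate_def by (auto simp: INF_less_iff)
  then have a: "0 \<le> a'" "a' < a" by (auto simp: rate_set_def ennreal_less_iff)
  obtain K where K: "compact K" "K \<subseteq> A" "recurrent_rate K F (\<epsilon> / 4) \<Lambda> a'"
  proof -
    have "\<forall>F \<epsilon>. test_functions F \<longrightarrow> \<epsilon> > 0 \<longrightarrow>
        (\<exists>K. compact K \<and> K \<subseteq> A \<and> recurrent_rate K F \<epsilon> \<Lambda> a')"
      using a'(1) unfolding rate_set_def by blast
    moreover have "\<epsilon> / 4 > 0" using e by simp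
    ultimately show ?thesis using F that by blast
  qed
  have 4: "4 * (\<epsilon> / 4) = \<epsilon>" and "\<epsilon> / 4 > 0" using e by simp_all
  show ?thesis
    using recurrent_rate_eventually[OF A K(1,2) F \<open>\<epsilon> / 4 > 0\<close> K(3) a, unfolded 4] K(1,2) by blast
qed

lemma class_rate_greaterD:
  assumes "ennreal a < class_rate A \<Lambda>" "0 \<le> a"
  obtains F \<epsilon> where "test_functions F" "\<epsilon> > 0"
    "\<And>K. compact K \<Longrightarrow> K \<subseteq> A \<Longrightarrow>
      \<forall>\<^sub>F t in at_top. max_prob K F (\<lambda>f. t * \<Lambda> f) (\<epsilon> * t) < exp (- a * t)"
proof -
  have "a \<notin> rate_set A \<Lambda>"
    using assms(1) unfolding class_rate_def by (meson INF_lower not_le)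
  then obtain F \<epsilon> where "test_functions F" "\<epsilon> > 0"
      "\<And>K. compact K \<Longrightarrow> K \<subseteq> A \<Longrightarrow> \<not> recurrent_rate K F \<epsilon> \<Lambda> a"
    using assms(2) unfolding rate_set_def by blast
  then show thesis
    by (intro that[of F \<epsilon>]) (simp_all add: recurrent_rate_def frequently_def not_le)
qed

lemma class_rate_le:
  assumes "0 \<le> a" "\<And>F \<epsilon>. test_functions F \<Longrightarrow> \<epsilon> > 0 \<Longrightarrow> \<exists>K. compact K \<and> K \<subseteq> A \<and>
    (\<forall>\<^sub>F t in at_top. exp (- a * t) \<le> max_prob K F (\<lambda>f. t * \<Lambda> f) (\<epsilon> * t))"
  shows "class_rate A \<Lambda> \<le> ennreal a"
proof -
  have "\<exists>K. compact K \<and> K \<subseteq> A \<and> recurrent_rate K F \<epsilon> \<Lambda> a" if "test_functions F" "\<epsilon> > 0" for F \<epsilon>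
    using assms(2)[OF that] eventually_frequently[OF trivial_limit_at_top_linorder]
    unfolding recurrent_rate_def by blast
  then have "a \<in> rate_set A \<Lambda>" using assms(1) unfolding rate_set_def by blast
  then show ?thesis unfolding class_rate_def by (rule INF_lower)
qed

lemma max_prob_cong: "(\<And>f. f \<in> F \<Longrightarrow> \<alpha> f = \<alpha>' f) \<Longrightarrow> max_prob K F \<alpha> r = max_prob K F \<alpha>' r"
  unfolding max_prob_def block_def block_paths_def by simp

lemma class_rate_add:
  assumes A: "regular_class A"
    and \<Lambda>: "\<And>f. continuous_on UNIV f \<Longrightarrow> bounded (range f) \<Longrightarrow> \<Lambda> f = \<Lambda>1 f + \<Lambda>2 f"
  shows "class_rate A \<Lambda> \<le> class_rate A \<Lambda>1 + class_rate A \<Lambda>2"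
proof (rule ennreal_le_epsilon)
  fix e :: real assume fin: "class_rate A \<Lambda>1 + class_rate A \<Lambda>2 < top" and e: "0 < e"
  define a1 a2 where "a1 = enn2real (class_rate A \<Lambda>1) + e / 3" and "a2 = enn2real (class_rate A \<Lambda>2) + e / 3"
  have less: "class_rate A \<Lambda>1 < ennreal a1" "class_rate A \<Lambda>2 < ennreal a2"
    using fin e by (cases "class_rate A \<Lambda>1"; cases "class_rate A \<Lambda>2";
        auto simp: a1_def a2_def ennreal_less_iff)+
  have pos: "a1 \<ge> 0" "a2 \<ge> 0" using e by (simp_all add: a1_def a2_def)
  have "class_rate A \<Lambda> \<le> ennreal (a1 + a2 + e / 3)"
  proof (rule class_rate_le)
    fix F :: "('a \<Rightarrow> real) set" and \<epsilon> :: real assume F: "test_functions F" and \<epsilon>: "\<epsilon> > 0"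
    have e3: "\<epsilon> / 3 > 0" using \<epsilon> by simp
    obtain K1 where K1: "compact K1" "K1 \<subseteq> A"
      and ev1: "\<forall>\<^sub>F t in at_top. exp (- a1 * t) \<le> max_prob K1 F (\<lambda>f. t * \<Lambda>1 f) (\<epsilon> / 3 * t)"
      using class_rate_lessD[OF A less(1) F e3] by blast
    obtain K2 where K2: "compact K2" "K2 \<subseteq> A"
      and ev2: "\<forall>\<^sub>F t in at_top. exp (- a2 * t) \<le> max_prob K2 F (\<lambda>f. t * \<Lambda>2 f) (\<epsilon> / 3 * t)"
      using class_rate_lessD[OF A less(2) F e3] by blast
    obtain C N where C: "C \<ge> 1" and super: "\<And>F \<alpha>1 \<alpha>2 r1 r2 D. test_functions F \<Longrightarrow>
      (\<And>f x. f \<in> F \<Longrightarrow> \<bar>f x\<bar> \<le> D) \<Longrightarrow> max_prob K1 F \<alpha>1 r1 * max_prob K2 F \<alpha>2 r2 \<le>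
        C * max_prob (K1 \<union> K2) F (\<lambda>f. \<alpha>1 f + \<alpha>2 f) (r1 + r2 + real N * \<bar>D\<bar>)"
      by (rule max_prob_superadditive[OF A K1 K2]) blast
    obtain D where D: "D \<ge> 1" "\<And>f x. f \<in> F \<Longrightarrow> \<bar>f x\<bar> \<le> D"
      by (rule test_functions_bound[OF F]) blast
    have [measurable]: "K1 \<in> sets borel" "K2 \<in> sets borel" using K1 K2 by (auto intro: borel_compact)
    have "\<forall>\<^sub>F t in at_top. t \<ge> max (3 * (N * D) / \<epsilon>) (ln C / (e / 3))" by (rule eventually_ge_at_top)
    with ev1 ev2 have "\<forall>\<^sub>F t in at_top. exp (- (a1 + a2 + e / 3) * t) \<le> max_prob (K1 \<union> K2) F (\<lambda>f. t * \<Lambda> f) (\<epsilon> * t)"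
    proof eventually_elim
      case (elim t)
      have t: "N * D \<le> \<epsilon> / 3 * t" "ln C \<le> e / 3 * t"
        using elim(3) \<epsilon> e by (simp_all add: field_simps)
      have CC: "C \<le> exp (e / 3 * t)"
        using t(2) C by (metis exp_le_cancel_iff exp_ln less_le_trans zero_less_one)
      let ?E = "max_prob (K1 \<union> K2) F (\<lambda>f. t * \<Lambda> f) (\<epsilon> * t)"
      have "exp (- a1 * t) * exp (- a2 * t) \<le>
          max_prob K1 F (\<lambda>f. t * \<Lambda>1 f) (\<epsilon> / 3 * t) * max_prob K2 F (\<lambda>f. t * \<Lambda>2 f) (\<epsilon> / 3 * t)"
        using elim by (intro mult_mono) (auto simp: max_prob_nonneg)
      also have "\<dots> \<le> C * max_prob (K1 \<union> K2) F (\<lambda>f. t * \<Lambda>1 f + t * \<Lambda>2 f) (\<epsilon> / 3 * t + \<epsilon> / 3 * t + real N * \<bar>D\<bar>)"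
        by (rule super[OF F]) (rule D(2))
      also have "\<dots> \<le> C * ?E"
      proof (intro mult_left_mono max_prob_mono)
        fix f assume "f \<in> F"
        then have "\<Lambda> f = \<Lambda>1 f + \<Lambda>2 f" using F by (intro \<Lambda>) (auto simp: test_functions_def)
        then show "\<bar>t * \<Lambda>1 f + t * \<Lambda>2 f - t * \<Lambda> f\<bar> \<le> \<epsilon> * t - (\<epsilon> / 3 * t + \<epsilon> / 3 * t + real N * \<bar>D\<bar>)"
          using t(1) D(1) by (simp add: algebra_simps)
      qed (use F C in auto)
      also have "\<dots> \<le> exp (e / 3 * t) * ?E" using CC by (intro mult_right_mono) (auto simp: max_prob_nonneg)
      finally have "exp (- (e / 3 * t)) * (exp (- a1 * t) * exp (- a2 * t)) \<le> exp (- (e / 3 * t)) * (exp (e / 3 * t) * ?E)"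
        by (intro mult_left_mono) auto
      also have "\<dots> = ?E" by (simp add: exp_minus)
      also have "exp (- (e / 3 * t)) * (exp (- a1 * t) * exp (- a2 * t)) = exp (- (a1 + a2 + e / 3) * t)"
        by (simp add: exp_add[symmetric] algebra_simps)
      finally show ?case .
    qed
    then show "\<exists>K. compact K \<and> K \<subseteq> A \<and>
        (\<forall>\<^sub>F t in at_top. exp (- (a1 + a2 + e / 3) * t) \<le> max_prob K F (\<lambda>f. t * \<Lambda> f) (\<epsilon> * t))"
      using K1 K2 by (intro exI[of _ "K1 \<union> K2"]) auto
  qed (use pos e in auto)
  also have "a1 + a2 + e / 3 = enn2real (class_rate A \<Lambda>1) + enn2real (class_rate A \<Lambda>2) + e"
    by (simp add: a1_def a2_def)
  also have "ennreal \<dots> = class_rate A \<Lambda>1 + class_rate A \<Lambda>2 + ennreal e"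
    using fin e by (cases "class_rate A \<Lambda>1"; cases "class_rate A \<Lambda>2") auto
  finally show "class_rate A \<Lambda> \<le> class_rate A \<Lambda>1 + class_rate A \<Lambda>2 + ennreal e" .
qed

lemma class_rate_scale_le:
  assumes A: "regular_class A" and l: "l > 0"
    and \<Lambda>: "\<And>f. continuous_on UNIV f \<Longrightarrow> bounded (range f) \<Longrightarrow> \<Lambda>' f = l * \<Lambda> f"
  shows "class_rate A \<Lambda>' \<le> ennreal l * class_rate A \<Lambda>"
proof (rule ennreal_le_epsilon)
  fix e :: real assume fin: "ennreal l * class_rate A \<Lambda> < top" and e: "0 < e"
  have fin': "class_rate A \<Lambda> < top" using fin l by (auto simp: ennreal_mult_less_top)
  define a where "a = enn2real (class_rate A \<Lambda>) + e / l"
  have a0: "a \<ge> 0" using e l by (simp add: a_def)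
  have less: "class_rate A \<Lambda> < ennreal a"
    using fin' e l by (cases "class_rate A \<Lambda>") (auto simp: a_def ennreal_less_iff)
  have "class_rate A \<Lambda>' \<le> ennreal (l * a)"
  proof (rule class_rate_le)
    fix F :: "('a \<Rightarrow> real) set" and \<epsilon> :: real assume F: "test_functions F" and \<epsilon>: "\<epsilon> > 0"
    obtain K where K: "compact K" "K \<subseteq> A"
      and ev: "\<forall>\<^sub>F t in at_top. exp (- a * t) \<le> max_prob K F (\<lambda>f. t * \<Lambda> f) (\<epsilon> / l * t)"
      using class_rate_lessD[OF A less F, of "\<epsilon> / l"] \<epsilon> l by auto
    have "filterlim (\<lambda>t :: real. l * t) at_top at_top"
      using l by (intro filterlim_tendsto_pos_mult_at_top[OF tendsto_const] filterlim_ident) auto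
    from eventually_compose_filterlim[OF ev this]
    have "\<forall>\<^sub>F t in at_top. exp (- (l * a) * t) \<le> max_prob K F (\<lambda>f. t * \<Lambda>' f) (\<epsilon> * t)"
    proof eventually_elim
      case (elim t)
      have "max_prob K F (\<lambda>f. t * \<Lambda>' f) (\<epsilon> * t) = max_prob K F (\<lambda>f. l * t * \<Lambda> f) (\<epsilon> * t)"
        using F \<Lambda> by (intro max_prob_cong) (auto simp: test_functions_def)
      then show ?case using elim l by (simp add: mult_ac)
    qed
    then show "\<exists>K. compact K \<and> K \<subseteq> A \<and>
        (\<forall>\<^sub>F t in at_top. exp (- (l * a) * t) \<le> max_prob K F (\<lambda>f. t * \<Lambda>' f) (\<epsilon> * t))"
      using K by blast
  qed (use a0 l in auto)
  also have "l * a = l * enn2real (class_rate A \<Lambda>) + e" using l by (simp add: a_def algebra_simps)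
  also have "ennreal \<dots> = ennreal l * class_rate A \<Lambda> + ennreal e"
    using fin' e l by (cases "class_rate A \<Lambda>") (auto simp: ennreal_mult)
  finally show "class_rate A \<Lambda>' \<le> ennreal l * class_rate A \<Lambda> + ennreal e" .
qed

lemma class_rate_scale:
  assumes A: "regular_class A" and l: "l > 0"
    and \<Lambda>: "\<And>f. continuous_on UNIV f \<Longrightarrow> bounded (range f) \<Longrightarrow> \<Lambda>' f = l * \<Lambda> f"
  shows "class_rate A \<Lambda>' = ennreal l * class_rate A \<Lambda>"
proof (rule antisym)
  show "class_rate A \<Lambda>' \<le> ennreal l * class_rate A \<Lambda>" by (rule class_rate_scale_le) fact+
  have "class_rate A \<Lambda> \<le> ennreal (1 / l) * class_rate A \<Lambda>'"
    using l \<Lambda> by (intro class_rate_scale_le[OF A]) auto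
  then have "ennreal l * class_rate A \<Lambda> \<le> ennreal l * (ennreal (1 / l) * class_rate A \<Lambda>')"
    by (rule mult_left_mono) simp
  also have "\<dots> = class_rate A \<Lambda>'"
    using l by (simp add: mult.assoc[symmetric] ennreal_mult[symmetric])
  finally show "ennreal l * class_rate A \<Lambda> \<le> class_rate A \<Lambda>'" .
qed

end

section \<open>Cutoffs and events of superexponentially small probability\<close>

lemma compact_cutoff:
  fixes K :: "'a::euclidean_space set"
  assumes K: "compact K" "K \<subseteq> U" and U: "open U"
  obtains \<phi> :: "'a \<Rightarrow> real" and L where "continuous_on UNIV \<phi>" "\<And>x. 0 \<le> \<phi> x" "\<And>x. \<phi> x \<le> 1"
    "\<And>x. x \<in> K \<Longrightarrow> \<phi> x = 1" "compact L" "L \<subseteq> U" "\<And>x. x \<notin> L \<Longrightarrow> \<phi> x = 0"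
proof (cases "K = {}")
  case True
  show thesis by (rule that[of "\<lambda>_. 0" "{}"]) (use True in auto)
next
  case False
  obtain e where e: "e > 0" "{x. infdist x K \<le> e} \<subseteq> U"
    using compact_in_open_separated[OF False K(1) U K(2)] by blast
  show thesis
  proof (rule that[of "\<lambda>x. max 0 (1 - infdist x K / e)" "{x. infdist x K \<le> e}"])
    show "continuous_on UNIV (\<lambda>x. max 0 (1 - infdist x K / e))"
      using e by (intro continuous_intros) auto
    show "max 0 (1 - infdist x K / e) \<le> 1" for x using e infdist_nonneg[of x K] by simp
    show "compact {x. infdist x K \<le> e}" by (rule compact_infdist_le[OF False K(1) e(1)])
    show "max 0 (1 - infdist x K / e) = 0" if "x \<notin> {x. infdist x K \<le> e}" for x
      using that e by (simp add: le_divide_eq)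
  qed (use e in auto)
qed

lemma bounded_range_unit:
  fixes \<phi> :: "'b \<Rightarrow> real"
  shows "(\<And>x. 0 \<le> \<phi> x) \<Longrightarrow> (\<And>x. \<phi> x \<le> 1) \<Longrightarrow> bounded (range \<phi>)"
  by (rule boundedI[of _ 1]) auto

lemma compact_inner_approx:
  fixes \<mu> :: "'a::euclidean_space measure"
  assumes \<mu>: "\<mu> \<in> prob_measures" and B: "B \<in> sets borel" and e: "e > 0"
  obtains K where "compact K" "K \<subseteq> B" "measure \<mu> K > measure \<mu> B - e"
proof -
  interpret \<mu>: prob_space \<mu> using \<mu> by (simp add: space_prob_algebra)
  have s: "sets \<mu> = sets borel" using \<mu> by (simp add: space_prob_algebra)
  show thesis
  proof (cases "measure \<mu> B = 0")
    case True
    then show thesis using e by (intro that[of "{}"]) auto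
  next
    case False
    then have pos: "emeasure \<mu> B > 0" by (simp add: \<mu>.emeasure_eq_measure zero_less_measure_iff)
    have "ennreal (measure \<mu> B - e) < emeasure \<mu> B"
      using pos e by (auto simp: \<mu>.emeasure_eq_measure ennreal_less_iff ennreal_lessI)
    also have "emeasure \<mu> B = (SUP K \<in> {K. K \<subseteq> B \<and> compact K}. emeasure \<mu> K)"
      by (rule inner_regular[OF s _ B]) (simp add: \<mu>.emeasure_eq_measure)
    finally obtain K where K: "K \<subseteq> B" "compact K" "ennreal (measure \<mu> B - e) < emeasure \<mu> K"
      by (auto simp: less_SUP_iff)
    then have "measure \<mu> B - e < measure \<mu> K"
      by (metis \<mu>.emeasure_eq_measure ennreal_leI not_le)
    then show thesis using K that by blast
  qed
qed

lemma openin_weak_topology_ball: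
  assumes "test_functions T"
  shows "openin weak_topology {\<nu> \<in> prob_measures. \<forall>g\<in>T. \<bar>(\<integral>x. g x \<partial>\<nu>) - (\<integral>x. g x \<partial>\<mu>)\<bar> < \<delta>}"
proof -
  have fin: "finite T" using assms by (simp add: test_functions_def)
  have "openin weak_topology (prob_measures \<inter> (\<Inter>g\<in>T. {\<nu> \<in> prob_measures. (\<integral>x. g x \<partial>\<nu>) \<in> ball (\<integral>x. g x \<partial>\<mu>) \<delta>}))"
  proof (cases "T = {}")
    case True
    then show ?thesis using openin_topspace[of weak_topology] by (simp add: topspace_weak_topology)
  next
    case False
    have "openin weak_topology (\<Inter>g\<in>T. {\<nu> \<in> prob_measures. (\<integral>x. g x \<partial>\<nu>) \<in> ball (\<integral>x. g x \<partial>\<mu>) \<delta>})"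
      using fin False assms
      by (intro openin_INT2 openin_weak_topology_integral) (auto simp: test_functions_def)
    then show ?thesis
      using openin_topspace[of weak_topology] by (intro openin_Int) (auto simp: topspace_weak_topology)
  qed
  also have "prob_measures \<inter> (\<Inter>g\<in>T. {\<nu> \<in> prob_measures. (\<integral>x. g x \<partial>\<nu>) \<in> ball (\<integral>x. g x \<partial>\<mu>) \<delta>}) =
      {\<nu> \<in> prob_measures. \<forall>g\<in>T. \<bar>(\<integral>x. g x \<partial>\<nu>) - (\<integral>x. g x \<partial>\<mu>)\<bar> < \<delta>}"
    by (auto simp: dist_real_def abs_minus_commute)
  finally show ?thesis .
qed

context class_chain
begin

lemma AE_visit:
  assumes A: "A \<in> classes" and n: "n \<ge> 1"
  shows "AE \<omega> in M. X n \<omega> \<in> A \<longrightarrow> leads_to \<rho> None (Some A)"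
proof (cases "leads_to \<rho> None (Some A)")
  case False
  have [measurable]: "A \<in> sets borel" "X n \<in> M \<rightarrow>\<^sub>M borel" using A n by auto
  have sp: "space M \<in> sets (past M X 0)" using sets.top[of "past M X 0"] by simp
  have z: "iter_density \<rho> n None y * indicator A y = 0" for y
    using False root_iff[OF A] n by (auto simp: reach_def indicator_def zero_less_iff_neq_zero)
  have "(\<integral>\<^sup>+\<omega>. indicator A (X n \<omega>) \<partial>M) = (\<integral>\<^sup>+\<omega>\<in>space M. indicator A (X (0 + n) \<omega>) \<partial>M)"
    by (intro nn_integral_cong) simp
  also have "\<dots> = (\<integral>\<^sup>+\<omega>\<in>space M. (\<integral>\<^sup>+y. iter_density \<rho> n (Y 0 \<omega>) y * indicator A y \<partial>lborel) \<partial>M)"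
    by (rule multi_step[OF sp n]) simp
  also have "\<dots> = 0" by (simp add: Y_def z)
  finally have "AE \<omega> in M. indicator A (X n \<omega>) = (0 :: ennreal)"
    by (subst (asm) nn_integral_0_iff_AE) simp_all
  then show ?thesis by eventually_elim (simp add: indicator_def split: if_splits)
qed simp

lemma AE_transition:
  assumes A: "A \<in> classes" and B: "B \<in> classes" and n: "n \<ge> 1" and k: "k \<ge> 1"
  shows "AE \<omega> in M. X n \<omega> \<in> A \<and> X (n + k) \<omega> \<in> B \<longrightarrow> leads_to \<rho> (Some A) (Some B)"
proof (cases "leads_to \<rho> (Some A) (Some B)")
  case False
  have [measurable]: "A \<in> sets borel" "B \<in> sets borel" "X n \<in> M \<rightarrow>\<^sub>M borel" "X (n + k) \<in> M \<rightarrow>\<^sub>M borel"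
    using A B n by auto
  have [measurable]: "X n \<in> past M X n \<rightarrow>\<^sub>M borel" using n by (intro measurable_X_past) auto
  have "X n -` A \<inter> space (past M X n) \<in> sets (past M X n)" by measurable
  then have past: "X n -` A \<inter> space M \<in> sets (past M X n)" by simp
  have z: "iter_density \<rho> k (Some x) y * indicator B y = 0" if "x \<in> A" for x y
    using False leads_to_classI[OF A B that] k by (auto simp: reach_def indicator_def zero_less_iff_neq_zero)
  have "(\<integral>\<^sup>+\<omega>\<in>X n -` A \<inter> space M. indicator B (X (n + k) \<omega>) \<partial>M) =
      (\<integral>\<^sup>+\<omega>\<in>X n -` A \<inter> space M. (\<integral>\<^sup>+y. iter_density \<rho> k (Y n \<omega>) y * indicator B y \<partial>lborel) \<partial>M)"
    by (rule multi_step[OF past k]) simp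
  also have "\<dots> = (\<integral>\<^sup>+\<omega>. 0 \<partial>M)"
  proof (rule nn_integral_cong)
    fix \<omega>
    show "(\<integral>\<^sup>+y. iter_density \<rho> k (Y n \<omega>) y * indicator B y \<partial>lborel) * indicator (X n -` A \<inter> space M) \<omega> = 0"
    proof (cases "X n \<omega> \<in> A")
      case True
      have "(\<integral>\<^sup>+y. iter_density \<rho> k (Y n \<omega>) y * indicator B y \<partial>lborel) = (\<integral>\<^sup>+(y :: 'a). 0 \<partial>lborel)"
        using n z[OF True] by (intro nn_integral_cong) (simp add: Y_def del: mult_eq_0_iff)
      then show ?thesis by simp
    qed simp
  qed
  finally have "(\<integral>\<^sup>+\<omega>\<in>X n -` A \<inter> space M. indicator B (X (n + k) \<omega>) \<partial>M) = 0" by simp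
  then have "AE \<omega> in M. indicator B (X (n + k) \<omega>) * indicator (X n -` A \<inter> space M) \<omega> = (0 :: ennreal)"
    by (subst (asm) nn_integral_0_iff_AE) simp_all
  then show ?thesis using AE_space
    by eventually_elim (auto simp: indicator_def split: if_splits)
qed simp

definition ordered :: "'w \<Rightarrow> bool"
  where "ordered \<omega> \<longleftrightarrow> (\<forall>A\<in>classes. \<forall>n\<ge>1. X n \<omega> \<in> A \<longrightarrow> leads_to \<rho> None (Some A)) \<and>
    (\<forall>A\<in>classes. \<forall>B\<in>classes. \<forall>m\<ge>1. \<forall>n\<ge>m. X m \<omega> \<in> A \<and> X n \<omega> \<in> B \<longrightarrow> leads_to \<rho> (Some A) (Some B))"

lemma AE_ordered: "AE \<omega> in M. ordered \<omega>"
proof -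
  have 1: "AE \<omega> in M. \<forall>A\<in>classes. \<forall>n\<ge>1. X n \<omega> \<in> A \<longrightarrow> leads_to \<rho> None (Some A)"
    using countable_classes AE_visit by (simp only: AE_ball_countable AE_all_countable) auto
  have 2: "AE \<omega> in M. \<forall>A\<in>classes. \<forall>B\<in>classes. \<forall>m. \<forall>k. m \<ge> 1 \<longrightarrow> k \<ge> 1 \<longrightarrow>
      X m \<omega> \<in> A \<and> X (m + k) \<omega> \<in> B \<longrightarrow> leads_to \<rho> (Some A) (Some B)"
    using countable_classes AE_transition by (simp only: AE_ball_countable AE_all_countable) auto
  show ?thesis
    using 1 2
  proof eventually_elim
    case (elim \<omega>)
    have "leads_to \<rho> (Some A) (Some B)"
      if "A \<in> classes" "B \<in> classes" "m \<ge> 1" "n \<ge> m" "X m \<omega> \<in> A" "X n \<omega> \<in> B" for A B m n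
    proof (cases "m = n")
      case True
      then show ?thesis using that class_disjoint[of A B] leads_to_refl by blast
    next
      case False
      then show ?thesis using elim(2)[rule_format, OF that(1,2,3), of "n - m"] that by auto
    qed
    then show ?case using elim(1) unfolding ordered_def by blast
  qed
qed

lemma prob_zero_if_not_ordered:
  assumes "\<And>\<omega>. ordered \<omega> \<Longrightarrow> \<omega> \<in> space M \<Longrightarrow> \<not> P \<omega>"
  shows "prob {\<omega> \<in> space M. P \<omega>} = 0"
proof -
  have "AE \<omega> in M. \<not> P \<omega>" using AE_ordered AE_space by eventually_elim (rule assms)
  from emeasure_eq_0_AE[OF this] show ?thesis by (simp add: measure_def)
qed

lemma class_cutoff:
  assumes \<mu>: "\<mu> \<in> prob_measures" and A: "A \<in> classes" and pos: "measure \<mu> A > 0"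
  obtains \<phi> :: "'a \<Rightarrow> real" where "continuous_on UNIV \<phi>" "bounded (range \<phi>)" "\<And>x. 0 \<le> \<phi> x" "\<And>x. x \<notin> A \<Longrightarrow> \<phi> x = 0" "(\<integral>x. \<phi> x \<partial>\<mu>) > 0"
proof -
  interpret \<mu>: prob_space \<mu> using \<mu> by (simp add: space_prob_algebra)
  have s [measurable_cong]: "sets \<mu> = sets borel" using \<mu> by (simp add: space_prob_algebra)
  obtain K where K: "compact K" "K \<subseteq> A" "measure \<mu> K > measure \<mu> A - measure \<mu> A"
    by (rule compact_inner_approx[OF \<mu> measurable_class[OF A] pos])
  obtain \<phi> L where \<phi>: "continuous_on UNIV \<phi>" "\<And>x. 0 \<le> \<phi> x" "\<And>x. \<phi> x \<le> 1"
    "\<And>x. x \<in> K \<Longrightarrow> \<phi> x = 1" "compact L" "L \<subseteq> A" "\<And>x. x \<notin> L \<Longrightarrow> \<phi> x = (0 :: real)"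
    using compact_cutoff[OF K(1,2) open_class[OF A]] by blast
  have [measurable]: "K \<in> sets borel" "\<phi> \<in> borel_measurable borel"
    using K \<phi> by (auto intro: borel_compact borel_measurable_continuous_onI)
  have "measure \<mu> K = (\<integral>x. indicator K x \<partial>\<mu>)" by (simp add: sets_eq_imp_space_eq[OF s])
  also have "\<dots> \<le> (\<integral>x. \<phi> x \<partial>\<mu>)"
    using \<phi> by (intro integral_mono \<mu>.integrable_const_bound[where B = 1]) (auto simp: indicator_def)
  finally have "(\<integral>x. \<phi> x \<partial>\<mu>) > 0" using K by simp
  moreover have "\<phi> x = 0" if "x \<notin> A" for x using that \<phi>(6,7) by blast
  ultimately show thesis using \<phi>(1,2,3) by (intro that[of \<phi>] bounded_range_unit) auto
qed

lemma empirical_positive_visits: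
  assumes "continuous_on UNIV \<phi>" and "\<And>x. x \<notin> A \<Longrightarrow> \<phi> x = (0::real)"
    and "(\<integral>x. \<phi> x \<partial>empirical X n \<omega>) > 0"
  shows "\<exists>i\<in>{1..n}. X i \<omega> \<in> A"
proof (rule ccontr)
  assume "\<not> ?thesis"
  then have "(\<Sum>i=1..n. \<phi> (X i \<omega>)) = 0" using assms(2) by (intro sum.neutral) auto
  then show False using assms by (simp add: integral_empirical borel_measurable_continuous_onI)
qed

lemma unreachable_zero:
  assumes \<mu>: "\<mu> \<in> prob_measures" and A: "A \<in> classes" "\<not> leads_to \<rho> None (Some A)" and pos: "measure \<mu> A > 0"
  shows "\<exists>V. openin weak_topology V \<and> \<mu> \<in> V \<and> (\<forall>n. prob {\<omega> \<in> space M. empirical X n \<omega> \<in> V} = 0)"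
proof -
  obtain \<phi> :: "'a \<Rightarrow> real" where \<phi>: "continuous_on UNIV \<phi>" "bounded (range \<phi>)" "\<And>x. x \<notin> A \<Longrightarrow> \<phi> x = 0" "(\<integral>x. \<phi> x \<partial>\<mu>) > 0"
    by (rule class_cutoff[OF \<mu> A(1) pos]) blast
  let ?V = "{\<nu> \<in> prob_measures. (\<integral>x. \<phi> x \<partial>\<nu>) \<in> {0<..}}"
  have "prob {\<omega> \<in> space M. empirical X n \<omega> \<in> ?V} = 0" for n
  proof (rule prob_zero_if_not_ordered)
    fix \<omega> assume o: "ordered \<omega>"
    show "empirical X n \<omega> \<notin> ?V"
    proof
      assume V: "empirical X n \<omega> \<in> ?V"
      have "\<exists>i\<in>{1..n}. X i \<omega> \<in> A"
        by (rule empirical_positive_visits[OF \<phi>(1)]) (use \<phi>(3) V in auto)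
      then obtain i where "i \<in> {1..n}" "X i \<omega> \<in> A" by blast
      then show False using o A unfolding ordered_def by (auto simp del: leads_to.simps)
    qed
  qed
  moreover have "openin weak_topology ?V" by (rule openin_weak_topology_integral[OF \<phi>(1,2)]) simp
  moreover have "\<mu> \<in> ?V" using \<mu> \<phi> by simp
  ultimately show ?thesis by blast
qed

lemma incomparable_zero:
  assumes \<mu>: "\<mu> \<in> prob_measures" and A: "A \<in> classes" "measure \<mu> A > 0" and B: "B \<in> classes" "measure \<mu> B > 0"
    and AB: "\<not> leads_to \<rho> (Some A) (Some B)" "\<not> leads_to \<rho> (Some B) (Some A)"
  shows "\<exists>V. openin weak_topology V \<and> \<mu> \<in> V \<and> (\<forall>n. prob {\<omega> \<in> space M. empirical X n \<omega> \<in> V} = 0)"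
proof -
  obtain \<phi> :: "'a \<Rightarrow> real" where \<phi>: "continuous_on UNIV \<phi>" "bounded (range \<phi>)" "\<And>x. x \<notin> A \<Longrightarrow> \<phi> x = 0" "(\<integral>x. \<phi> x \<partial>\<mu>) > 0"
    by (rule class_cutoff[OF \<mu> A]) blast
  obtain \<psi> :: "'a \<Rightarrow> real" where \<psi>: "continuous_on UNIV \<psi>" "bounded (range \<psi>)" "\<And>x. x \<notin> B \<Longrightarrow> \<psi> x = 0" "(\<integral>x. \<psi> x \<partial>\<mu>) > 0"
    by (rule class_cutoff[OF \<mu> B]) blast
  let ?V = "{\<nu> \<in> prob_measures. (\<integral>x. \<phi> x \<partial>\<nu>) \<in> {0<..}} \<inter> {\<nu> \<in> prob_measures. (\<integral>x. \<psi> x \<partial>\<nu>) \<in> {0<..}}"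
  have "prob {\<omega> \<in> space M. empirical X n \<omega> \<in> ?V} = 0" for n
  proof (rule prob_zero_if_not_ordered)
    fix \<omega> assume o: "ordered \<omega>"
    show "empirical X n \<omega> \<notin> ?V"
    proof
      assume V: "empirical X n \<omega> \<in> ?V"
      have "\<exists>i\<in>{1..n}. X i \<omega> \<in> A"
        by (rule empirical_positive_visits[OF \<phi>(1)]) (use \<phi>(3) V in auto)
      then obtain i where i: "i \<in> {1..n}" "X i \<omega> \<in> A" by blast
      have "\<exists>j\<in>{1..n}. X j \<omega> \<in> B"
        by (rule empirical_positive_visits[OF \<psi>(1)]) (use \<psi>(3) V in auto)
      then obtain j where j: "j \<in> {1..n}" "X j \<omega> \<in> B" by blast
      have *: "\<And>A B m n. A \<in> classes \<Longrightarrow> B \<in> classes \<Longrightarrow> 1 \<le> m \<Longrightarrow> m \<le> n \<Longrightarrow> X m \<omega> \<in> A \<Longrightarrow> X n \<omega> \<in> B \<Longrightarrow>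
          leads_to \<rho> (Some A) (Some B)"
        using o unfolding ordered_def by blast
      show False
      proof (cases "i \<le> j")
        case True
        then show False using *[OF A(1) B(1) _ True i(2) j(2)] AB(1) i(1) by (simp del: leads_to.simps)
      next
        case False
        then show False using *[OF B(1) A(1) _ _ j(2) i(2)] AB(2) j(1) by (simp del: leads_to.simps)
      qed
    qed
  qed
  moreover have "openin weak_topology ?V"
    using \<phi> \<psi> by (intro openin_Int openin_weak_topology_integral) auto
  moreover have "\<mu> \<in> ?V" using \<mu> \<phi> \<psi> by simp
  ultimately show ?thesis by blast
qed

lemma visits_product:
  assumes A: "regular_class A" and K: "compact K" "K \<subseteq> A"
  obtains c N where "(c :: real) \<ge> 1"
    "\<And>G T. G \<in> sets borel \<Longrightarrow> G \<subseteq> K \<Longrightarrow> finite T \<Longrightarrow> T \<subseteq> {1..} \<Longrightarrow>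
      prob {\<omega> \<in> space M. \<forall>t\<in>T. X t \<omega> \<in> G} \<le> (c * (\<Sum>s=1..N. prob (X s -` G \<inter> space M))) ^ card T"
proof -
  have A': "A \<in> classes" "leads_to \<rho> None (Some A)" using A by (auto simp: regular_class_def)
  have cd: "chain_data {A} (\<lambda>_. K)"
    using A' K leads_to_refl[OF A'(1)] by (auto simp: chain_data_def comparable_def simp del: leads_to.simps)
  obtain c N where dec: "decoupled {A} (\<lambda>_. K) c N" using ex_decoupled[OF cd] by blast
  note c1 = decoupled_ge_1[OF dec]
  show thesis
  proof (rule that[OF c1, of N])
    fix G and T :: "nat set"
    assume G [measurable]: "G \<in> sets borel" and GK: "G \<subseteq> K" and T: "finite T" "T \<subseteq> {1..}"
    let ?\<eta> = "c * (\<Sum>s=1..N. prob (X s -` G \<inter> space M))"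
    have bl: "block G {} (\<lambda>_. 0) 0 s 0 = X s -` G \<inter> space M" for s
      by (auto simp: block_iff)
    have tf: "test_functions ({} :: ('a \<Rightarrow> real) set)" by (simp add: test_functions_def)
    have \<eta>0: "?\<eta> \<ge> 0" using c1 by (simp add: sum_nonneg)
    show "prob {\<omega> \<in> space M. \<forall>t\<in>T. X t \<omega> \<in> G} \<le> ?\<eta> ^ card T"
      using T
    proof (induction T rule: finite_linorder_max_induct)
      case empty
      then show ?case by (simp add: prob_space)
    next
      case (insert b T)
      let ?A1 = "{\<omega> \<in> space M. \<forall>t\<in>T. X t \<omega> \<in> G}"
      define n where "n = (if T = {} then 0 else Max T)"
      have nb: "n < b" using insert by (auto simp: n_def)
      have Tn: "t \<le> n" "1 \<le> t" if "t \<in> T" for t using that insert by (auto simp: n_def)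
      have A1: "?A1 \<in> sets (past M X n)"
      proof -
        have "{\<omega> \<in> space (past M X n). \<forall>t\<in>T. X t \<omega> \<in> G} \<in> sets (past M X n)"
        proof (rule sets.sets_Collect_finite_All)
          fix t assume "t \<in> T"
          then have [measurable]: "X t \<in> past M X n \<rightarrow>\<^sub>M borel" using Tn by (intro measurable_X_past) auto
          show "{\<omega> \<in> space (past M X n). X t \<omega> \<in> G} \<in> sets (past M X n)" by measurable
        qed (use insert in auto)
        then show ?thesis by simp
      qed
      have h: "Y n \<omega> \<in> heads {A} (\<lambda>_. K) A" if "\<omega> \<in> ?A1" for \<omega>
      proof (cases "T = {}")
        case True
        then show ?thesis by (simp add: n_def Y_def heads_def)
      next
        case False
        then have "n \<in> T" using insert by (simp add: n_def)
        then have "X n \<omega> \<in> G" "n \<ge> 1" using that Tn by auto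
        then show ?thesis using GK leads_to_refl[OF A'(1)] by (auto simp: Y_def heads_def simp del: leads_to.simps)
      qed
      have "{\<omega> \<in> space M. \<forall>t\<in>insert b T. X t \<omega> \<in> G} = ?A1 \<inter> block G {} (\<lambda>_. 0) 0 (n + (b - n)) 0"
        using nb by (auto simp: bl)
      also have "prob \<dots> \<le> c * prob ?A1 * (\<Sum>s=1..N. prob (block G {} (\<lambda>_. 0) 0 s 0))"
      proof (rule decoupled_upper[OF dec])
        show "Y n \<omega> \<in> heads {A} (\<lambda>_. K) A" if "\<omega> \<in> ?A1" for \<omega> by (rule h[OF that])
      qed (use nb GK tf A1 G in auto)
      also have "\<dots> = ?\<eta> * prob ?A1" by (simp add: bl)
      also have "\<dots> \<le> ?\<eta> * ?\<eta> ^ card T"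
        using insert \<eta>0 by (intro mult_left_mono) auto
      also have "\<dots> = ?\<eta> ^ card (insert b T)" using insert by (subst card_insert_disjoint) auto
      finally show ?case .
    qed
  qed
qed

lemma prob_X_null:
  assumes [measurable]: "N \<in> sets borel" and N: "emeasure lborel N = 0" and s: "s \<ge> 1"
  shows "prob (X s -` N \<inter> space M) = 0"
proof -
  have [measurable]: "X s \<in> M \<rightarrow>\<^sub>M borel" using s by simp
  have sp: "space M \<in> sets (past M X 0)" using sets.top[of "past M X 0"] by simp
  have "AE y in lborel. y \<notin> N" using N by (intro AE_not_in) (auto simp: null_sets_def)
  then have z: "(\<integral>\<^sup>+y. iter_density \<rho> s x y * indicator N y \<partial>lborel) = 0" for x
    by (subst nn_integral_0_iff_AE) (auto simp: indicator_def elim: eventually_mono)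
  have "emeasure M (X s -` N \<inter> space M) = (\<integral>\<^sup>+\<omega>. indicator (X s -` N \<inter> space M) \<omega> \<partial>M)" by simp
  also have "\<dots> = (\<integral>\<^sup>+\<omega>\<in>space M. indicator N (X (0 + s) \<omega>) \<partial>M)"
    by (intro nn_integral_cong) (auto simp: indicator_def)
  also have "\<dots> = (\<integral>\<^sup>+\<omega>\<in>space M. (\<integral>\<^sup>+y. iter_density \<rho> s (Y 0 \<omega>) y * indicator N y \<partial>lborel) \<partial>M)"
    by (rule multi_step[OF sp s]) simp
  also have "\<dots> = 0" by (simp add: z)
  finally show ?thesis by (simp add: measure_def)
qed

lemma visits_small:
  assumes K: "compact K" and null: "emeasure lborel K = 0" and W: "open W" "K \<subseteq> W" and e: "(e :: real) > 0"
  shows "\<exists>U. open U \<and> K \<subseteq> U \<and> U \<subseteq> W \<and> (\<forall>s\<in>{1..N}. prob (X s -` U \<inter> space M) \<le> e)"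
proof -
  have [measurable]: "K \<in> sets borel" using K by (rule borel_compact)
  have "\<exists>U. open U \<and> K \<subseteq> U \<and> prob (X s -` U \<inter> space M) \<le> e" if s: "s \<in> {1..N}" for s
  proof -
    have [measurable]: "X s \<in> M \<rightarrow>\<^sub>M borel" using s by auto
    define \<nu> where "\<nu> = distr M borel (X s)"
    interpret \<nu>: prob_space \<nu> unfolding \<nu>_def by (rule prob_space_distr) simp
    have "emeasure \<nu> K = 0"
      using prob_X_null[OF _ null, of s] s by (simp add: \<nu>_def emeasure_distr emeasure_eq_measure)
    also have "emeasure \<nu> K = (INF U \<in> {U. K \<subseteq> U \<and> open U}. emeasure \<nu> U)"
      by (rule outer_regular) (simp_all add: \<nu>_def \<nu>.emeasure_eq_measure[unfolded \<nu>_def])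
    finally have "(INF U \<in> {U. K \<subseteq> U \<and> open U}. emeasure \<nu> U) < ennreal e" using e by simp
    then obtain U where U: "K \<subseteq> U" "open U" "emeasure \<nu> U < ennreal e" by (auto simp: INF_less_iff)
    then have "prob (X s -` U \<inter> space M) \<le> e"
      using e by (simp add: \<nu>_def emeasure_distr emeasure_eq_measure ennreal_less_iff)
    then show ?thesis using U by blast
  qed
  then have "\<forall>s\<in>{1..N}. \<exists>U. open U \<and> K \<subseteq> U \<and> prob (X s -` U \<inter> space M) \<le> e" by blast
  then obtain U where U: "\<forall>s\<in>{1..N}. open (U s) \<and> K \<subseteq> U s \<and> prob (X s -` U s \<inter> space M) \<le> e"
    by (rule bchoice[THEN exE])
  let ?U = "W \<inter> (\<Inter>s\<in>{1..N}. U s)"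
  have oU: "open ?U" using U W by (intro open_Int open_INT) auto
  moreover have "prob (X s -` ?U \<inter> space M) \<le> e" if s: "s \<in> {1..N}" for s
  proof -
    have [measurable]: "X s \<in> M \<rightarrow>\<^sub>M borel" "U s \<in> sets borel" using s U by auto
    have "prob (X s -` ?U \<inter> space M) \<le> prob (X s -` U s \<inter> space M)"
      using s by (intro finite_measure_mono) auto
    then show ?thesis using U s by force
  qed
  moreover have "K \<subseteq> ?U" using W U by blast
  ultimately show ?thesis by blast
qed

lemma singular_superexponential:
  assumes \<mu>: "\<mu> \<in> prob_measures" and A: "regular_class A" and N: "N \<in> sets borel" "emeasure lborel N = 0"
    and pos: "measure \<mu> (N \<inter> A) > 0" and a: "(a :: real) \<ge> 0"
  shows "\<exists>V. openin weak_topology V \<and> \<mu> \<in> V \<and>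
    (\<forall>\<^sub>F n in sequentially. prob {\<omega> \<in> space M. empirical X n \<omega> \<in> V} \<le> exp (- a * n))"
proof -
  interpret \<mu>: prob_space \<mu> using \<mu> by (simp add: space_prob_algebra)
  have s [measurable_cong]: "sets \<mu> = sets borel" using \<mu> by (simp add: space_prob_algebra)
  have Ac: "A \<in> classes" using A by (simp add: regular_class_def)
  have [measurable]: "N \<inter> A \<in> sets borel" using N Ac by auto
  obtain K where K: "compact K" "K \<subseteq> N \<inter> A" "measure \<mu> K > measure \<mu> (N \<inter> A) - measure \<mu> (N \<inter> A)"
    by (rule compact_inner_approx[OF \<mu> \<open>N \<inter> A \<in> sets borel\<close> pos])
  have [measurable]: "K \<in> sets borel" using K by (simp add: borel_compact)
  have K0: "measure \<mu> K > 0" using K by simp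
  have Knull: "emeasure lborel K = 0"
  proof -
    have "emeasure lborel K \<le> emeasure lborel N" using K N by (intro emeasure_mono) auto
    then show ?thesis using N by simp
  qed
  obtain \<phi> L where \<phi>: "continuous_on UNIV \<phi>" "\<And>x. x \<in> K \<Longrightarrow> \<phi> x = (1 :: real)" "compact L" "L \<subseteq> A" "\<And>x. x \<notin> L \<Longrightarrow> \<phi> x = 0"
    using compact_cutoff[OF K(1) _ open_class[OF Ac]] K(2) by (metis le_inf_iff)
  obtain c M' where c1: "(c :: real) \<ge> 1" and prod: "\<And>G T. G \<in> sets borel \<Longrightarrow> G \<subseteq> L \<Longrightarrow> finite T \<Longrightarrow> T \<subseteq> {1..} \<Longrightarrow>
      prob {\<omega> \<in> space M. \<forall>t\<in>T. X t \<omega> \<in> G} \<le> (c * (\<Sum>s=1..M'. prob (X s -` G \<inter> space M))) ^ card T"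
    by (rule visits_product[OF A \<phi>(3,4)]) blast
  define \<epsilon> where "\<epsilon> = measure \<mu> K / 2"
  define \<eta> where "\<eta> = exp (- (a + ln 2) / \<epsilon>)"
  have \<epsilon>: "\<epsilon> > 0" using K0 by (simp add: \<epsilon>_def)
  have "0 \<le> a + ln 2" using a ln_ge_zero[of 2] by linarith
  then have "- (a + ln 2) / \<epsilon> \<le> 0" using \<epsilon> by (intro divide_nonpos_pos) auto
  then have \<eta>: "0 < \<eta>" "\<eta> \<le> 1" by (simp_all only: \<eta>_def exp_gt_zero exp_le_one_iff)
  have oO: "open {x. \<phi> x > 0}" using \<phi>(1) by (intro open_Collect_less) auto
  have KO: "K \<subseteq> {x. \<phi> x > 0}" using \<phi>(2) by auto
  have e: "\<eta> / (c * (real M' + 1)) > 0" using \<eta> c1 by (intro divide_pos_pos mult_pos_pos) auto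
  obtain U where U: "open U" "K \<subseteq> U" "U \<subseteq> {x. \<phi> x > 0}"
    "\<forall>s\<in>{1..M'}. prob (X s -` U \<inter> space M) \<le> \<eta> / (c * (real M' + 1))"
    using visits_small[OF K(1) Knull oO KO e] by blast
  obtain \<psi> G where \<psi>: "continuous_on UNIV \<psi>" "\<And>x. 0 \<le> \<psi> x" "\<And>x. \<psi> x \<le> 1"
    "\<And>x. x \<in> K \<Longrightarrow> \<psi> x = 1" "compact G" "G \<subseteq> U" "\<And>x. x \<notin> G \<Longrightarrow> \<psi> x = (0 :: real)"
    using compact_cutoff[OF K(1) U(2,1)] by blast
  have [measurable]: "G \<in> sets borel" "\<psi> \<in> borel_measurable borel" "U \<in> sets borel"
    using \<psi> U by (auto intro: borel_compact borel_measurable_continuous_onI)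
  have GL: "G \<subseteq> L" using \<psi>(6) U(3) \<phi>(5) by force
  have "c * (\<Sum>s=1..M'. prob (X s -` G \<inter> space M)) \<le> \<eta>"
  proof -
    have "(\<Sum>s=1..M'. prob (X s -` G \<inter> space M)) \<le> (\<Sum>s=1..M'. \<eta> / (c * (real M' + 1)))"
    proof (rule sum_mono)
      fix s assume s: "s \<in> {1..M'}"
      then have [measurable]: "X s \<in> M \<rightarrow>\<^sub>M borel" by auto
      have "prob (X s -` G \<inter> space M) \<le> prob (X s -` U \<inter> space M)"
        using \<psi>(6) by (intro finite_measure_mono) auto
      then show "prob (X s -` G \<inter> space M) \<le> \<eta> / (c * (real M' + 1))" using U(4) s by force
    qed
    also have "\<dots> = M' * (\<eta> / (c * (real M' + 1)))" by simp
    finally have "c * (\<Sum>s=1..M'. prob (X s -` G \<inter> space M)) \<le> c * (M' * (\<eta> / (c * (real M' + 1))))"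
      using c1 by (intro mult_left_mono) auto
    also have "\<dots> = \<eta> * (M' / (real M' + 1))" using c1 by simp
    also have "\<dots> \<le> \<eta> * 1" using \<eta> by (intro mult_left_mono) auto
    finally show ?thesis by simp
  qed
  then have prod': "prob {\<omega> \<in> space M. \<forall>t\<in>T. X t \<omega> \<in> G} \<le> \<eta> ^ card T" if "finite T" "T \<subseteq> {1..}" for T
    using prod[OF _ GL that] c1
    by (meson \<open>G \<in> sets borel\<close> order_trans power_mono mult_nonneg_nonneg sum_nonneg measure_nonneg zero_le_one)
  let ?V = "{\<nu> \<in> prob_measures. (\<integral>x. \<psi> x \<partial>\<nu>) \<in> {\<epsilon><..}}"
  have "openin weak_topology ?V"
    using \<psi> by (intro openin_weak_topology_integral bounded_range_unit) auto
  moreover have "\<mu> \<in> ?V"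
  proof -
    have "measure \<mu> K = (\<integral>x. indicator K x \<partial>\<mu>)" by (simp add: sets_eq_imp_space_eq[OF s])
    also have "\<dots> \<le> (\<integral>x. \<psi> x \<partial>\<mu>)"
      using \<psi> by (intro integral_mono \<mu>.integrable_const_bound[where B = 1]) (auto simp: indicator_def)
    finally show ?thesis using \<mu> K0 by (simp add: \<epsilon>_def)
  qed
  moreover have "prob {\<omega> \<in> space M. empirical X n \<omega> \<in> ?V} \<le> exp (- a * n)" if n: "n \<ge> 1" for n
  proof -
    let ?TT = "{T. T \<subseteq> {1..n} \<and> \<epsilon> * n \<le> card T}"
    have fin: "finite ?TT" by simp
    have ev: "{\<omega> \<in> space M. \<forall>t\<in>T. X t \<omega> \<in> G} \<in> sets M" if "T \<in> ?TT" for T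
    proof (rule sets.sets_Collect_finite_All)
      fix t assume "t \<in> T"
      then have [measurable]: "X t \<in> M \<rightarrow>\<^sub>M borel" using that by auto
      show "{\<omega> \<in> space M. X t \<omega> \<in> G} \<in> sets M" by measurable
    qed (use that finite_subset in auto)
    have "{\<omega> \<in> space M. empirical X n \<omega> \<in> ?V} \<subseteq> (\<Union>T\<in>?TT. {\<omega> \<in> space M. \<forall>t\<in>T. X t \<omega> \<in> G})"
    proof
      fix \<omega> assume \<omega>: "\<omega> \<in> {\<omega> \<in> space M. empirical X n \<omega> \<in> ?V}"
      let ?T = "{t \<in> {1..n}. X t \<omega> \<in> G}"
      have "\<epsilon> < (\<Sum>i=1..n. \<psi> (X i \<omega>)) / n" using \<omega> by (simp add: integral_empirical)
      then have "\<epsilon> * n < (\<Sum>i=1..n. \<psi> (X i \<omega>))" using n by (simp add: pos_less_divide_eq)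
      also have "\<dots> \<le> (\<Sum>i=1..n. if X i \<omega> \<in> G then 1 else 0)"
        using \<psi> by (intro sum_mono) auto
      also have "\<dots> = card ?T" by (simp add: sum.If_cases Int_def)
      finally have "?T \<in> ?TT" by auto
      then show "\<omega> \<in> (\<Union>T\<in>?TT. {\<omega> \<in> space M. \<forall>t\<in>T. X t \<omega> \<in> G})" using \<omega> by blast
    qed
    then have "prob {\<omega> \<in> space M. empirical X n \<omega> \<in> ?V} \<le> prob (\<Union>T\<in>?TT. {\<omega> \<in> space M. \<forall>t\<in>T. X t \<omega> \<in> G})"
      using ev fin by (intro finite_measure_mono sets.finite_UN) auto
    also have "\<dots> \<le> (\<Sum>T\<in>?TT. prob {\<omega> \<in> space M. \<forall>t\<in>T. X t \<omega> \<in> G})"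
      using ev fin by (intro finite_measure_subadditive_finite) auto
    also have "\<dots> \<le> (\<Sum>T\<in>?TT. \<eta> powr (\<epsilon> * n))"
    proof (rule sum_mono)
      fix T assume T: "T \<in> ?TT"
      then have "T \<subseteq> {1..}" "finite T" using finite_subset by auto
      then have "prob {\<omega> \<in> space M. \<forall>t\<in>T. X t \<omega> \<in> G} \<le> \<eta> ^ card T" using prod' by blast
      also have "\<dots> = \<eta> powr card T" using \<eta> by (simp add: powr_realpow)
      also have "\<dots> \<le> \<eta> powr (\<epsilon> * n)" using T \<eta> by (intro powr_mono') auto
      finally show "prob {\<omega> \<in> space M. \<forall>t\<in>T. X t \<omega> \<in> G} \<le> \<eta> powr (\<epsilon> * n)" .
    qed
    also have "\<dots> \<le> 2 ^ n * \<eta> powr (\<epsilon> * n)"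
    proof -
      have "card ?TT \<le> card (Pow {1..n})" by (intro card_mono) auto
      also have "\<dots> = 2 ^ n" by (simp add: card_Pow)
      finally have "real (card ?TT) \<le> 2 ^ n" by (metis of_nat_le_iff of_nat_numeral of_nat_power)
      then show ?thesis by (simp add: mult_right_mono)
    qed
    also have "\<dots> = exp (- a * n)"
    proof -
      have "\<eta> powr (\<epsilon> * n) = exp (- (a + ln 2) * n)"
        using \<epsilon> by (simp add: powr_def \<eta>_def)
      moreover have "(2 :: real) ^ n = exp (ln 2 * n)" by (simp add: exp_of_nat2_mult)
      ultimately show ?thesis by (simp add: exp_add[symmetric] algebra_simps)
    qed
    finally show ?thesis .
  qed
  ultimately show ?thesis
    by (intro exI[of _ ?V] conjI) (auto intro!: eventually_sequentiallyI[of 1])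
qed

end

section \<open>Local bounds for chains of classes\<close>

lemma ennreal_sum_split:
  fixes c :: "'b \<Rightarrow> ennreal"
  assumes fin: "finite S" and less: "ennreal a < (\<Sum>A\<in>S. c A)" and a: "a \<ge> 0"
  shows "\<exists>b S'. S' \<subseteq> S \<and> (\<forall>A\<in>S'. 0 \<le> b A \<and> ennreal (b A) < c A) \<and> a < (\<Sum>A\<in>S'. b A)"
proof (cases "\<exists>A\<in>S. c A = \<top>")
  case True
  then obtain A where "A \<in> S" "c A = \<top>" by blast
  then show ?thesis using a by (intro exI[of _ "\<lambda>_. a + 1"] exI[of _ "{A}"]) auto
next
  case False
  define r where "r A = enn2real (c A)" for A
  have cr: "c A = ennreal (r A)" "0 \<le> r A" if "A \<in> S" for A
    using False that by (auto simp: r_def less_top)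
  define S' where "S' = {A \<in> S. r A > 0}"
  define R where "R = (\<Sum>A\<in>S'. r A)"
  have "(\<Sum>A\<in>S. c A) = ennreal (\<Sum>A\<in>S. r A)" using cr by (simp add: sum_ennreal)
  also have "(\<Sum>A\<in>S. r A) = R"
    unfolding R_def S'_def using fin cr(2) by (intro sum.mono_neutral_right) (auto simp: not_less antisym)
  finally have "a < R" using less a by (simp add: ennreal_less_iff)
  define \<theta> where "\<theta> = (a / R + 1) / 2"
  have R: "R > 0" using \<open>a < R\<close> a by simp
  have \<theta>: "0 \<le> \<theta>" "\<theta> < 1" using \<open>a < R\<close> a R by (auto simp: \<theta>_def)
  have "\<forall>A\<in>S'. 0 \<le> \<theta> * r A \<and> ennreal (\<theta> * r A) < c A"
    using \<theta> cr by (auto simp: S'_def ennreal_less_iff)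
  moreover have "a < (\<Sum>A\<in>S'. \<theta> * r A)"
  proof -
    have "(\<Sum>A\<in>S'. \<theta> * r A) = \<theta> * R" by (simp add: R_def sum_distrib_left)
    also have "\<dots> = (a + R) / 2" using R by (simp add: \<theta>_def field_simps)
    finally show ?thesis using \<open>a < R\<close> by simp
  qed
  ultimately show ?thesis by (intro exI[of _ "\<lambda>A. \<theta> * r A"] exI[of _ S']) (auto simp: S'_def)
qed

context class_chain
begin

definition part :: "'a measure \<Rightarrow> 'a set \<Rightarrow> ('a \<Rightarrow> real) \<Rightarrow> real"
  where "part \<mu> A f = (\<integral>x. indicator A x * f x \<partial>\<mu>)"

definition charged :: "'a measure \<Rightarrow> 'a set set"
  where "charged \<mu> = {A \<in> classes. measure \<mu> A > 0}"

lemma comparable_maximum: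
  assumes "finite S" "S \<noteq> {}" "S \<subseteq> classes" "comparable S"
  shows "\<exists>m\<in>S. \<forall>A\<in>S. leads_to \<rho> (Some A) (Some m)"
  using assms
proof (induction S rule: finite_ne_induct)
  case (singleton x)
  then show ?case using leads_to_refl by (auto simp del: leads_to.simps)
next
  case (insert x S)
  then have "comparable S" "S \<subseteq> classes" by (auto simp: comparable_def simp del: leads_to.simps)
  with insert.IH obtain m where m: "m \<in> S" "\<forall>A\<in>S. leads_to \<rho> (Some A) (Some m)" by blast
  have cl: "x \<in> classes" "m \<in> classes" using insert.prems m by auto
  show ?case
  proof (cases "leads_to \<rho> (Some x) (Some m)")
    case True
    then show ?thesis using m by blast
  next
    case False
    then have "leads_to \<rho> (Some m) (Some x)" using insert.prems m(1) unfolding comparable_def by blast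
    then have "leads_to \<rho> (Some A) (Some x)" if "A \<in> S" for A
      using leads_to_trans[of A m x] m that cl \<open>S \<subseteq> classes\<close> by blast
    then show ?thesis using leads_to_refl[OF cl(1)] by (intro bexI[of _ x]) (auto simp del: leads_to.simps)
  qed
qed

lemma class_list:
  assumes "finite S" "S \<subseteq> classes" "comparable S"
  shows "\<exists>As. distinct As \<and> set As = S \<and> sorted_wrt (\<lambda>A B. leads_to \<rho> (Some B) (Some A)) As"
  using assms
proof (induction S rule: finite_psubset_induct)
  case (psubset S)
  show ?case
  proof (cases "S = {}")
    case False
    obtain m where m: "m \<in> S" "\<forall>A\<in>S. leads_to \<rho> (Some A) (Some m)"
      using comparable_maximum[OF psubset.hyps False psubset.prems] by blast
    have "S - {m} \<subset> S" "S - {m} \<subseteq> classes" "comparable (S - {m})"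
      using m psubset.prems by (auto simp: comparable_def simp del: leads_to.simps)
    from psubset.IH[OF this] obtain As where
      "distinct As" "set As = S - {m}" "sorted_wrt (\<lambda>A B. leads_to \<rho> (Some B) (Some A)) As" by blast
    then show ?thesis using m by (intro exI[of _ "m # As"]) (auto simp del: leads_to.simps)
  qed (auto intro: exI[of _ "[]"])
qed

lemma charged_exhaustion:
  assumes \<mu>: "\<mu> \<in> prob_measures" and one: "measure \<mu> (\<Union>classes) = 1" and \<delta>: "\<delta> > 0"
    and S1: "finite S1" "S1 \<subseteq> charged \<mu>"
  shows "\<exists>S. finite S \<and> S1 \<subseteq> S \<and> S \<subseteq> charged \<mu> \<and> (\<Sum>A\<in>S. measure \<mu> A) > 1 - \<delta>"
proof -
  interpret \<mu>: prob_space \<mu> using \<mu> by (simp add: space_prob_algebra)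
  have s: "sets \<mu> = sets borel" using \<mu> by (simp add: space_prob_algebra)
  have ne: "classes \<noteq> {}" using one by auto
  define c where "c = from_nat_into classes"
  have rc: "range c = classes" unfolding c_def by (rule range_from_nat_into[OF ne countable_classes])
  have cl: "c i \<in> classes" for i using rc by auto
  have "(\<lambda>n. measure \<mu> (\<Union>i<n. c i)) \<longlonglongrightarrow> measure \<mu> (\<Union>n. \<Union>i<n. c i)"
    using cl s by (intro \<mu>.finite_Lim_measure_incseq) (auto intro!: incseq_SucI sets.finite_UN simp: open_class less_Suc_eq)
  also have "(\<Union>n. \<Union>i<n. c i) = \<Union>classes" unfolding rc[symmetric] by auto
  finally have "\<forall>\<^sub>F n in sequentially. measure \<mu> (\<Union>i<n. c i) > 1 - \<delta>"
    using \<delta> by (intro order_tendstoD) (auto simp: one)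
  then obtain n where n: "measure \<mu> (\<Union>i<n. c i) > 1 - \<delta>" by (auto simp: eventually_sequentially)
  define S0 where "S0 = c ` {..<n}"
  define S where "S = S1 \<union> {A \<in> S0. measure \<mu> A > 0}"
  have S0: "finite S0" "S0 \<subseteq> classes" using cl by (auto simp: S0_def)
  have fS: "finite S" "S \<subseteq> charged \<mu>" using S0 S1 by (auto simp: S_def charged_def)
  have "measure \<mu> (\<Union>i<n. c i) = measure \<mu> (\<Union>A\<in>S0. A)" by (simp add: S0_def)
  also have "\<dots> \<le> (\<Sum>A\<in>S0. measure \<mu> A)"
    using S0 s by (intro \<mu>.finite_measure_subadditive_finite) (auto simp: open_class)
  also have "\<dots> = (\<Sum>A\<in>{A \<in> S0. measure \<mu> A > 0}. measure \<mu> A)"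
    using S0 by (intro sum.mono_neutral_right) (auto simp: zero_less_measure_iff)
  also have "\<dots> \<le> (\<Sum>A\<in>S. measure \<mu> A)"
    using fS by (intro sum_mono2) (auto simp: S_def)
  finally show ?thesis using n fS by (intro exI[of _ S]) (auto simp: S_def)
qed

lemma sum_charged_le_1:
  assumes \<mu>: "\<mu> \<in> prob_measures" and S: "finite S" "S \<subseteq> classes"
  shows "measure \<mu> (\<Union>S) = (\<Sum>A\<in>S. measure \<mu> A)" "(\<Sum>A\<in>S. measure \<mu> A) \<le> 1"
proof -
  interpret \<mu>: prob_space \<mu> using \<mu> by (simp add: space_prob_algebra)
  have s: "sets \<mu> = sets borel" using \<mu> by (simp add: space_prob_algebra)
  have "disjoint_family_on (\<lambda>A. A) S"
    unfolding disjoint_family_on_def using S class_disjoint by blast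
  then have "measure \<mu> (\<Union>A\<in>S. A) = (\<Sum>A\<in>S. measure \<mu> A)"
    using S s by (intro \<mu>.finite_measure_finite_Union) (auto simp: open_class)
  then show "measure \<mu> (\<Union>S) = (\<Sum>A\<in>S. measure \<mu> A)" by simp
  then show "(\<Sum>A\<in>S. measure \<mu> A) \<le> 1" using \<mu>.prob_le_1[of "\<Union>S"] by simp
qed

text \<open>The classes are listed from the last one visited to the first one, and \<open>n\<close> is the time at which
  the last block ends.\<close>

primrec chain_event ::
  "('a set \<Rightarrow> 'a set) \<Rightarrow> ('a \<Rightarrow> real) set \<Rightarrow> ('a set \<Rightarrow> ('a \<Rightarrow> real) \<Rightarrow> real) \<Rightarrow> real \<Rightarrow> 'a set list \<Rightarrow> nat \<Rightarrow> 'w set"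
  where
    "chain_event Kf F \<alpha> r [] n = (if n = 0 then space M else {})"
  | "chain_event Kf F \<alpha> r (A # As) n =
      (\<Union>m\<in>{..<n}. \<Union>k\<in>{m<..n}. chain_event Kf F \<alpha> r As m \<inter> block (Kf A) F (\<alpha> A) r k (n - k))"

lemma chain_event_past:
  assumes F: "test_functions F" and K: "\<And>A. A \<in> set As \<Longrightarrow> Kf A \<in> sets borel"
  shows "chain_event Kf F \<alpha> r As n \<in> sets (past M X n)"
  using K
proof (induction As arbitrary: n)
  case Nil
  then show ?case using sets.top[of "past M X n"] by (cases "n = 0") simp_all
next
  case (Cons A As)
  have "chain_event Kf F \<alpha> r As m \<inter> block (Kf A) F (\<alpha> A) r k (n - k) \<in> sets (past M X n)"
    if "m < n" "k \<in> {m<..n}" for m k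
  proof (rule sets.Int)
    have "chain_event Kf F \<alpha> r As m \<in> sets (past M X m)" using Cons by auto
    then show "chain_event Kf F \<alpha> r As m \<in> sets (past M X n)" using sets_past_mono[of m n] that by auto
    have "block (Kf A) F (\<alpha> A) r k (n - k) \<in> sets (past M X (k + (n - k)))"
      using that Cons.prems F by (intro block_past) auto
    then show "block (Kf A) F (\<alpha> A) r k (n - k) \<in> sets (past M X n)" using that by simp
  qed
  then show ?case
    unfolding chain_event.simps by (intro sets.finite_UN finite_lessThan finite_greaterThanAtMost) auto
qed

lemma chain_event_head:
  assumes "\<omega> \<in> chain_event Kf F \<alpha> r As n"
  shows "As = [] \<and> n = 0 \<or> As \<noteq> [] \<and> n \<ge> 1 \<and> X n \<omega> \<in> Kf (hd As)"
  using assms by (cases As) (auto simp: block_iff split: if_splits)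

lemma chain_event_prob:
  assumes cd: "chain_data S Kf" and F: "test_functions F" and dec: "decoupled S Kf c N"
    and As: "set As \<subseteq> S" "sorted_wrt (\<lambda>A B. leads_to \<rho> (Some B) (Some A)) As" and n: "n \<le> n0"
  shows "prob (chain_event Kf F \<alpha> r As n) \<le>
    (\<Prod>A\<leftarrow>As. real n0 ^ 2 * (c * N * max_prob (Kf A) F (\<alpha> A) r))"
  using As n
proof (induction As arbitrary: n)
  case Nil
  then show ?case by (simp add: prob_space)
next
  case (Cons A As)
  have c: "0 \<le> c" using decoupled_ge_1[OF dec] by simp
  have K: "Kf A \<in> sets borel" if "A \<in> S" for A
    using cd that by (auto simp: chain_data_def intro: borel_compact)
  have KA: "\<And>B. B \<in> set As \<Longrightarrow> Kf B \<in> sets borel" using K Cons.prems by auto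
  let ?P = "\<Prod>A\<leftarrow>As. real n0 ^ 2 * (c * N * max_prob (Kf A) F (\<alpha> A) r)"
  let ?E = "max_prob (Kf A) F (\<alpha> A) r"
  have P0: "0 \<le> ?P" using c by (intro prod_list_nonneg) (auto simp: max_prob_nonneg)
  have one: "prob (chain_event Kf F \<alpha> r As m \<inter> block (Kf A) F (\<alpha> A) r k (n - k)) \<le> c * N * ?E * ?P"
    if mk: "m < n" "k \<in> {m<..n}" for m k
  proof -
    have "prob (chain_event Kf F \<alpha> r As m \<inter> block (Kf A) F (\<alpha> A) r (m + (k - m)) (n - k)) \<le>
        c * prob (chain_event Kf F \<alpha> r As m) * (\<Sum>s=1..N. prob (block (Kf A) F (\<alpha> A) r s (n - k)))"
    proof (rule decoupled_upper[OF dec])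
      show "chain_event Kf F \<alpha> r As m \<in> sets (past M X m)" by (rule chain_event_past[OF F KA])
      fix \<omega> assume \<omega>: "\<omega> \<in> chain_event Kf F \<alpha> r As m"
      show "Y m \<omega> \<in> heads S Kf A"
      proof (cases As)
        case Nil
        then show ?thesis using chain_event_head[OF \<omega>] by (simp add: Y_def heads_def)
      next
        case (Cons B Bs)
        then have "m \<ge> 1" "X m \<omega> \<in> Kf B" using chain_event_head[OF \<omega>] by auto
        moreover have "B \<in> S" "leads_to \<rho> (Some B) (Some A)" using Cons.prems Cons by (auto simp del: leads_to.simps)
        ultimately show ?thesis by (auto simp: Y_def heads_def simp del: leads_to.simps)
      qed
    qed (use mk Cons.prems K F in auto)
    also have "\<dots> \<le> c * ?P * (\<Sum>s=1..N. ?E)"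
    proof (intro mult_mono)
      show "prob (chain_event Kf F \<alpha> r As m) \<le> ?P" using Cons mk by auto
      show "(\<Sum>s=1..N. prob (block (Kf A) F (\<alpha> A) r s (n - k))) \<le> (\<Sum>s=1..N. ?E)"
        by (intro sum_mono max_prob_upper) auto
    qed (use c P0 in \<open>auto intro!: sum_nonneg mult_nonneg_nonneg\<close>)
    also have "\<dots> = c * N * ?E * ?P" by simp
    finally show ?thesis using mk by simp
  qed
  have ev: "chain_event Kf F \<alpha> r As m \<inter> block (Kf A) F (\<alpha> A) r k (n - k) \<in> sets M" if "k \<in> {m<..n}" for m k
    using chain_event_past[OF F KA] that K Cons.prems F by (intro sets.Int past_event block_event) auto
  have "prob (chain_event Kf F \<alpha> r (A # As) n) \<le>
      (\<Sum>m<n. prob (\<Union>k\<in>{m<..n}. chain_event Kf F \<alpha> r As m \<inter> block (Kf A) F (\<alpha> A) r k (n - k)))"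
    unfolding chain_event.simps
    by (rule finite_measure_subadditive_finite) (intro image_subsetI sets.finite_UN ev | simp)+
  also have "\<dots> \<le> (\<Sum>m<n. \<Sum>k\<in>{m<..n}. prob (chain_event Kf F \<alpha> r As m \<inter> block (Kf A) F (\<alpha> A) r k (n - k)))"
    by (intro sum_mono finite_measure_subadditive_finite image_subsetI ev) auto
  also have "\<dots> \<le> (\<Sum>m<n. \<Sum>k\<in>{m<..n}. c * N * ?E * ?P)"
    by (intro sum_mono one) auto
  also have "\<dots> \<le> (\<Sum>m<n. real n0 * (c * N * ?E * ?P))"
  proof (rule sum_mono)
    fix m
    have "(\<Sum>k\<in>{m<..n}. c * N * ?E * ?P) = real (n - m) * (c * N * ?E * ?P)" by simp
    also have "\<dots> \<le> real n0 * (c * N * ?E * ?P)"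
      using Cons.prems c P0 by (intro mult_right_mono) (auto simp: max_prob_nonneg)
    finally show "(\<Sum>k\<in>{m<..n}. c * N * ?E * ?P) \<le> real n0 * (c * N * ?E * ?P)" .
  qed
  also have "\<dots> = real n * (real n0 * (c * N * ?E * ?P))" by simp
  also have "\<dots> \<le> real n0 * (real n0 * (c * N * ?E * ?P))"
    using Cons.prems c P0 by (intro mult_right_mono) (auto simp: max_prob_nonneg)
  finally show ?case by (simp add: power2_eq_square mult_ac)
qed

lemma chain_event_cover:
  assumes o: "ordered \<omega>" and \<omega>: "\<omega> \<in> space M"
    and As: "distinct As" "set As \<subseteq> classes" "sorted_wrt (\<lambda>A B. leads_to \<rho> (Some B) (Some A)) As"
    and K: "\<And>A. A \<in> set As \<Longrightarrow> Kf A \<subseteq> A"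
    and kl: "\<And>A. A \<in> set As \<Longrightarrow> 1 \<le> k A \<and> k A \<le> l A \<and> \<omega> \<in> block (Kf A) F (\<alpha> A) r (k A) (l A - k A)"
  shows "\<omega> \<in> chain_event Kf F \<alpha> r As (if As = [] then 0 else l (hd As))"
  using As K kl
proof (induction As)
  case Nil
  then show ?case using \<omega> by simp
next
  case (Cons A As)
  define m where "m = (if As = [] then 0 else l (hd As))"
  have IH: "\<omega> \<in> chain_event Kf F \<alpha> r As m"
    unfolding m_def by (rule Cons.IH) (use Cons.prems in auto)
  have A: "1 \<le> k A" "k A \<le> l A" "\<omega> \<in> block (Kf A) F (\<alpha> A) r (k A) (l A - k A)" "A \<in> classes" "Kf A \<subseteq> A"
    using Cons.prems by auto
  have "m < k A"
  proof (cases As)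
    case Nil
    then show ?thesis using A by (simp add: m_def)
  next
    case (Cons B Bs)
    have B: "1 \<le> k B" "k B \<le> l B" "\<omega> \<in> block (Kf B) F (\<alpha> B) r (k B) (l B - k B)" "B \<in> classes" "Kf B \<subseteq> B" "A \<noteq> B"
      "leads_to \<rho> (Some B) (Some A)"
      using Cons.prems Cons by (auto simp del: leads_to.simps)
    have "X (k A) \<omega> \<in> A" "X (l B) \<omega> \<in> B" using A B by (auto simp: block_iff)
    have "\<not> k A \<le> l B"
    proof
      assume "k A \<le> l B"
      then have "leads_to \<rho> (Some A) (Some B)"
        using o A(1,4) B(4) \<open>X (k A) \<omega> \<in> A\<close> \<open>X (l B) \<omega> \<in> B\<close> unfolding ordered_def by blast
      then show False using leads_to_antisym[OF A(4) B(4)] B(6,7) by blast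
    qed
    then show ?thesis using Cons by (simp add: m_def)
  qed
  have "\<omega> \<in> chain_event Kf F \<alpha> r (A # As) (l A)"
    unfolding chain_event.simps
  proof (intro UN_I IntI)
    show "m \<in> {..<l A}" "k A \<in> {m<..l A}" using \<open>m < k A\<close> A(2) by auto
  qed (fact IH A(3))+
  then show ?case by simp
qed

lemma block_from_visits:
  fixes \<phi> :: "'a set \<Rightarrow> 'a \<Rightarrow> real"
  assumes o: "ordered \<omega>" and \<omega>: "\<omega> \<in> space M"
    and S: "finite S" "S \<subseteq> classes" and A: "A \<in> S"
    and \<phi>: "\<And>B x. B \<in> S \<Longrightarrow> 0 \<le> \<phi> B x" "\<And>B x. B \<in> S \<Longrightarrow> \<phi> B x \<le> 1" "\<And>B x. B \<in> S \<Longrightarrow> x \<notin> K B \<Longrightarrow> \<phi> B x = 0"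
    and K: "\<And>B. B \<in> S \<Longrightarrow> K B \<subseteq> B"
    and visit: "(\<Sum>i=1..n. \<phi> A (X i \<omega>)) > 0"
    and most: "n - (\<Sum>i=1..n. \<Sum>B\<in>S. \<phi> B (X i \<omega>)) \<le> d"
    and D: "\<And>f x. f \<in> F \<Longrightarrow> \<bar>f x\<bar> \<le> D"
    and near: "\<And>f. f \<in> F \<Longrightarrow> \<bar>(\<Sum>i=1..n. f (X i \<omega>) * \<phi> A (X i \<omega>)) - \<alpha> f\<bar> \<le> e"
  shows "\<exists>k l. 1 \<le> k \<and> k \<le> l \<and> l \<le> n \<and> \<omega> \<in> block (K A) F \<alpha> (e + \<bar>D\<bar> * d) k (l - k)"
proof -
  define V where "V = {i \<in> {1..n}. X i \<omega> \<in> K A}"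
  have "V \<noteq> {}"
  proof
    assume "V = {}"
    then have "(\<Sum>i=1..n. \<phi> A (X i \<omega>)) = 0" using \<phi>(3)[OF A] by (intro sum.neutral) (auto simp: V_def)
    then show False using visit by simp
  qed
  have fV: "finite V" by (simp add: V_def)
  define k l where "k = Min V" and "l = Max V"
  have k: "k \<in> V" and l: "l \<in> V" using fV \<open>V \<noteq> {}\<close> by (auto simp: k_def l_def)
  have kl: "1 \<le> k" "k \<le> l" "l \<le> n" using k l fV by (auto simp: V_def k_def)
  have inV: "i \<in> {k..l}" if "i \<in> V" for i using that fV by (auto simp: k_def l_def)
  have Ac: "A \<in> classes" using A S by auto
  have XA: "X k \<omega> \<in> A" "X l \<omega> \<in> A" using k l K[OF A] by (auto simp: V_def)
  have other: "\<phi> B (X i \<omega>) = 0" if B: "B \<in> S" "B \<noteq> A" and i: "i \<in> {k..l}" for B i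
  proof (rule \<phi>(3)[OF B(1)], rule notI)
    assume "X i \<omega> \<in> K B"
    then have XB: "X i \<omega> \<in> B" using K B by blast
    have Bc: "B \<in> classes" using B S by auto
    have ord: "\<And>A B m n. A \<in> classes \<Longrightarrow> B \<in> classes \<Longrightarrow> 1 \<le> m \<Longrightarrow> m \<le> n \<Longrightarrow> X m \<omega> \<in> A \<Longrightarrow> X n \<omega> \<in> B \<Longrightarrow>
        leads_to \<rho> (Some A) (Some B)"
      using o unfolding ordered_def by blast
    have "leads_to \<rho> (Some A) (Some B)" using i kl by (intro ord[OF Ac Bc _ _ XA(1) XB]) auto
    moreover have "leads_to \<rho> (Some B) (Some A)" using i kl by (intro ord[OF Bc Ac _ _ XB XA(2)]) auto
    ultimately show False using leads_to_antisym[OF Ac Bc] B by blast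
  qed
  have single: "(\<Sum>B\<in>S. \<phi> B (X i \<omega>)) \<le> 1" for i
  proof (cases "\<exists>B\<in>S. X i \<omega> \<in> K B")
    case True
    then obtain B where B: "B \<in> S" "X i \<omega> \<in> K B" by blast
    have "\<phi> B' (X i \<omega>) = 0" if "B' \<in> S - {B}" for B'
    proof (rule \<phi>(3))
      show "X i \<omega> \<notin> K B'" using that B K class_disjoint S by blast
    qed (use that in auto)
    then have "(\<Sum>B\<in>S. \<phi> B (X i \<omega>)) = \<phi> B (X i \<omega>)"
      using S B by (subst sum.remove[of _ B]) auto
    then show ?thesis using \<phi>(2)[OF B(1)] by simp
  next
    case False
    then have "(\<Sum>B\<in>S. \<phi> B (X i \<omega>)) = 0" using \<phi>(3) by (intro sum.neutral) blast
    then show ?thesis by simp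
  qed
  have gap: "(\<Sum>i=k..l. 1 - \<phi> A (X i \<omega>)) \<le> d"
  proof -
    have "(\<Sum>i=k..l. 1 - \<phi> A (X i \<omega>)) = (\<Sum>i=k..l. 1 - (\<Sum>B\<in>S. \<phi> B (X i \<omega>)))"
    proof (rule sum.cong)
      fix i assume i: "i \<in> {k..l}"
      have "(\<Sum>B\<in>S. \<phi> B (X i \<omega>)) = \<phi> A (X i \<omega>) + (\<Sum>B\<in>S - {A}. \<phi> B (X i \<omega>))"
        using S(1) A by (rule sum.remove)
      also have "(\<Sum>B\<in>S - {A}. \<phi> B (X i \<omega>)) = 0" using other i by (intro sum.neutral) auto
      finally show "1 - \<phi> A (X i \<omega>) = 1 - (\<Sum>B\<in>S. \<phi> B (X i \<omega>))" by simp
    qed simp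
    also have "\<dots> \<le> (\<Sum>i=1..n. 1 - (\<Sum>B\<in>S. \<phi> B (X i \<omega>)))"
      using kl single by (intro sum_mono2) auto
    also have "\<dots> = n - (\<Sum>i=1..n. \<Sum>B\<in>S. \<phi> B (X i \<omega>))" by (simp add: sum_subtractf)
    finally show ?thesis using most by linarith
  qed
  have "\<omega> \<in> block (K A) F \<alpha> (e + \<bar>D\<bar> * d) k (l - k)"
    unfolding block_iff
  proof (intro conjI ballI)
    show "\<omega> \<in> space M" "X k \<omega> \<in> K A" "X (k + (l - k)) \<omega> \<in> K A" using \<omega> k l kl by (auto simp: V_def)
    fix f assume f: "f \<in> F"
    have "(\<Sum>i\<le>l - k. f (X (k + i) \<omega>)) = (\<Sum>i=k..l. f (X i \<omega>))"
      using kl by (intro sum.reindex_bij_witness[of _ "\<lambda>i. i - k" "\<lambda>i. k + i"]) auto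
    also have "\<dots> = (\<Sum>i=k..l. f (X i \<omega>) * \<phi> A (X i \<omega>)) + (\<Sum>i=k..l. f (X i \<omega>) * (1 - \<phi> A (X i \<omega>)))"
      by (simp add: sum.distrib[symmetric] algebra_simps)
    also have "(\<Sum>i=k..l. f (X i \<omega>) * \<phi> A (X i \<omega>)) = (\<Sum>i=1..n. f (X i \<omega>) * \<phi> A (X i \<omega>))"
    proof (rule sum.mono_neutral_left)
      show "\<forall>i\<in>{1..n} - {k..l}. f (X i \<omega>) * \<phi> A (X i \<omega>) = 0"
      proof
        fix i assume i: "i \<in> {1..n} - {k..l}"
        then have "i \<notin> V" using inV by blast
        then have "X i \<omega> \<notin> K A" using i by (auto simp: V_def)
        then show "f (X i \<omega>) * \<phi> A (X i \<omega>) = 0" using \<phi>(3)[OF A] by simp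
      qed
    qed (use kl in auto)
    finally have eq: "(\<Sum>i\<le>l - k. f (X (k + i) \<omega>)) = (\<Sum>i=1..n. f (X i \<omega>) * \<phi> A (X i \<omega>)) +
        (\<Sum>i=k..l. f (X i \<omega>) * (1 - \<phi> A (X i \<omega>)))" .
    have "\<bar>\<Sum>i=k..l. f (X i \<omega>) * (1 - \<phi> A (X i \<omega>))\<bar> \<le> (\<Sum>i=k..l. \<bar>f (X i \<omega>) * (1 - \<phi> A (X i \<omega>))\<bar>)"
      by (rule sum_abs)
    also have "\<dots> \<le> (\<Sum>i=k..l. \<bar>D\<bar> * (1 - \<phi> A (X i \<omega>)))"
    proof (rule sum_mono)
      fix i
      have "\<bar>f (X i \<omega>)\<bar> \<le> \<bar>D\<bar>" using D[OF f, of "X i \<omega>"] by linarith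
      then show "\<bar>f (X i \<omega>) * (1 - \<phi> A (X i \<omega>))\<bar> \<le> \<bar>D\<bar> * (1 - \<phi> A (X i \<omega>))"
        using \<phi>(2)[OF A, of "X i \<omega>"] by (simp add: abs_mult mult_right_mono)
    qed
    also have "\<dots> = \<bar>D\<bar> * (\<Sum>i=k..l. 1 - \<phi> A (X i \<omega>))" by (simp add: sum_distrib_left)
    also have "\<dots> \<le> \<bar>D\<bar> * d" using gap by (intro mult_left_mono) auto
    finally show "\<bar>(\<Sum>i\<le>l - k. f (X (k + i) \<omega>)) - \<alpha> f\<bar> \<le> e + \<bar>D\<bar> * d"
      using near[OF f] eq by linarith
  qed
  then show ?thesis using kl by blast
qed

subsection \<open>The local upper bound\<close>

lemma class_cutoff_approx:
  assumes \<mu>: "\<mu> \<in> prob_measures" and A: "A \<in> classes" and \<gamma>: "\<gamma> > 0"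
  shows "\<exists>\<phi> K. continuous_on UNIV \<phi> \<and> (\<forall>x. 0 \<le> \<phi> x \<and> \<phi> x \<le> 1) \<and> compact K \<and> K \<subseteq> A \<and>
    (\<forall>x. x \<notin> K \<longrightarrow> \<phi> x = 0) \<and> (\<integral>x. \<phi> x \<partial>\<mu>) > measure \<mu> A - \<gamma>"
proof -
  interpret \<mu>: prob_space \<mu> using \<mu> by (simp add: space_prob_algebra)
  have s [measurable_cong]: "sets \<mu> = sets borel" using \<mu> by (simp add: space_prob_algebra)
  obtain Q where Q: "compact Q" "Q \<subseteq> A" "measure \<mu> Q > measure \<mu> A - \<gamma>"
    by (rule compact_inner_approx[OF \<mu> measurable_class[OF A] \<gamma>])
  obtain \<phi> :: "'a \<Rightarrow> real" and L where \<phi>: "continuous_on UNIV \<phi>" "\<And>x. 0 \<le> \<phi> x" "\<And>x. \<phi> x \<le> 1"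
    "\<And>x. x \<in> Q \<Longrightarrow> \<phi> x = 1" "compact L" "L \<subseteq> A" "\<And>x. x \<notin> L \<Longrightarrow> \<phi> x = 0"
    using compact_cutoff[OF Q(1,2) open_class[OF A]] by blast
  have [measurable]: "Q \<in> sets borel" "\<phi> \<in> borel_measurable borel"
    using Q \<phi> by (auto intro: borel_compact borel_measurable_continuous_onI)
  have "measure \<mu> Q = (\<integral>x. indicator Q x \<partial>\<mu>)" by (simp add: sets_eq_imp_space_eq[OF s])
  also have "\<dots> \<le> (\<integral>x. \<phi> x \<partial>\<mu>)"
    using \<phi> by (intro integral_mono \<mu>.integrable_const_bound[where B = 1]) (auto simp: indicator_def)
  finally have "(\<integral>x. \<phi> x \<partial>\<mu>) > measure \<mu> A - \<gamma>" using Q by simp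
  then show ?thesis using \<phi> by blast
qed

lemma integral_cutoff_near:
  assumes \<mu>: "\<mu> \<in> prob_measures" and A: "A \<in> classes"
    and \<phi>: "continuous_on UNIV \<phi>" "\<And>x. 0 \<le> \<phi> x" "\<And>x. \<phi> x \<le> 1" "\<And>x. x \<notin> A \<Longrightarrow> \<phi> x = 0"
    and f: "f \<in> borel_measurable borel" "\<And>x. \<bar>f x\<bar> \<le> D"
  shows "\<bar>(\<integral>x. f x * \<phi> x \<partial>\<mu>) - part \<mu> A f\<bar> \<le> D * (measure \<mu> A - (\<integral>x. \<phi> x \<partial>\<mu>))"
proof -
  interpret \<mu>: prob_space \<mu> using \<mu> by (simp add: space_prob_algebra)
  have s [measurable_cong]: "sets \<mu> = sets borel" using \<mu> by (simp add: space_prob_algebra)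
  have [measurable]: "f \<in> borel_measurable borel" "\<phi> \<in> borel_measurable borel" "A \<in> sets borel"
    using f \<phi> A by (auto intro: borel_measurable_continuous_onI)
  have D: "D \<ge> 0" using f(2)[of undefined] by linarith
  have "\<bar>f x * \<phi> x\<bar> \<le> D" for x
    using mult_mono[OF f(2)[of x], of "\<bar>\<phi> x\<bar>" 1] \<phi>(2,3)[of x] D by (simp add: abs_mult)
  then have i1: "integrable \<mu> (\<lambda>x. f x * \<phi> x)"
    by (intro \<mu>.integrable_const_bound[where B = D]) auto
  have i2: "integrable \<mu> (\<lambda>x. indicator A x * f x)"
    using f D by (intro \<mu>.integrable_const_bound[where B = D]) (auto simp: indicator_def)
  have i3: "integrable \<mu> \<phi>" using \<phi> by (intro \<mu>.integrable_const_bound[where B = 1]) auto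
  have i4: "integrable \<mu> (indicator A :: 'a \<Rightarrow> real)"
    by (intro \<mu>.integrable_const_bound[where B = 1]) (auto simp: indicator_def)
  have "(\<integral>x. f x * \<phi> x \<partial>\<mu>) - part \<mu> A f = (\<integral>x. f x * \<phi> x - indicator A x * f x \<partial>\<mu>)"
    unfolding part_def using i1 i2 by simp
  also have "\<bar>\<dots>\<bar> \<le> (\<integral>x. \<bar>f x * \<phi> x - indicator A x * f x\<bar> \<partial>\<mu>)" by (rule integral_abs_bound)
  also have "\<dots> \<le> (\<integral>x. D * (indicator A x - \<phi> x) \<partial>\<mu>)"
  proof (rule integral_mono)
    fix x
    have "f x * \<phi> x - indicator A x * f x = f x * (\<phi> x - indicator A x)" by (simp add: algebra_simps)
    moreover have "\<bar>\<phi> x - indicator A x\<bar> = indicator A x - \<phi> x"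
      using \<phi>(3,4)[of x] by (auto simp: indicator_def)
    moreover have "0 \<le> indicator A x - \<phi> x" using \<phi>(3,4)[of x] by (auto simp: indicator_def)
    ultimately show "\<bar>f x * \<phi> x - indicator A x * f x\<bar> \<le> D * (indicator A x - \<phi> x)"
      using f(2)[of x] by (simp add: abs_mult mult_right_mono)
  qed (use i1 i2 i3 i4 in auto)
  also have "\<dots> = D * (measure \<mu> A - (\<integral>x. \<phi> x \<partial>\<mu>))"
    using i3 i4 by (simp add: sets_eq_imp_space_eq[OF s])
  finally show ?thesis .
qed

lemma eventually_nat_of_real: "eventually P (at_top :: real filter) \<Longrightarrow> \<forall>\<^sub>F n in sequentially. P (real n)"
  by (rule eventually_compose_filterlim[OF _ filterlim_real_sequentially])

lemma upper_bound:
  assumes \<mu>: "\<mu> \<in> prob_measures" and one: "measure \<mu> (\<Union>classes) = 1"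
    and reg: "\<And>A. A \<in> charged \<mu> \<Longrightarrow> regular_class A" and comp: "comparable (charged \<mu>)"
    and S0: "finite S0" "S0 \<subseteq> charged \<mu>" and a: "(a :: real) \<ge> 0"
    and less: "ennreal a < (\<Sum>A\<in>S0. class_rate A (part \<mu> A))"
  shows "\<exists>V. openin weak_topology V \<and> \<mu> \<in> V \<and>
    (\<forall>\<^sub>F n in sequentially. prob {\<omega> \<in> space M. empirical X n \<omega> \<in> V} \<le> exp (- a * n))"
proof -
  interpret \<mu>: prob_space \<mu> using \<mu> by (simp add: space_prob_algebra)
  have s [measurable_cong]: "sets \<mu> = sets borel" using \<mu> by (simp add: space_prob_algebra)
  obtain b S1 where S1: "S1 \<subseteq> S0" and b: "\<forall>A\<in>S1. 0 \<le> b A \<and> ennreal (b A) < class_rate A (part \<mu> A)"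
    and ab: "a < (\<Sum>A\<in>S1. b A)"
    using ennreal_sum_split[OF S0(1) less a] by blast
  have fS1: "finite S1" "S1 \<subseteq> charged \<mu>" using S0 S1 finite_subset by blast+
  have S1c: "S1 \<subseteq> classes" using fS1 by (auto simp: charged_def)
  have "\<forall>A\<in>S1. \<exists>F \<epsilon>. test_functions F \<and> \<epsilon> > 0 \<and> (\<forall>K. compact K \<longrightarrow> K \<subseteq> A \<longrightarrow>
      (\<forall>\<^sub>F t in at_top. max_prob K F (\<lambda>f. t * part \<mu> A f) (\<epsilon> * t) < exp (- b A * t)))"
  proof
    fix A assume "A \<in> S1"
    then have bA: "ennreal (b A) < class_rate A (part \<mu> A)" "0 \<le> b A" using b by auto
    show "\<exists>F \<epsilon>. test_functions F \<and> \<epsilon> > 0 \<and> (\<forall>K. compact K \<longrightarrow> K \<subseteq> A \<longrightarrow>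
      (\<forall>\<^sub>F t in at_top. max_prob K F (\<lambda>f. t * part \<mu> A f) (\<epsilon> * t) < exp (- b A * t)))"
      by (rule class_rate_greaterD[OF bA]) blast
  qed
  then obtain FF ee where F\<epsilon>: "\<forall>A\<in>S1. test_functions (FF A) \<and> ee A > 0 \<and> (\<forall>K. compact K \<longrightarrow> K \<subseteq> A \<longrightarrow>
      (\<forall>\<^sub>F t in at_top. max_prob K (FF A) (\<lambda>f. t * part \<mu> A f) (ee A * t) < exp (- b A * t)))"
    unfolding bchoice_iff by (elim exE)
  define F where "F = (\<Union>A\<in>S1. FF A)"
  define \<epsilon> where "\<epsilon> = Min (insert 1 (ee ` S1))"
  have F: "test_functions F" using F\<epsilon> fS1 by (auto simp: F_def test_functions_def)
  have \<epsilon>: "\<epsilon> > 0" "\<And>A. A \<in> S1 \<Longrightarrow> \<epsilon> \<le> ee A"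
    using F\<epsilon> fS1 by (auto simp: \<epsilon>_def)
  obtain D where D: "D \<ge> 1" "\<And>f x. f \<in> F \<Longrightarrow> \<bar>f x\<bar> \<le> D"
    by (rule test_functions_bound[OF F]) blast
  define \<delta> where "\<delta> = Min (insert (\<epsilon> / (4 * D)) ((\<lambda>A. measure \<mu> A / 3) ` S1))"
  have \<delta>: "\<delta> > 0" using \<epsilon> D fS1 by (auto simp: \<delta>_def charged_def)
  have \<delta>\<epsilon>: "4 * D * \<delta> \<le> \<epsilon>"
  proof -
    have "\<delta> \<le> \<epsilon> / (4 * D)" using fS1 by (auto simp: \<delta>_def)
    then show ?thesis using D by (simp add: field_simps)
  qed
  have \<delta>A: "3 * \<delta> \<le> measure \<mu> A" if "A \<in> S1" for A
  proof -
    have "\<delta> \<le> measure \<mu> A / 3" unfolding \<delta>_def by (rule Min_le) (use fS1 that in auto)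
    then show ?thesis by simp
  qed
  have "\<delta> / 2 > 0" using \<delta> by simp
  obtain S where S: "finite S" "S1 \<subseteq> S" "S \<subseteq> charged \<mu>" "(\<Sum>A\<in>S. measure \<mu> A) > 1 - \<delta> / 2"
    using charged_exhaustion[OF \<mu> one \<open>\<delta> / 2 > 0\<close> fS1] by blast
  have Sc: "S \<subseteq> classes" using S by (auto simp: charged_def)
  define \<gamma> where "\<gamma> = \<delta> / (2 * (real (card S) + 1))"
  have \<gamma>: "\<gamma> > 0" "\<gamma> \<le> \<delta> / 2" using \<delta> by (auto simp: \<gamma>_def field_simps)
  have "\<forall>A\<in>S. \<exists>\<phi> K. continuous_on UNIV \<phi> \<and> (\<forall>x. 0 \<le> \<phi> x \<and> \<phi> x \<le> 1) \<and> compact K \<and> K \<subseteq> A \<and>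
      (\<forall>x. x \<notin> K \<longrightarrow> \<phi> x = 0) \<and> (\<integral>x. \<phi> x \<partial>\<mu>) > measure \<mu> A - \<gamma>"
    using Sc by (intro ballI class_cutoff_approx[OF \<mu> _ \<gamma>(1)]) blast
  then obtain \<phi> K where \<phi>K: "\<forall>A\<in>S. continuous_on UNIV (\<phi> A) \<and> (\<forall>x. 0 \<le> \<phi> A x \<and> \<phi> A x \<le> 1) \<and>
      compact (K A) \<and> K A \<subseteq> A \<and> (\<forall>x. x \<notin> K A \<longrightarrow> \<phi> A x = 0) \<and> (\<integral>x. \<phi> A x \<partial>\<mu>) > measure \<mu> A - \<gamma>"
    unfolding bchoice_iff by (elim exE)
  have \<phi>: "continuous_on UNIV (\<phi> A)" "0 \<le> \<phi> A x" "\<phi> A x \<le> 1" "x \<notin> K A \<Longrightarrow> \<phi> A x = 0"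
      "(\<integral>x. \<phi> A x \<partial>\<mu>) > measure \<mu> A - \<gamma>" and K: "compact (K A)" "K A \<subseteq> A"
    if "A \<in> S" for A x
    using \<phi>K that by auto
  have \<phi>b: "bounded (range (\<phi> A))" if "A \<in> S" for A
    using \<phi>(2,3)[OF that] by (rule bounded_range_unit)
  have \<phi>m [measurable]: "\<phi> A \<in> borel_measurable borel" if "A \<in> S" for A
    using \<phi>(1)[OF that] by (rule borel_measurable_continuous_onI)
  have Fm [measurable]: "f \<in> borel_measurable borel" if "f \<in> F" for f
    using test_functions_measurable[OF F that] .
  define \<psi> where "\<psi> x = (\<Sum>B\<in>S. \<phi> B x)" for x
  have \<psi>i: "(\<integral>x. \<psi> x \<partial>\<mu>) \<ge> 1 - \<delta>"
  proof -
    have "(\<integral>x. \<psi> x \<partial>\<mu>) = (\<Sum>B\<in>S. \<integral>x. \<phi> B x \<partial>\<mu>)"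
      unfolding \<psi>_def
    proof (rule Bochner_Integration.integral_sum)
      fix B assume B: "B \<in> S"
      then have [measurable]: "\<phi> B \<in> borel_measurable borel" by (rule \<phi>m)
      show "integrable \<mu> (\<phi> B)" using \<phi>[OF B] by (intro \<mu>.integrable_const_bound[where B = 1]) auto
    qed
    also have "\<dots> \<ge> (\<Sum>B\<in>S. measure \<mu> B - \<gamma>)"
      using \<phi>(5) by (intro sum_mono) (auto intro: less_imp_le)
    moreover have "(\<Sum>B\<in>S. measure \<mu> B - \<gamma>) = (\<Sum>B\<in>S. measure \<mu> B) - card S * \<gamma>" by (simp add: sum_subtractf)
    moreover have "card S * \<gamma> \<le> \<delta> / 2"
      using \<delta> by (auto simp: \<gamma>_def field_simps)
    ultimately show ?thesis using S(4) by linarith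
  qed
  define T where "T = insert \<psi> (\<phi> ` S1 \<union> (\<lambda>(f, A) x. f x * \<phi> A x) ` (F \<times> S1))"
  have T: "test_functions T"
    unfolding test_functions_def
  proof (intro conjI ballI)
    show "finite T" using F fS1 by (simp add: T_def test_functions_def)
    fix g assume "g \<in> T"
    then consider "g = \<psi>" | A where "A \<in> S1" "g = \<phi> A" | f A where "f \<in> F" "A \<in> S1" "g = (\<lambda>x. f x * \<phi> A x)"
      by (auto simp: T_def)
    then have "continuous_on UNIV g \<and> bounded (range g)"
    proof cases
      case 1
      have "\<bar>\<psi> x\<bar> \<le> card S" for x
      proof -
        have "\<bar>\<psi> x\<bar> \<le> (\<Sum>B\<in>S. \<bar>\<phi> B x\<bar>)" unfolding \<psi>_def by (rule sum_abs)
        also have "\<dots> \<le> (\<Sum>B\<in>S. 1)" using \<phi>(2,3) by (intro sum_mono) simp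
        finally show ?thesis by simp
      qed
      then have "bounded (range \<psi>)" by (intro boundedI) auto
      moreover have "continuous_on UNIV \<psi>" unfolding \<psi>_def using \<phi>(1) by (intro continuous_on_sum)
      ultimately show ?thesis using 1 by simp
    next
      case 2
      then show ?thesis using \<phi>(1) \<phi>b S by auto
    next
      case 3
      then have A: "A \<in> S" using S by auto
      have "\<bar>f x * \<phi> A x\<bar> \<le> D" for x
        using mult_mono[OF D(2)[OF 3(1), of x], of "\<bar>\<phi> A x\<bar>" 1] \<phi>(2,3)[OF A, of x] D(1) by (simp add: abs_mult)
      then have "bounded (range (\<lambda>x. f x * \<phi> A x))" by (intro boundedI) auto
      moreover have "continuous_on UNIV (\<lambda>x. f x * \<phi> A x)"
        using \<phi>(1)[OF A] F 3 by (intro continuous_intros) (auto simp: test_functions_def)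
      ultimately show ?thesis using 3 by simp
    qed
    then show "continuous_on UNIV g" "bounded (range g)" by auto
  qed
  let ?V = "{\<nu> \<in> prob_measures. \<forall>g\<in>T. \<bar>(\<integral>x. g x \<partial>\<nu>) - (\<integral>x. g x \<partial>\<mu>)\<bar> < \<delta>}"
  have V: "openin weak_topology ?V" by (rule openin_weak_topology_ball[OF T])
  have cd: "chain_data S1 K"
    using fS1 S1c comp reg K S(2) unfolding chain_data_def comparable_def regular_class_def by blast
  obtain c N where dec: "decoupled S1 K c N" using ex_decoupled[OF cd] by blast
  note c1 = decoupled_ge_1[OF dec]
  have "comparable S1" using comp fS1 unfolding comparable_def by blast
  then obtain As where As: "distinct As" "set As = S1" "sorted_wrt (\<lambda>A B. leads_to \<rho> (Some B) (Some A)) As"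
    using class_list[OF fS1(1) S1c] by blast
  let ?CE = "\<lambda>n m. chain_event K F (\<lambda>A f. real n * part \<mu> A f) (\<epsilon> * n) As m"
  have cover: "\<omega> \<in> (\<Union>m\<in>{..n}. ?CE n m)"
    if o: "ordered \<omega>" and \<omega>: "\<omega> \<in> space M" and n: "n \<ge> 1" and LV: "empirical X n \<omega> \<in> ?V" for \<omega> n
  proof -
    have near: "\<bar>(\<Sum>i=1..n. g (X i \<omega>)) - n * (\<integral>x. g x \<partial>\<mu>)\<bar> < n * \<delta>" if g: "g \<in> T" for g
    proof -
      have "\<bar>(\<integral>x. g x \<partial>empirical X n \<omega>) - (\<integral>x. g x \<partial>\<mu>)\<bar> < \<delta>" using LV g by blast
      then have "\<bar>(\<Sum>i=1..n. g (X i \<omega>)) / n - (\<integral>x. g x \<partial>\<mu>)\<bar> < \<delta>"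
        using test_functions_measurable[OF T g] by (simp add: integral_empirical)
      then have "n * \<bar>(\<Sum>i=1..n. g (X i \<omega>)) / n - (\<integral>x. g x \<partial>\<mu>)\<bar> < n * \<delta>" using n by (intro mult_strict_left_mono) auto
      also have "n * \<bar>(\<Sum>i=1..n. g (X i \<omega>)) / n - (\<integral>x. g x \<partial>\<mu>)\<bar> = \<bar>n * ((\<Sum>i=1..n. g (X i \<omega>)) / n - (\<integral>x. g x \<partial>\<mu>))\<bar>"
        by (simp add: abs_mult)
      also have "n * ((\<Sum>i=1..n. g (X i \<omega>)) / n - (\<integral>x. g x \<partial>\<mu>)) = (\<Sum>i=1..n. g (X i \<omega>)) - n * (\<integral>x. g x \<partial>\<mu>)"
        using n by (simp add: right_diff_distrib)
      finally show ?thesis .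
    qed
    have "\<forall>A\<in>S1. \<exists>k l. 1 \<le> k \<and> k \<le> l \<and> l \<le> n \<and>
        \<omega> \<in> block (K A) F (\<lambda>f. real n * part \<mu> A f) (\<epsilon> * n) k (l - k)"
    proof
      fix A assume A1: "A \<in> S1"
      then have A: "A \<in> S" using S by auto
      have "\<exists>k l. 1 \<le> k \<and> k \<le> l \<and> l \<le> n \<and>
          \<omega> \<in> block (K A) F (\<lambda>f. real n * part \<mu> A f) (n * (2 * D * \<delta>) + \<bar>D\<bar> * (n * (2 * \<delta>))) k (l - k)"
      proof (rule block_from_visits[OF o \<omega> S(1) Sc A, where \<phi> = \<phi>])
        have "\<bar>(\<Sum>i=1..n. \<phi> A (X i \<omega>)) - n * (\<integral>x. \<phi> A x \<partial>\<mu>)\<bar> < n * \<delta>"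
          using A1 by (intro near) (auto simp: T_def)
        moreover have "n * \<delta> \<le> n * (\<integral>x. \<phi> A x \<partial>\<mu>)"
          using \<phi>(5)[OF A] \<delta>A[OF A1] \<gamma> \<delta> by (intro mult_left_mono) auto
        ultimately show "(\<Sum>i=1..n. \<phi> A (X i \<omega>)) > 0" by linarith
        have "\<bar>(\<Sum>i=1..n. \<psi> (X i \<omega>)) - n * (\<integral>x. \<psi> x \<partial>\<mu>)\<bar> < n * \<delta>"
          by (intro near) (auto simp: T_def)
        moreover have "n * (1 - \<delta>) \<le> n * (\<integral>x. \<psi> x \<partial>\<mu>)" using \<psi>i by (intro mult_left_mono) auto
        ultimately have "n - (\<Sum>i=1..n. \<psi> (X i \<omega>)) \<le> n * (2 * \<delta>)" by (simp add: algebra_simps)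
        then show "n - (\<Sum>i=1..n. \<Sum>B\<in>S. \<phi> B (X i \<omega>)) \<le> n * (2 * \<delta>)" by (simp add: \<psi>_def)
        fix f assume f: "f \<in> F"
        have "\<bar>(\<Sum>i=1..n. f (X i \<omega>) * \<phi> A (X i \<omega>)) - n * (\<integral>x. f x * \<phi> A x \<partial>\<mu>)\<bar> < n * \<delta>"
          using A1 f by (intro near) (force simp: T_def)
        moreover have "\<bar>n * (\<integral>x. f x * \<phi> A x \<partial>\<mu>) - n * part \<mu> A f\<bar> \<le> n * (D * \<delta>)"
        proof -
          have "\<bar>(\<integral>x. f x * \<phi> A x \<partial>\<mu>) - part \<mu> A f\<bar> \<le> D * (measure \<mu> A - (\<integral>x. \<phi> A x \<partial>\<mu>))"
            using \<phi>[OF A] K(2)[OF A] Sc A by (intro integral_cutoff_near[OF \<mu> _ _ _ _ _ Fm[OF f] D(2)[OF f]]) auto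
          also have "\<dots> \<le> D * \<delta>" using \<phi>(5)[OF A] \<gamma> \<delta> D(1) by (intro mult_left_mono) auto
          finally have "n * \<bar>(\<integral>x. f x * \<phi> A x \<partial>\<mu>) - part \<mu> A f\<bar> \<le> n * (D * \<delta>)" by (intro mult_left_mono) auto
          then show ?thesis by (simp add: abs_mult right_diff_distrib[symmetric])
        qed
        moreover have "n * \<delta> \<le> n * (D * \<delta>)" using D(1) \<delta> by (intro mult_left_mono) auto
        ultimately show "\<bar>(\<Sum>i=1..n. f (X i \<omega>) * \<phi> A (X i \<omega>)) - real n * part \<mu> A f\<bar> \<le> n * (2 * D * \<delta>)"
          by linarith
      qed (use \<phi> K D in auto)
      then obtain k l where kl: "1 \<le> k" "k \<le> l" "l \<le> n"
        "\<omega> \<in> block (K A) F (\<lambda>f. real n * part \<mu> A f) (n * (2 * D * \<delta>) + \<bar>D\<bar> * (n * (2 * \<delta>))) k (l - k)" by blast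
      have "n * (2 * D * \<delta>) + \<bar>D\<bar> * (n * (2 * \<delta>)) = n * (4 * D * \<delta>)" using D(1) by (simp add: algebra_simps)
      also have "\<dots> \<le> n * \<epsilon>" using \<delta>\<epsilon> by (intro mult_left_mono) auto
      finally have "\<omega> \<in> block (K A) F (\<lambda>f. real n * part \<mu> A f) (\<epsilon> * n) k (l - k)"
        using kl(4) unfolding block_iff by (auto simp: mult.commute intro: order_trans)
      then show "\<exists>k l. 1 \<le> k \<and> k \<le> l \<and> l \<le> n \<and>
        \<omega> \<in> block (K A) F (\<lambda>f. real n * part \<mu> A f) (\<epsilon> * n) k (l - k)"
        using kl(1,2,3) by blast
    qed
    then obtain k l where kl: "\<forall>A\<in>S1. 1 \<le> k A \<and> k A \<le> l A \<and> l A \<le> n \<and>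
        \<omega> \<in> block (K A) F (\<lambda>f. real n * part \<mu> A f) (\<epsilon> * n) (k A) (l A - k A)"
      unfolding bchoice_iff by (elim exE)
    have "\<omega> \<in> ?CE n (if As = [] then 0 else l (hd As))"
    proof (rule chain_event_cover[OF o \<omega> As(1) _ As(3), where k = k and l = l])
      show "set As \<subseteq> classes" using As S1c by simp
      show "K A \<subseteq> A" if "A \<in> set As" for A
        using that As(2) S(2) by (intro K(2)) blast
      show "1 \<le> k A \<and> k A \<le> l A \<and>
        \<omega> \<in> block (K A) F (\<lambda>f. real n * part \<mu> A f) (\<epsilon> * n) (k A) (l A - k A)"
        if "A \<in> set As" for A using kl that As by blast
    qed
    moreover have "(if As = [] then 0 else l (hd As)) \<le> n"
    proof (cases "As = []")
      case False
      then have "hd As \<in> S1" using As by (metis hd_in_set)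
      then show ?thesis using kl by auto
    qed simp
    ultimately show ?thesis by blast
  qed
  have Kb: "K A \<in> sets borel" if "A \<in> S1" for A
    using that S(2) by (intro borel_compact K(1)) blast
  have CEm: "?CE n m \<in> sets M" for n m
    by (rule past_event[OF chain_event_past[OF F]]) (use Kb As(2) in blast)
  define r where "r = length As"
  define E where "E n A = max_prob (K A) F (\<lambda>f. real n * part \<mu> A f) (\<epsilon> * real n)" for n A
  have bound: "prob {\<omega> \<in> space M. empirical X n \<omega> \<in> ?V} \<le> (real n + 1) * (\<Prod>A\<in>S1. real n ^ 2 * (c * N * E n A))"
    if n: "n \<ge> 1" for n
  proof -
    have "prob {\<omega> \<in> space M. empirical X n \<omega> \<in> ?V} \<le> prob (\<Union>m\<in>{..n}. ?CE n m)"
    proof (rule finite_measure_mono_AE)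
      show "AE \<omega> in M. \<omega> \<in> {\<omega> \<in> space M. empirical X n \<omega> \<in> ?V} \<longrightarrow> \<omega> \<in> (\<Union>m\<in>{..n}. ?CE n m)"
        using AE_ordered by eventually_elim (use cover n in blast)
      show "(\<Union>m\<in>{..n}. ?CE n m) \<in> sets M" using CEm by (intro sets.finite_UN) auto
    qed
    also have "\<dots> \<le> (\<Sum>m\<in>{..n}. prob (?CE n m))"
      using CEm by (intro finite_measure_subadditive_finite) auto
    also have "\<dots> \<le> (\<Sum>m\<in>{..n}. \<Prod>A\<leftarrow>As. real n ^ 2 * (c * N * E n A))"
      unfolding E_def
    proof (rule sum_mono)
      fix m assume m: "m \<in> {..n}"
      show "prob (?CE n m) \<le> (\<Prod>A\<leftarrow>As. real n ^ 2 * (c * N * max_prob (K A) F (\<lambda>f. real n * part \<mu> A f) (\<epsilon> * real n)))"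
        by (rule chain_event_prob[OF cd F dec]) (use As m in auto)
    qed
    also have "\<dots> = (real n + 1) * (\<Prod>A\<leftarrow>As. real n ^ 2 * (c * N * E n A))" by simp
    also have "(\<Prod>A\<leftarrow>As. real n ^ 2 * (c * N * E n A)) = (\<Prod>A\<in>S1. real n ^ 2 * (c * N * E n A))"
      unfolding As(2)[symmetric] by (rule prod.distinct_set_conv_list[OF As(1), symmetric])
    finally show ?thesis .
  qed
  have "\<forall>\<^sub>F n in sequentially. \<forall>A\<in>S1. E n A \<le> exp (- b A * n)"
  proof (intro eventually_ball_finite ballI fS1)
    fix A assume A: "A \<in> S1"
    have "\<forall>\<^sub>F t in at_top. max_prob (K A) (FF A) (\<lambda>f. t * part \<mu> A f) (ee A * t) < exp (- b A * t)"
      using F\<epsilon> A K S by blast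
    from eventually_nat_of_real[OF this] show "\<forall>\<^sub>F n in sequentially. E n A \<le> exp (- b A * n)"
    proof eventually_elim
      case (elim n)
      have "E n A \<le> max_prob (K A) (FF A) (\<lambda>f. real n * part \<mu> A f) (ee A * real n)"
        unfolding E_def
      proof (rule max_prob_mono)
        show "FF A \<subseteq> F" using A by (auto simp: F_def)
        show "\<bar>real n * part \<mu> A f - real n * part \<mu> A f\<bar> \<le> ee A * real n - \<epsilon> * real n" for f
          using \<epsilon>(2)[OF A] by (simp add: mult_right_mono)
      qed (use A F\<epsilon> Kb in auto)
      then show ?case using elim by simp
    qed
  qed
  moreover have "\<forall>\<^sub>F n in sequentially. 2 * (c * N) ^ card S1 * real n ^ (2 * card S1 + 1) * exp (- (\<Sum>A\<in>S1. b A) * n) \<le> exp (- a * n)"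
    by (rule eventually_power_times_exp_le[OF ab])
  ultimately have "\<forall>\<^sub>F n in sequentially. prob {\<omega> \<in> space M. empirical X n \<omega> \<in> ?V} \<le> exp (- a * n)"
    using eventually_ge_at_top[of 1]
  proof eventually_elim
    case (elim n)
    have "(\<Prod>A\<in>S1. real n ^ 2 * (c * N * E n A)) \<le> (\<Prod>A\<in>S1. real n ^ 2 * (c * N * exp (- b A * n)))"
      using elim(1) c1 by (intro prod_mono conjI mult_left_mono mult_nonneg_nonneg) (auto simp: E_def max_prob_nonneg)
    also have "\<dots> = (\<Prod>A\<in>S1. real n ^ 2 * (c * N)) * (\<Prod>A\<in>S1. exp (- b A * n))"
      unfolding prod.distrib[symmetric] by (simp add: mult.assoc)
    also have "(\<Prod>A\<in>S1. real n ^ 2 * (c * N)) = real n ^ (2 * card S1) * (c * N) ^ card S1"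
      by (simp add: power_mult_distrib power_mult[symmetric])
    also have "(\<Prod>A\<in>S1. exp (- b A * n)) = exp (- (\<Sum>A\<in>S1. b A) * n)"
      using fS1 by (simp add: exp_sum[symmetric] sum_negf sum_distrib_right)
    finally have "(\<Prod>A\<in>S1. real n ^ 2 * (c * N * E n A)) \<le> real n ^ (2 * card S1) * (c * N) ^ card S1 * exp (- (\<Sum>A\<in>S1. b A) * n)" .
    then have "(real n + 1) * (\<Prod>A\<in>S1. real n ^ 2 * (c * N * E n A)) \<le>
        (2 * real n) * (real n ^ (2 * card S1) * (c * N) ^ card S1 * exp (- (\<Sum>A\<in>S1. b A) * n))"
      using elim(3) c1 by (intro mult_mono) (auto intro!: prod_nonneg simp: E_def max_prob_nonneg)
    also have "\<dots> = 2 * (c * N) ^ card S1 * real n ^ (2 * card S1 + 1) * exp (- (\<Sum>A\<in>S1. b A) * n)" by simp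
    finally show ?case using bound[OF elim(3)] elim(2) by linarith
  qed
  moreover have "\<mu> \<in> ?V" using \<mu> \<delta> by simp
  ultimately show ?thesis using V by blast
qed

end

subsection \<open>The local lower bound\<close>

lemma ennreal_sum_dominate:
  fixes c :: "'b \<Rightarrow> ennreal"
  assumes fin: "finite S" and less: "(\<Sum>A\<in>S. c A) < ennreal a"
  shows "\<exists>\<alpha>. (\<forall>A\<in>S. 0 \<le> \<alpha> A \<and> c A < ennreal (\<alpha> A)) \<and> (\<Sum>A\<in>S. \<alpha> A) < a"
proof -
  define r where "r A = enn2real (c A)" for A
  have cr: "c A = ennreal (r A)" "0 \<le> r A" if "A \<in> S" for A
  proof -
    have "c A \<le> (\<Sum>A\<in>S. c A)" using fin that by (intro member_le_sum) auto
    then have "c A < \<top>" using less by (meson ennreal_less_top le_less_trans less_trans)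
    then show "c A = ennreal (r A)" "0 \<le> r A" by (auto simp: r_def)
  qed
  have "(\<Sum>A\<in>S. c A) = ennreal (\<Sum>A\<in>S. r A)" using cr by (simp add: sum_ennreal)
  then have ra: "(\<Sum>A\<in>S. r A) < a" using less cr(2) by (simp add: ennreal_less_iff sum_nonneg)
  define \<eta> where "\<eta> = (a - (\<Sum>A\<in>S. r A)) / (real (card S) + 1)"
  have \<eta>: "\<eta> > 0" using ra by (simp add: \<eta>_def)
  have "(\<Sum>A\<in>S. r A + \<eta>) = (\<Sum>A\<in>S. r A) + card S * \<eta>" by (simp add: sum.distrib)
  also have "\<dots> < (\<Sum>A\<in>S. r A) + (real (card S) + 1) * \<eta>" using \<eta> by simp
  also have "\<dots> = a" by (simp add: \<eta>_def)
  finally show ?thesis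
    using cr \<eta> by (intro exI[of _ "\<lambda>A. r A + \<eta>"]) (auto simp: ennreal_less_iff)
qed

lemma sum_diff_le_bound:
  fixes g :: "nat \<Rightarrow> real"
  assumes "\<And>i. \<bar>g i\<bar> \<le> D"
  shows "\<bar>(\<Sum>i=1..n. g i) - (\<Sum>i=1..T. g i)\<bar> \<le> D * \<bar>real n - real T\<bar>"
proof -
  have *: "\<bar>(\<Sum>i=1..n. g i) - (\<Sum>i=1..T. g i)\<bar> \<le> D * (real n - real T)" if "T \<le> n" for n T
  proof -
    have "{1..n} = {1..T} \<union> {T<..n}" using that by auto
    moreover have "(\<Sum>i\<in>{1..T} \<union> {T<..n}. g i) = (\<Sum>i=1..T. g i) + (\<Sum>i\<in>{T<..n}. g i)"
      by (rule sum.union_disjoint) auto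
    ultimately have "(\<Sum>i=1..n. g i) = (\<Sum>i=1..T. g i) + (\<Sum>i\<in>{T<..n}. g i)" by (simp only:)
    moreover have "\<bar>\<Sum>i\<in>{T<..n}. g i\<bar> \<le> (\<Sum>i\<in>{T<..n}. \<bar>g i\<bar>)" by (rule sum_abs)
    moreover have "(\<Sum>i\<in>{T<..n}. \<bar>g i\<bar>) \<le> real (card {T<..n}) * D"
      using assms by (intro sum_bounded_above) auto
    moreover have "real (card {T<..n}) * D = D * (real n - real T)" using that by (simp add: of_nat_diff)
    ultimately show ?thesis by linarith
  qed
  show ?thesis
  proof (cases "T \<le> n")
    case True
    then show ?thesis using *[OF True] by simp
  next
    case False
    then show ?thesis using *[of n T] by (simp add: abs_minus_commute)
  qed
qed

context class_chain
begin

lemma chained_blocks: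
  fixes D r :: real
  assumes cd: "chain_data S K" and F: "test_functions F" and D: "\<And>f x. f \<in> F \<Longrightarrow> \<bar>f x\<bar> \<le> D"
    and dec: "decoupled S K c N"
    and As: "set As \<subseteq> S" "sorted_wrt (\<lambda>A B. leads_to \<rho> (Some B) (Some A)) As"
    and e: "\<And>A. A \<in> set As \<Longrightarrow> 0 < e A" "\<And>A. A \<in> set As \<Longrightarrow> e A \<le> max_prob (K A) F (\<alpha> A) r"
  shows "\<exists>T. \<exists>Ev\<in>sets (past M X T).
    (\<forall>\<omega>\<in>Ev. As = [] \<and> T = 0 \<or> As \<noteq> [] \<and> T \<ge> 1 \<and> X T \<omega> \<in> K (hd As)) \<and>
    (\<Prod>A\<leftarrow>As. e A / (2 * c * (real N + 1))) \<le> prob Ev \<and>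
    (\<forall>\<omega>\<in>Ev. \<forall>f\<in>F. \<bar>(\<Sum>i=1..T. f (X i \<omega>)) - (\<Sum>A\<leftarrow>As. \<alpha> A f)\<bar> \<le> length As * (r + N * \<bar>D\<bar>))"
  using As e
proof (induction As)
  case Nil
  have "space M \<in> sets (past M X 0)" using sets.top[of "past M X 0"] by simp
  then show ?case by (intro exI[of _ 0] bexI[of _ "space M"]) (auto simp: prob_space)
next
  case (Cons A As)
  note c = decoupled_ge_1[OF dec]
  have "\<exists>T. \<exists>Ev\<in>sets (past M X T).
    (\<forall>\<omega>\<in>Ev. As = [] \<and> T = 0 \<or> As \<noteq> [] \<and> T \<ge> 1 \<and> X T \<omega> \<in> K (hd As)) \<and>
    (\<Prod>A\<leftarrow>As. e A / (2 * c * (real N + 1))) \<le> prob Ev \<and>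
    (\<forall>\<omega>\<in>Ev. \<forall>f\<in>F. \<bar>(\<Sum>i=1..T. f (X i \<omega>)) - (\<Sum>A\<leftarrow>As. \<alpha> A f)\<bar> \<le> length As * (r + N * \<bar>D\<bar>))"
    by (rule Cons.IH) (use Cons.prems in auto)
  then obtain T Ev where Ev: "Ev \<in> sets (past M X T)"
    and hd: "\<And>\<omega>. \<omega> \<in> Ev \<Longrightarrow> As = [] \<and> T = 0 \<or> As \<noteq> [] \<and> T \<ge> 1 \<and> X T \<omega> \<in> K (hd As)"
    and pr: "(\<Prod>A\<leftarrow>As. e A / (2 * c * (real N + 1))) \<le> prob Ev"
    and sm: "\<And>\<omega> f. \<omega> \<in> Ev \<Longrightarrow> f \<in> F \<Longrightarrow> \<bar>(\<Sum>i=1..T. f (X i \<omega>)) - (\<Sum>A\<leftarrow>As. \<alpha> A f)\<bar> \<le> length As * (r + N * \<bar>D\<bar>)"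
    by blast
  have AS: "A \<in> S" using Cons.prems by simp
  have KA: "K A \<in> sets borel" using cd AS by (auto simp: chain_data_def intro: borel_compact)
  have eA: "0 < e A" "e A \<le> max_prob (K A) F (\<alpha> A) r" using Cons.prems by auto
  have "e A / 2 < max_prob (K A) F (\<alpha> A) r" using eA by linarith
  then obtain k b where k: "k \<ge> 1" and kb: "e A / 2 < prob (block (K A) F (\<alpha> A) r k b)"
    by (rule max_prob_less)
  let ?P = "\<Prod>A\<leftarrow>As. e A / (2 * c * (real N + 1))"
  have "0 < (\<Prod>A\<leftarrow>Bs. e A / (2 * c * (real N + 1)))" if "\<And>A. A \<in> set Bs \<Longrightarrow> 0 < e A" for Bs
    using that c by (induction Bs) (auto intro!: mult_pos_pos divide_pos_pos)
  then have P0: "0 < ?P" using Cons.prems by simp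
  have Ev0: "0 < prob Ev" using P0 pr by linarith
  let ?x = "prob Ev * prob (block (K A) F (\<alpha> A) r k b) / (c * (real N + 1))"
  have x0: "0 < ?x" using Ev0 kb eA c by (intro divide_pos_pos mult_pos_pos) auto
  have low: "prob Ev * prob (block (K A) F (\<alpha> A) r k b) \<le> c * (\<Sum>s=1..N. prob (Ev \<inter> block (K A) F (\<alpha> A) r (T + s) b))"
  proof (rule decoupled_lower[OF dec])
    fix \<omega> assume "\<omega> \<in> Ev"
    show "Y T \<omega> \<in> heads S K A"
    proof (cases As)
      case Nil
      then show ?thesis using hd[OF \<open>\<omega> \<in> Ev\<close>] by (simp add: Y_def heads_def)
    next
      case (Cons B Bs)
      then have "T \<ge> 1" "X T \<omega> \<in> K B" using hd[OF \<open>\<omega> \<in> Ev\<close>] by auto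
      moreover have "B \<in> S" "leads_to \<rho> (Some B) (Some A)" using Cons.prems Cons by (auto simp del: leads_to.simps)
      ultimately show ?thesis by (auto simp: Y_def heads_def simp del: leads_to.simps)
    qed
  qed (use AS KA F Ev k in auto)
  have "\<exists>s\<in>{1..N}. ?x \<le> prob (Ev \<inter> block (K A) F (\<alpha> A) r (T + s) b)"
  proof (rule ccontr)
    assume "\<not> ?thesis"
    then have "(\<Sum>s=1..N. prob (Ev \<inter> block (K A) F (\<alpha> A) r (T + s) b)) \<le> (\<Sum>s=1..N. ?x)"
      by (intro sum_mono) force
    also have "\<dots> = N * ?x" by simp
    also have "\<dots> < (real N + 1) * ?x" using x0 by (intro mult_strict_right_mono) auto
    finally have "c * (\<Sum>s=1..N. prob (Ev \<inter> block (K A) F (\<alpha> A) r (T + s) b)) < c * ((real N + 1) * ?x)"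
      using c by (intro mult_strict_left_mono) auto
    also have "\<dots> = prob Ev * prob (block (K A) F (\<alpha> A) r k b)" using c by simp
    finally show False using low by linarith
  qed
  then obtain s where s: "s \<in> {1..N}" and sx: "?x \<le> prob (Ev \<inter> block (K A) F (\<alpha> A) r (T + s) b)" by blast
  let ?Ev = "Ev \<inter> block (K A) F (\<alpha> A) r (T + s) b"
  show ?case
  proof (intro exI[of _ "T + s + b"] bexI[of _ ?Ev] conjI ballI)
    show "?Ev \<in> sets (past M X (T + s + b))"
    proof (rule sets.Int)
      show "Ev \<in> sets (past M X (T + s + b))" using Ev sets_past_mono[of T "T + s + b"] by auto
      show "block (K A) F (\<alpha> A) r (T + s) b \<in> sets (past M X (T + s + b))"
        using s by (intro block_past KA F) auto
    qed
    have "(\<Prod>A\<leftarrow>A # As. e A / (2 * c * (real N + 1))) = (e A / 2) / (c * (real N + 1)) * ?P" by simp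
    also have "\<dots> \<le> prob (block (K A) F (\<alpha> A) r k b) / (c * (real N + 1)) * prob Ev"
      using kb pr c P0 by (intro mult_mono divide_right_mono) auto
    also have "\<dots> = ?x" by (simp add: mult.commute)
    finally show "(\<Prod>A\<leftarrow>A # As. e A / (2 * c * (real N + 1))) \<le> prob ?Ev" using sx by linarith
    fix \<omega> assume \<omega>: "\<omega> \<in> ?Ev"
    show "A # As = [] \<and> T + s + b = 0 \<or> A # As \<noteq> [] \<and> T + s + b \<ge> 1 \<and> X (T + s + b) \<omega> \<in> K (hd (A # As))"
      using \<omega> s by (auto simp: block_iff)
    fix f assume f: "f \<in> F"
    have 1: "\<bar>(\<Sum>i\<le>b. f (X (T + s + i) \<omega>)) - \<alpha> A f\<bar> \<le> r" using \<omega> f by (auto simp: block_iff)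
    have 2: "\<bar>(\<Sum>i=1..T. f (X i \<omega>)) - (\<Sum>A\<leftarrow>As. \<alpha> A f)\<bar> \<le> length As * (r + N * \<bar>D\<bar>)" using sm \<omega> f by blast
    have 3: "\<bar>(\<Sum>i=1..T + s + b. f (X i \<omega>)) - (\<Sum>i=1..T. f (X i \<omega>)) - (\<Sum>i\<le>b. f (X (T + s + i) \<omega>))\<bar> \<le> s * \<bar>D\<bar>"
    proof (rule sum_gap)
      show "\<bar>f (X i \<omega>)\<bar> \<le> \<bar>D\<bar>" for i using D[OF f, of "X i \<omega>"] by linarith
    qed (use s in auto)
    have 4: "s * \<bar>D\<bar> \<le> N * \<bar>D\<bar>" using s by (intro mult_right_mono) auto
    have 5: "length (A # As) * (r + N * \<bar>D\<bar>) = length As * (r + N * \<bar>D\<bar>) + (r + N * \<bar>D\<bar>)" by (simp add: algebra_simps)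
    have 6: "(\<Sum>A\<leftarrow>A # As. \<alpha> A f) = \<alpha> A f + (\<Sum>A\<leftarrow>As. \<alpha> A f)" by simp
    show "\<bar>(\<Sum>i=1..T + s + b. f (X i \<omega>)) - (\<Sum>A\<leftarrow>A # As. \<alpha> A f)\<bar> \<le> length (A # As) * (r + N * \<bar>D\<bar>)"
      unfolding 5 6 using 1 2 3 4 by linarith
  qed
qed

lemma part_sum_near:
  assumes \<mu>: "\<mu> \<in> prob_measures" and S: "finite S" "S \<subseteq> classes"
    and f: "f \<in> borel_measurable borel" "\<And>x. \<bar>f x\<bar> \<le> D"
  shows "\<bar>(\<Sum>A\<in>S. part \<mu> A f) - (\<integral>x. f x \<partial>\<mu>)\<bar> \<le> D * (1 - (\<Sum>A\<in>S. measure \<mu> A))"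
proof -
  interpret \<mu>: prob_space \<mu> using \<mu> by (simp add: space_prob_algebra)
  have s [measurable_cong]: "sets \<mu> = sets borel" using \<mu> by (simp add: space_prob_algebra)
  have [measurable]: "f \<in> borel_measurable borel" "\<And>A. A \<in> S \<Longrightarrow> A \<in> sets borel" using f S by (auto simp: open_class)
  have D: "D \<ge> 0" using f(2)[of undefined] by linarith
  define U where "U = \<Union>S"
  have [measurable]: "U \<in> sets borel" unfolding U_def using S open_class by (intro borel_open open_Union) blast
  have ind: "(\<Sum>A\<in>S. indicator A x) = (indicator U x :: real)" for x
  proof (cases "x \<in> U")
    case True
    then obtain A where A: "A \<in> S" "x \<in> A" by (auto simp: U_def)
    have "indicator B x = (0 :: real)" if "B \<in> S - {A}" for B
    proof -
      have "x \<notin> B" using that A S(2) class_disjoint by blast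
      then show ?thesis by simp
    qed
    then have "(\<Sum>B\<in>S. indicator B x) = (indicator A x :: real)"
      using S A by (subst sum.remove[of _ A]) auto
    then show ?thesis using True A by simp
  qed (auto simp: U_def indicator_def intro!: sum.neutral)
  have i: "integrable \<mu> (\<lambda>x. indicator A x * f x)" if [measurable]: "A \<in> sets borel" for A
    using f D by (intro \<mu>.integrable_const_bound[where B = D]) (auto simp: indicator_def)
  have if': "integrable \<mu> f" using f by (intro \<mu>.integrable_const_bound[where B = D]) auto
  have "(\<Sum>A\<in>S. part \<mu> A f) = (\<integral>x. (\<Sum>A\<in>S. indicator A x * f x) \<partial>\<mu>)"
    unfolding part_def using i by (subst Bochner_Integration.integral_sum) auto
  also have "\<dots> = (\<integral>x. indicator U x * f x \<partial>\<mu>)" by (simp add: sum_distrib_right[symmetric] ind)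
  finally have "(\<Sum>A\<in>S. part \<mu> A f) - (\<integral>x. f x \<partial>\<mu>) = (\<integral>x. indicator U x * f x - f x \<partial>\<mu>)"
    using i[of U] if' by simp
  also have "\<bar>\<dots>\<bar> \<le> (\<integral>x. \<bar>indicator U x * f x - f x\<bar> \<partial>\<mu>)" by (rule integral_abs_bound)
  also have "\<dots> \<le> (\<integral>x. D * (1 - indicator U x) \<partial>\<mu>)"
  proof (rule integral_mono)
    show "integrable \<mu> (\<lambda>x. D * (1 - indicator U x))"
      using D by (intro \<mu>.integrable_const_bound[where B = D]) (auto simp: indicator_def)
    show "\<bar>indicator U x * f x - f x\<bar> \<le> D * (1 - indicator U x)" for x
      using f(2)[of x] by (auto simp: indicator_def)
  qed (use i[of U] if' in auto)
  also have "\<dots> = D * (1 - measure \<mu> U)"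
  proof -
    have "integrable \<mu> (indicator U :: 'a \<Rightarrow> real)"
      by (intro \<mu>.integrable_const_bound[where B = 1]) (auto simp: indicator_def)
    moreover have "measure \<mu> UNIV = 1" using \<mu>.prob_space sets_eq_imp_space_eq[OF s] by simp
    ultimately show ?thesis by (simp add: sets_eq_imp_space_eq[OF s])
  qed
  also have "measure \<mu> U = (\<Sum>A\<in>S. measure \<mu> A)" unfolding U_def by (rule sum_charged_le_1[OF \<mu> S])
  finally show ?thesis .
qed

lemma part_one: "\<mu> \<in> prob_measures \<Longrightarrow> A \<in> classes \<Longrightarrow> part \<mu> A (\<lambda>_. 1) = measure \<mu> A"
  by (simp add: part_def space_prob_algebra sets_eq_imp_space_eq[of \<mu> borel])

lemma lower_bound:
  fixes a :: real
  assumes \<mu>: "\<mu> \<in> prob_measures" and one: "measure \<mu> (\<Union>classes) = 1"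
    and reg: "\<And>A. A \<in> charged \<mu> \<Longrightarrow> regular_class A" and comp: "comparable (charged \<mu>)"
    and less: "\<And>S. finite S \<Longrightarrow> S \<subseteq> charged \<mu> \<Longrightarrow> (\<Sum>A\<in>S. class_rate A (part \<mu> A)) < ennreal a"
    and V: "openin weak_topology V" "\<mu> \<in> V"
  shows "\<forall>\<^sub>F n in sequentially. exp (- a * n) \<le> prob {\<omega> \<in> space M. empirical X n \<omega> \<in> V}"
proof -
  obtain F0 \<epsilon> where F0: "test_functions F0" and \<epsilon>: "\<epsilon> > 0"
    and sub: "{\<nu> \<in> prob_measures. \<forall>f\<in>F0. \<bar>(\<integral>x. f x \<partial>\<nu>) - (\<integral>x. f x \<partial>\<mu>)\<bar> < \<epsilon>} \<subseteq> V"
    using openin_weak_topologyD[OF V] by blast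
  define F where "F = insert (\<lambda>_. 1) F0"
  have F: "test_functions F" using F0 by (auto simp: F_def test_functions_def)
  obtain D where D: "D \<ge> 1" "\<And>f x. f \<in> F \<Longrightarrow> \<bar>f x\<bar> \<le> D"
    by (rule test_functions_bound[OF F]) blast
  define \<delta> where "\<delta> = \<epsilon> / (8 * D)"
  have \<delta>: "\<delta> > 0" using \<epsilon> D by (simp add: \<delta>_def)
  obtain S where S: "finite S" "S \<subseteq> charged \<mu>" "(\<Sum>A\<in>S. measure \<mu> A) > 1 - \<delta>"
    using charged_exhaustion[OF \<mu> one \<delta>, of "{}"] by auto
  have Sc: "S \<subseteq> classes" using S by (auto simp: charged_def)
  obtain \<alpha> where \<alpha>: "\<forall>A\<in>S. 0 \<le> \<alpha> A \<and> class_rate A (part \<mu> A) < ennreal (\<alpha> A)" and \<alpha>a: "(\<Sum>A\<in>S. \<alpha> A) < a"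
    using ennreal_sum_dominate[OF S(1) less[OF S(1,2)]] by blast
  define r where "r = real (card S)"
  define \<epsilon>' where "\<epsilon>' = \<epsilon> / (8 * D * (r + 1))"
  have r0: "r \<ge> 0" by (simp add: r_def)
  have \<epsilon>': "\<epsilon>' > 0" using \<epsilon> D r0 by (simp add: \<epsilon>'_def)
  have "\<forall>A\<in>S. \<exists>K. compact K \<and> K \<subseteq> A \<and>
      (\<forall>\<^sub>F t in at_top. exp (- \<alpha> A * t) \<le> max_prob K F (\<lambda>f. t * part \<mu> A f) (\<epsilon>' * t))"
    using class_rate_lessD[OF reg _ F \<epsilon>'] \<alpha> S by blast
  then obtain K where K: "\<forall>A\<in>S. compact (K A) \<and> K A \<subseteq> A \<and>
      (\<forall>\<^sub>F t in at_top. exp (- \<alpha> A * t) \<le> max_prob (K A) F (\<lambda>f. t * part \<mu> A f) (\<epsilon>' * t))"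
    by (rule bchoice[THEN exE])
  have cd: "chain_data S K"
    using S Sc comp reg K unfolding chain_data_def comparable_def regular_class_def by blast
  obtain c N where dec: "decoupled S K c N" using ex_decoupled[OF cd] by blast
  note c1 = decoupled_ge_1[OF dec]
  have "comparable S" using comp S unfolding comparable_def by blast
  then obtain As where As: "distinct As" "set As = S" "sorted_wrt (\<lambda>A B. leads_to \<rho> (Some B) (Some A)) As"
    using class_list[OF S(1) Sc] by blast
  have len: "real (length As) = r" using As by (simp add: r_def distinct_card[symmetric])
  have "\<forall>\<^sub>F n in sequentially. \<forall>A\<in>S. exp (- \<alpha> A * real n) \<le> max_prob (K A) F (\<lambda>f. real n * part \<mu> A f) (\<epsilon>' * real n)"
  proof (intro eventually_ball_finite ballI S)
    fix A assume A: "A \<in> S"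
    have "\<forall>\<^sub>F t in at_top. exp (- \<alpha> A * t) \<le> max_prob (K A) F (\<lambda>f. t * part \<mu> A f) (\<epsilon>' * t)" using K A by blast
    then show "\<forall>\<^sub>F n in sequentially. exp (- \<alpha> A * real n) \<le> max_prob (K A) F (\<lambda>f. real n * part \<mu> A f) (\<epsilon>' * real n)"
      by (rule eventually_nat_of_real)
  qed
  moreover have "\<forall>\<^sub>F n in sequentially. (2 * c * (real N + 1)) ^ card S * real n ^ 0 * exp (- a * n) \<le> exp (- (\<Sum>A\<in>S. \<alpha> A) * n)"
    by (rule eventually_power_times_exp_le[OF \<alpha>a])
  moreover have "\<forall>\<^sub>F n in sequentially. real n \<ge> 8 * D * r * N * D / \<epsilon>"
    by (rule eventually_nat_of_real[OF eventually_ge_at_top])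
  ultimately show ?thesis using eventually_ge_at_top[of 1]
  proof eventually_elim
    case (elim n)
    let ?Z = "2 * c * (real N + 1)"
    have Z: "?Z > 0" using c1 by simp
    have "\<exists>T. \<exists>Ev\<in>sets (past M X T).
      (\<forall>\<omega>\<in>Ev. As = [] \<and> T = 0 \<or> As \<noteq> [] \<and> T \<ge> 1 \<and> X T \<omega> \<in> K (hd As)) \<and>
      (\<Prod>A\<leftarrow>As. exp (- \<alpha> A * real n) / ?Z) \<le> prob Ev \<and>
      (\<forall>\<omega>\<in>Ev. \<forall>f\<in>F. \<bar>(\<Sum>i=1..T. f (X i \<omega>)) - (\<Sum>A\<leftarrow>As. real n * part \<mu> A f)\<bar> \<le> length As * (\<epsilon>' * real n + N * \<bar>D\<bar>))"
    proof (rule chained_blocks[OF cd F _ dec])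
      show "\<bar>f x\<bar> \<le> D" if "f \<in> F" for f x using D(2) that .
    qed (use As elim in auto)
    then obtain T Ev where Ev: "Ev \<in> sets (past M X T)"
      and pr: "(\<Prod>A\<leftarrow>As. exp (- \<alpha> A * real n) / ?Z) \<le> prob Ev"
      and sm: "\<And>\<omega> f. \<omega> \<in> Ev \<Longrightarrow> f \<in> F \<Longrightarrow> \<bar>(\<Sum>i=1..T. f (X i \<omega>)) - (\<Sum>A\<leftarrow>As. real n * part \<mu> A f)\<bar> \<le>
        length As * (\<epsilon>' * real n + N * \<bar>D\<bar>)"
      by blast
    have sums: "(\<Sum>A\<leftarrow>As. real n * part \<mu> A f) = n * (\<Sum>A\<in>S. part \<mu> A f)" for f
      unfolding sum_distrib_left As(2)[symmetric] by (rule sum.distinct_set_conv_list[OF As(1), symmetric])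
    let ?R = "r * (\<epsilon>' * real n + N * D)"
    have R: "?R \<le> n * (\<epsilon> / (4 * D))"
    proof -
      have "8 * D * r * N * D \<le> \<epsilon> * n" using elim(3) \<epsilon> by (simp add: pos_divide_le_eq mult.commute)
      then have "r * (N * D) \<le> \<epsilon> * n / (8 * D)" using D(1) by (simp add: field_simps)
      moreover have "r * (\<epsilon>' * real n) \<le> \<epsilon> * n / (8 * D)"
      proof -
        have "r * (\<epsilon>' * real n) = (r / (r + 1)) * (\<epsilon> * n / (8 * D))" by (simp add: \<epsilon>'_def)
        also have "\<dots> \<le> 1 * (\<epsilon> * n / (8 * D))" using r0 \<epsilon> D(1) by (intro mult_right_mono) auto
        finally show ?thesis by simp
      qed
      ultimately have "?R \<le> \<epsilon> * n / (8 * D) + \<epsilon> * n / (8 * D)" by (simp add: distrib_left)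
      then show ?thesis using D(1) by (simp add: field_simps)
    qed
    have nonneg: "0 \<le> r * (\<epsilon>' * real n + N * D)" using r0 \<epsilon>' D(1) by (intro mult_nonneg_nonneg add_nonneg_nonneg) auto
    have mass: "1 - \<delta> < (\<Sum>A\<in>S. measure \<mu> A)" "(\<Sum>A\<in>S. measure \<mu> A) \<le> 1"
      using S(3) sum_charged_le_1[OF \<mu> S(1) Sc] by auto
    have inV: "empirical X n \<omega> \<in> V" if \<omega>: "\<omega> \<in> Ev" for \<omega>
    proof -
      have "\<bar>(\<Sum>i=1..T. (1::real)) - n * (\<Sum>A\<in>S. part \<mu> A (\<lambda>_. 1))\<bar> \<le> ?R"
        using sm[OF \<omega>, of "\<lambda>_. 1"] D(1) unfolding sums len by (simp add: F_def)
      moreover have "(\<Sum>A\<in>S. part \<mu> A (\<lambda>_. 1)) = (\<Sum>A\<in>S. measure \<mu> A)"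
        using Sc \<mu> by (intro sum.cong) (auto simp: part_one)
      ultimately have T1: "\<bar>real T - n * (\<Sum>A\<in>S. measure \<mu> A)\<bar> \<le> ?R" by simp
      have "n * (1 - \<delta>) \<le> n * (\<Sum>A\<in>S. measure \<mu> A)" "n * (\<Sum>A\<in>S. measure \<mu> A) \<le> real n * 1"
        using mass by (intro mult_left_mono; simp)+
      then have T2: "\<bar>real n - real T\<bar> \<le> ?R + n * \<delta>" using T1 by (simp add: right_diff_distrib)
      have "\<bar>(\<integral>x. f x \<partial>empirical X n \<omega>) - (\<integral>x. f x \<partial>\<mu>)\<bar> < \<epsilon>" if f0: "f \<in> F0" for f
      proof -
        have f: "f \<in> F" using f0 by (simp add: F_def)
        have fm: "f \<in> borel_measurable borel" by (rule test_functions_measurable[OF F f])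
        have 1: "\<bar>(\<Sum>i=1..n. f (X i \<omega>)) - (\<Sum>i=1..T. f (X i \<omega>))\<bar> \<le> D * \<bar>real n - real T\<bar>"
          using D(2)[OF f] by (intro sum_diff_le_bound)
        have 2: "D * \<bar>real n - real T\<bar> \<le> D * (?R + n * \<delta>)" using T2 D(1) by (intro mult_left_mono) auto
        have 3: "\<bar>(\<Sum>i=1..T. f (X i \<omega>)) - n * (\<Sum>A\<in>S. part \<mu> A f)\<bar> \<le> ?R"
          using sm[OF \<omega> f] D(1) unfolding sums len by simp
        have 4: "\<bar>n * (\<Sum>A\<in>S. part \<mu> A f) - n * (\<integral>x. f x \<partial>\<mu>)\<bar> \<le> n * (D * \<delta>)"
        proof -
          have "\<bar>(\<Sum>A\<in>S. part \<mu> A f) - (\<integral>x. f x \<partial>\<mu>)\<bar> \<le> D * (1 - (\<Sum>A\<in>S. measure \<mu> A))"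
            by (rule part_sum_near[OF \<mu> S(1) Sc fm D(2)[OF f]])
          also have "\<dots> \<le> D * \<delta>" using mass D(1) by (intro mult_left_mono) auto
          finally have "n * \<bar>(\<Sum>A\<in>S. part \<mu> A f) - (\<integral>x. f x \<partial>\<mu>)\<bar> \<le> n * (D * \<delta>)" by (intro mult_left_mono) auto
          then show ?thesis by (simp add: abs_mult right_diff_distrib[symmetric])
        qed
        have 5: "?R \<le> D * ?R" using mult_right_mono[OF D(1) nonneg] by simp
        have 6: "D * ?R \<le> n * (\<epsilon> / 4)"
          using mult_left_mono[OF R, of D] D(1) by simp
        have 7: "D * (n * \<delta>) = n * (\<epsilon> / 8)" using D(1) by (simp add: \<delta>_def)
        have 8: "n * (D * \<delta>) = n * (\<epsilon> / 8)" using D(1) by (simp add: \<delta>_def)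
        have 9: "D * (?R + n * \<delta>) = D * ?R + D * (n * \<delta>)" by (simp add: distrib_left)
        have tri: "\<bar>x - w\<bar> \<le> p + q + s'" if "\<bar>x - y\<bar> \<le> p" "\<bar>y - z\<bar> \<le> q" "\<bar>z - w\<bar> \<le> s'" for x y z w p q s' :: real
          using that by linarith
        have "\<bar>(\<Sum>i=1..n. f (X i \<omega>)) - n * (\<integral>x. f x \<partial>\<mu>)\<bar> \<le> (n * (\<epsilon> / 4) + n * (\<epsilon> / 8)) + n * (\<epsilon> / 4) + n * (\<epsilon> / 8)"
        proof (rule tri)
          show "\<bar>(\<Sum>i=1..n. f (X i \<omega>)) - (\<Sum>i=1..T. f (X i \<omega>))\<bar> \<le> n * (\<epsilon> / 4) + n * (\<epsilon> / 8)"
            using order_trans[OF 1 2] 6 unfolding 9 7 by (rule order_trans[OF _ add_right_mono])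
          show "\<bar>(\<Sum>i=1..T. f (X i \<omega>)) - n * (\<Sum>A\<in>S. part \<mu> A f)\<bar> \<le> n * (\<epsilon> / 4)"
            by (rule order_trans[OF 3 order_trans[OF 5 6]])
          show "\<bar>n * (\<Sum>A\<in>S. part \<mu> A f) - n * (\<integral>x. f x \<partial>\<mu>)\<bar> \<le> n * (\<epsilon> / 8)"
            using 4 unfolding 8 .
        qed
        also have "\<dots> = n * (3 / 4 * \<epsilon>)" by simp
        also have "\<dots> < n * \<epsilon>" using elim(4) \<epsilon> by (intro mult_strict_left_mono) auto
        finally have "\<bar>(\<Sum>i=1..n. f (X i \<omega>)) - n * (\<integral>x. f x \<partial>\<mu>)\<bar> < n * \<epsilon>" .
        moreover have "(\<integral>x. f x \<partial>empirical X n \<omega>) - (\<integral>x. f x \<partial>\<mu>) = ((\<Sum>i=1..n. f (X i \<omega>)) - n * (\<integral>x. f x \<partial>\<mu>)) / n"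
          using elim(4) by (simp add: integral_empirical[OF fm] diff_divide_distrib)
        ultimately show ?thesis using elim(4) by (simp add: abs_divide pos_divide_less_eq mult.commute)
      qed
      then show ?thesis using sub empirical_in_prob_measures[of n X \<omega>] elim(4) by blast
    qed
    have "exp (- a * n) \<le> exp (- (\<Sum>A\<in>S. \<alpha> A) * n) / ?Z ^ card S"
      using elim(2) Z by (simp add: pos_le_divide_eq mult.commute)
    also have "\<dots> = (\<Prod>A\<in>S. exp (- \<alpha> A * real n) / ?Z)"
      using S(1) by (simp add: prod_dividef exp_sum[symmetric] sum_negf sum_distrib_right)
    also have "\<dots> = (\<Prod>A\<leftarrow>As. exp (- \<alpha> A * real n) / ?Z)"
      unfolding As(2)[symmetric] by (rule prod.distinct_set_conv_list[OF As(1)])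
    also have "\<dots> \<le> prob Ev" by (rule pr)
    also have "\<dots> \<le> prob {\<omega> \<in> space M. empirical X n \<omega> \<in> V}"
    proof (rule finite_measure_mono)
      show "Ev \<subseteq> {\<omega> \<in> space M. empirical X n \<omega> \<in> V}"
        using inV sets.sets_into_space[OF past_event[OF Ev]] by blast
      show "{\<omega> \<in> space M. empirical X n \<omega> \<in> V} \<in> sets M"
        by (rule measurable_empirical_open[OF measurable_X V(1) elim(4)])
    qed
    finally show ?case .
  qed
qed

end

section \<open>The rate function\<close>

lemma nn_integral_mixture:
  assumes s: "sets \<mu> = sets borel" "sets \<nu> = sets borel"
    and f: "f \<in> borel_measurable borel"
  shows "(\<integral>\<^sup>+x. f x \<partial>mixture l \<mu> \<nu>) = ennreal l * (\<integral>\<^sup>+x. f x \<partial>\<mu>) + ennreal (1 - l) * (\<integral>\<^sup>+x. f x \<partial>\<nu>)"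
  using f
proof (induction f rule: borel_measurable_induct)
  case (cong f g)
  then have "f = g" by auto
  then show ?case using cong by simp
next
  case (set A)
  then show ?case using s by (simp add: sets_mixture emeasure_mixture)
next
  case (mult u c)
  have [measurable]: "u \<in> borel_measurable (mixture l \<mu> \<nu>)" "u \<in> borel_measurable \<mu>" "u \<in> borel_measurable \<nu>"
    using mult(2) s by (auto simp: sets_mixture cong: measurable_cong_sets)
  show ?case using mult by (simp add: nn_integral_cmult distrib_left mult_ac)
next
  case (add u v)
  have [measurable]: "u \<in> borel_measurable (mixture l \<mu> \<nu>)" "u \<in> borel_measurable \<mu>" "u \<in> borel_measurable \<nu>"
    "v \<in> borel_measurable (mixture l \<mu> \<nu>)" "v \<in> borel_measurable \<mu>" "v \<in> borel_measurable \<nu>"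
    using add.hyps(1,3) s by (auto simp: sets_mixture cong: measurable_cong_sets)
  show ?case using add by (simp add: nn_integral_add distrib_left add_ac)
next
  case (seq U)
  have m: "U i \<in> borel_measurable (mixture l \<mu> \<nu>)" "U i \<in> borel_measurable \<mu>" "U i \<in> borel_measurable \<nu>" for i
    using seq(1)[of i] s by (auto simp: sets_mixture cong: measurable_cong_sets)
  have inc: "incseq (\<lambda>i. c * (\<integral>\<^sup>+x. U i x \<partial>N))" for c :: ennreal and N
    using \<open>incseq U\<close> by (auto simp: incseq_def le_fun_def intro!: mult_left_mono nn_integral_mono)
  have conv: "(\<integral>\<^sup>+x. (SUP i. U i) x \<partial>N) = (SUP i. \<integral>\<^sup>+x. U i x \<partial>N)" if "\<And>i. U i \<in> borel_measurable N" for N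
    unfolding SUP_apply by (rule nn_integral_monotone_convergence_SUP[OF \<open>incseq U\<close> that])
  have "(SUP i. \<integral>\<^sup>+x. U i x \<partial>mixture l \<mu> \<nu>) =
      (SUP i. ennreal l * (\<integral>\<^sup>+x. U i x \<partial>\<mu>) + ennreal (1 - l) * (\<integral>\<^sup>+x. U i x \<partial>\<nu>))"
    using seq by simp
  also have "\<dots> = (SUP i. ennreal l * (\<integral>\<^sup>+x. U i x \<partial>\<mu>)) + (SUP i. ennreal (1 - l) * (\<integral>\<^sup>+x. U i x \<partial>\<nu>))"
    by (rule ennreal_SUP_add[OF inc inc])
  finally show ?case by (simp only: conv[OF m(1)] conv[OF m(2)] conv[OF m(3)] SUP_mult_left_ennreal)
qed

lemma integral_mixture:
  fixes f :: "'a::topological_space \<Rightarrow> real"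
  assumes \<mu>: "\<mu> \<in> prob_measures" and \<nu>: "\<nu> \<in> prob_measures" and l: "0 \<le> l" "l \<le> 1"
    and f: "f \<in> borel_measurable borel" "\<And>x. \<bar>f x\<bar> \<le> D"
  shows "(\<integral>x. f x \<partial>mixture l \<mu> \<nu>) = l * (\<integral>x. f x \<partial>\<mu>) + (1 - l) * (\<integral>x. f x \<partial>\<nu>)"
proof -
  have s: "sets \<mu> = sets borel" "sets \<nu> = sets borel" using \<mu> \<nu> by (auto simp: space_prob_algebra)
  have UNIV: "emeasure \<mu> UNIV = 1" "emeasure \<nu> UNIV = 1"
    using \<mu> \<nu> by (auto simp: space_prob_algebra dest!: prob_space.emeasure_space_1 simp: sets_eq_imp_space_eq[OF s(1)] sets_eq_imp_space_eq[OF s(2)])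
  have spm: "space (mixture l \<mu> \<nu>) = UNIV" using sets_eq_imp_space_eq[OF sets_mixture[of l \<mu> \<nu>]] by simp
  have pm: "prob_space (mixture l \<mu> \<nu>)"
    using l s UNIV by (intro prob_spaceI) (simp add: spm emeasure_mixture ennreal_plus[symmetric])
  have shift: "(\<integral>x. f x \<partial>N) = enn2real (\<integral>\<^sup>+x. ennreal (f x + D) \<partial>N) - D \<and> (\<integral>\<^sup>+x. ennreal (f x + D) \<partial>N) < \<top>"
    if N: "prob_space N" and sN: "sets N = sets borel" for N
  proof -
    interpret N: prob_space N by fact
    have [measurable]: "f \<in> borel_measurable N" using f sN by (simp cong: measurable_cong_sets)
    have i: "integrable N f" using f by (intro N.integrable_const_bound[where B = D]) auto
    have i': "integrable N (\<lambda>x. f x + D)" using i by simp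
    have nn: "0 \<le> f x + D" for x using f(2)[of x] by linarith
    have "(\<integral>\<^sup>+x. ennreal (f x + D) \<partial>N) = ennreal (\<integral>x. f x + D \<partial>N)"
      using i' nn by (intro nn_integral_eq_integral) auto
    moreover have "(\<integral>x. f x + D \<partial>N) = (\<integral>x. f x \<partial>N) + D" using i by (simp add: N.prob_space)
    moreover have "0 \<le> (\<integral>x. f x + D \<partial>N)" using nn by simp
    ultimately show ?thesis by simp
  qed
  have m: "(\<lambda>x. ennreal (f x + D)) \<in> borel_measurable borel" using f by measurable
  have p: "prob_space \<mu>" "prob_space \<nu>" using \<mu> \<nu> by (auto simp: space_prob_algebra)
  let ?a = "\<integral>\<^sup>+x. ennreal (f x + D) \<partial>\<mu>" and ?b = "\<integral>\<^sup>+x. ennreal (f x + D) \<partial>\<nu>"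
  have "enn2real (ennreal l * ?a + ennreal (1 - l) * ?b) = l * enn2real ?a + (1 - l) * enn2real ?b"
    using shift[OF p(1) s(1)] shift[OF p(2) s(2)] l
    by (cases ?a; cases ?b) (auto simp: ennreal_mult[symmetric] ennreal_plus[symmetric] simp del: ennreal_plus)
  moreover have "enn2real ?a = (\<integral>x. f x \<partial>\<mu>) + D" "enn2real ?b = (\<integral>x. f x \<partial>\<nu>) + D"
    using shift[OF p(1) s(1)] shift[OF p(2) s(2)] by simp_all
  moreover have "enn2real (ennreal l * ?a + ennreal (1 - l) * ?b) = (\<integral>x. f x \<partial>mixture l \<mu> \<nu>) + D"
    unfolding nn_integral_mixture[OF s m, symmetric] using shift[OF pm sets_mixture] by simp
  ultimately have "(\<integral>x. f x \<partial>mixture l \<mu> \<nu>) + D = l * ((\<integral>x. f x \<partial>\<mu>) + D) + (1 - l) * ((\<integral>x. f x \<partial>\<nu>) + D)"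
    by metis
  then show ?thesis by (simp add: algebra_simps)
qed

lemma measure_mixture:
  assumes \<mu>: "\<mu> \<in> prob_measures" and \<nu>: "\<nu> \<in> prob_measures" and l: "0 \<le> l" "l \<le> 1" and A: "A \<in> sets borel"
  shows "measure (mixture l \<mu> \<nu>) A = l * measure \<mu> A + (1 - l) * measure \<nu> A"
proof -
  have s: "sets \<mu> = sets borel" "sets \<nu> = sets borel" and p: "prob_space \<mu>" "prob_space \<nu>"
    using \<mu> \<nu> by (auto simp: space_prob_algebra)
  interpret \<mu>: prob_space \<mu> by fact
  interpret \<nu>: prob_space \<nu> by fact
  have "emeasure (mixture l \<mu> \<nu>) A = ennreal (l * measure \<mu> A + (1 - l) * measure \<nu> A)"
    using l by (simp add: emeasure_mixture[OF s A] \<mu>.emeasure_eq_measure \<nu>.emeasure_eq_measure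
        ennreal_mult[symmetric] ennreal_plus[symmetric] del: ennreal_plus)
  then show ?thesis using l by (intro measure_eq_emeasure_eq_ennreal) simp_all
qed

lemma mixture_0: "sets \<mu> = sets borel \<Longrightarrow> sets \<nu> = sets borel \<Longrightarrow> mixture 0 \<mu> \<nu> = \<nu>"
  by (rule measure_eqI) (simp_all add: sets_mixture emeasure_mixture)

lemma mixture_1: "sets \<mu> = sets borel \<Longrightarrow> sets \<nu> = sets borel \<Longrightarrow> mixture 1 \<mu> \<nu> = \<mu>"
  by (rule measure_eqI) (simp_all add: sets_mixture emeasure_mixture)

context class_chain
begin

definition rate_term :: "'a measure \<Rightarrow> 'a set \<Rightarrow> ennreal"
  where "rate_term \<mu> A = (if measure \<mu> A = 0 then 0 else class_rate A (part \<mu> A))"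

definition rate :: "'a measure \<Rightarrow> ennreal"
  where "rate \<mu> = (if \<mu> \<in> admissible_measures \<rho> \<and> measure \<mu> (\<Union>classes) = 1
    then \<integral>\<^sup>+A. rate_term \<mu> A \<partial>count_space classes else \<infinity>)"

lemma admissibleD:
  assumes "\<mu> \<in> admissible_measures \<rho>"
  shows "\<mu> \<in> prob_measures" "\<And>A. A \<in> charged \<mu> \<Longrightarrow> regular_class A" "comparable (charged \<mu>)"
proof -
  have "charged \<mu> \<subseteq> classes" by (auto simp: charged_def)
  then show "\<mu> \<in> prob_measures" "\<And>A. A \<in> charged \<mu> \<Longrightarrow> regular_class A" "comparable (charged \<mu>)"
    using assms totally_ordered_iff[of "charged \<mu>"]
    unfolding admissible_measures_def charged_def regular_class_def by blast+
qed

lemma sum_rate_term_le: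
  assumes "finite S" "S \<subseteq> classes"
  shows "(\<Sum>A\<in>S. rate_term \<mu> A) \<le> (\<integral>\<^sup>+A. rate_term \<mu> A \<partial>count_space classes)"
proof -
  have "(\<Sum>A\<in>S. rate_term \<mu> A) = (\<Sum>A\<in>S. rate_term \<mu> A * indicator S A)" by (intro sum.cong) auto
  also have "\<dots> = (\<integral>\<^sup>+A. rate_term \<mu> A * indicator S A \<partial>count_space classes)"
    using assms by (intro nn_integral_count_space'[symmetric]) auto
  also have "\<dots> \<le> (\<integral>\<^sup>+A. rate_term \<mu> A \<partial>count_space classes)"
    by (intro nn_integral_mono) (auto simp: indicator_def)
  finally show ?thesis .
qed

lemma rate_term_finite_approx:
  assumes less: "x < (\<integral>\<^sup>+A. rate_term \<mu> A \<partial>count_space classes)"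
  shows "\<exists>S. finite S \<and> S \<subseteq> charged \<mu> \<and> x < (\<Sum>A\<in>S. class_rate A (part \<mu> A))"
proof (cases "classes = {}")
  case True
  then show ?thesis using less by (simp add: nn_integral_empty)
next
  case ne: False
  define c where "c = from_nat_into classes"
  have rc: "range c = classes" unfolding c_def by (rule range_from_nat_into[OF ne countable_classes])
  define S where "S n = c ` {..<n}" for n
  have S: "finite (S n)" "S n \<subseteq> classes" for n using rc by (auto simp: S_def)
  have inc: "incseq (\<lambda>n A. rate_term \<mu> A * indicator (S n) A)"
    by (auto simp: incseq_def le_fun_def S_def indicator_def)
  have "(\<integral>\<^sup>+A. rate_term \<mu> A \<partial>count_space classes) =
      (\<integral>\<^sup>+A. (SUP n. rate_term \<mu> A * indicator (S n) A) \<partial>count_space classes)"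
  proof (rule nn_integral_cong)
    fix A assume "A \<in> space (count_space classes)"
    then obtain i where "A = c i" using rc by auto
    then have "A \<in> S (Suc i)" by (auto simp: S_def)
    show "rate_term \<mu> A = (SUP n. rate_term \<mu> A * indicator (S n) A)"
    proof (rule antisym)
      show "rate_term \<mu> A \<le> (SUP n. rate_term \<mu> A * indicator (S n) A)"
        using \<open>A \<in> S (Suc i)\<close> by (intro SUP_upper2[of "Suc i"]) auto
      show "(SUP n. rate_term \<mu> A * indicator (S n) A) \<le> rate_term \<mu> A"
        by (intro SUP_least) (auto simp: indicator_def)
    qed
  qed
  also have "\<dots> = (SUP n. \<integral>\<^sup>+A. rate_term \<mu> A * indicator (S n) A \<partial>count_space classes)"
    by (rule nn_integral_monotone_convergence_SUP[OF inc]) simp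
  finally have "x < (SUP n. \<integral>\<^sup>+A. rate_term \<mu> A * indicator (S n) A \<partial>count_space classes)" using less by simp
  then obtain n where n: "x < (\<integral>\<^sup>+A. rate_term \<mu> A * indicator (S n) A \<partial>count_space classes)"
    by (auto simp: less_SUP_iff)
  also have "\<dots> = (\<Sum>A\<in>S n. rate_term \<mu> A * indicator (S n) A)"
    using S by (intro nn_integral_count_space') auto
  also have "\<dots> = (\<Sum>A\<in>{A \<in> S n. measure \<mu> A > 0}. rate_term \<mu> A * indicator (S n) A)"
    using S by (intro sum.mono_neutral_right) (auto simp: rate_term_def zero_less_measure_iff)
  also have "\<dots> = (\<Sum>A\<in>{A \<in> S n. measure \<mu> A > 0}. class_rate A (part \<mu> A))"
    by (intro sum.cong) (auto simp: rate_term_def)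
  finally show ?thesis
    using S by (intro exI[of _ "{A \<in> S n. measure \<mu> A > 0}"]) (auto simp: charged_def)
qed

lemma rate_lower:
  fixes a :: real
  assumes less: "rate \<mu> < ennreal a" and V: "openin weak_topology V" "\<mu> \<in> V"
  shows "\<forall>\<^sub>F n in sequentially. exp (- a * n) \<le> prob {\<omega> \<in> space M. empirical X n \<omega> \<in> V}"
proof -
  have adm: "\<mu> \<in> admissible_measures \<rho>" "measure \<mu> (\<Union>classes) = 1"
    and eq: "rate \<mu> = (\<integral>\<^sup>+A. rate_term \<mu> A \<partial>count_space classes)"
    using less by (auto simp: rate_def split: if_splits)
  show ?thesis
  proof (rule lower_bound[OF admissibleD(1)[OF adm(1)] adm(2) admissibleD(2)[OF adm(1)] admissibleD(3)[OF adm(1)] _ V])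
    fix S assume S: "finite S" "S \<subseteq> charged \<mu>"
    have "(\<Sum>A\<in>S. class_rate A (part \<mu> A)) = (\<Sum>A\<in>S. rate_term \<mu> A)"
      using S by (intro sum.cong) (auto simp: rate_term_def charged_def)
    also have "\<dots> \<le> rate \<mu>" unfolding eq using S by (intro sum_rate_term_le) (auto simp: charged_def)
    finally show "(\<Sum>A\<in>S. class_rate A (part \<mu> A)) < ennreal a" using less by simp
  qed
qed

lemma not_admissible_superexponential:
  assumes \<mu>: "\<mu> \<in> prob_measures" and one: "measure \<mu> (\<Union>classes) = 1"
    and na: "\<mu> \<notin> admissible_measures \<rho>" and a: "(a :: real) \<ge> 0"
  shows "\<exists>V. openin weak_topology V \<and> \<mu> \<in> V \<and>
    (\<forall>\<^sub>F n in sequentially. prob {\<omega> \<in> space M. empirical X n \<omega> \<in> V} \<le> exp (- a * n))"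
proof -
  interpret \<mu>: prob_space \<mu> using \<mu> by (simp add: space_prob_algebra)
  have s: "sets \<mu> = sets borel" using \<mu> by (simp add: space_prob_algebra)
  have sp: "space \<mu> = UNIV" using sets_eq_imp_space_eq[OF s] by simp
  have zero: ?thesis if "\<exists>V. openin weak_topology V \<and> \<mu> \<in> V \<and> (\<forall>n. prob {\<omega> \<in> space M. empirical X n \<omega> \<in> V} = 0)"
  proof -
    from that obtain V where "openin weak_topology V" "\<mu> \<in> V" "\<And>n. prob {\<omega> \<in> space M. empirical X n \<omega> \<in> V} = 0"
      by blast
    then show ?thesis by (intro exI[of _ V]) simp
  qed
  have Cs: "\<Union>classes \<in> sets \<mu>" using open_Union_classes s by auto
  have supp: "measure_support \<mu> \<subseteq> closure (\<Union>classes)"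
  proof
    fix x assume x: "x \<in> measure_support \<mu>"
    show "x \<in> closure (\<Union>classes)"
    proof (rule ccontr)
      assume "x \<notin> closure (\<Union>classes)"
      then have "emeasure \<mu> (- closure (\<Union>classes)) > 0"
        using x unfolding measure_support_def by (auto simp: open_Compl)
      moreover have "measure \<mu> (- closure (\<Union>classes)) \<le> measure \<mu> (space \<mu> - \<Union>classes)"
        using sets.compl_sets[OF Cs] closure_subset[of "\<Union>classes"]
        by (intro \<mu>.finite_measure_mono) (auto simp: sp)
      moreover have "measure \<mu> (space \<mu> - \<Union>classes) = 0"
        using \<mu>.prob_compl[OF Cs] one by simp
      ultimately show False by (simp add: \<mu>.emeasure_eq_measure)
    qed
  qed
  have "\<not> absolutely_continuous lborel \<mu> \<or> (\<exists>A\<in>classes. measure \<mu> A > 0 \<and> \<not> leads_to \<rho> None (Some A)) \<or>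
      \<not> comparable (charged \<mu>)"
  proof -
    have "charged \<mu> \<subseteq> classes" by (auto simp: charged_def)
    from totally_ordered_iff[OF this] show ?thesis
      using na \<mu> supp unfolding admissible_measures_def charged_def by blast
  qed
  then consider (reach) A where "A \<in> classes" "measure \<mu> A > 0" "\<not> leads_to \<rho> None (Some A)"
    | (comp) "\<not> comparable (charged \<mu>)"
    | (ac) "\<not> absolutely_continuous lborel \<mu>" by blast
  then show ?thesis
  proof cases
    case reach
    show ?thesis by (rule zero, rule unreachable_zero[OF \<mu> reach(1,3,2)])
  next
    case comp
    then obtain A B where AB: "A \<in> charged \<mu>" "B \<in> charged \<mu>" "\<not> leads_to \<rho> (Some A) (Some B)"
        "\<not> leads_to \<rho> (Some B) (Some A)"
      unfolding comparable_def by blast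
    show ?thesis
      by (rule zero, rule incomparable_zero[OF \<mu> _ _ _ _ AB(3,4)]) (use AB in \<open>auto simp: charged_def\<close>)
  next
    case ac
    then obtain N where N: "N \<in> null_sets lborel" "N \<notin> null_sets \<mu>"
      unfolding absolutely_continuous_def by blast
    have Nb: "N \<in> sets borel" "emeasure lborel N = 0" using N by auto
    have "\<exists>A\<in>classes. measure \<mu> (N \<inter> A) > 0"
    proof (rule ccontr)
      assume "\<not> ?thesis"
      then have z: "measure \<mu> (N \<inter> A) = 0" if "A \<in> classes" for A
        using that by (auto simp: zero_less_measure_iff)
      have "(\<Union>A\<in>classes. N \<inter> A) \<in> null_sets \<mu>"
        using z Nb s by (intro null_sets_UN' countable_classes) (auto simp: null_sets_def \<mu>.emeasure_eq_measure)
      moreover have "space \<mu> - \<Union>classes \<in> null_sets \<mu>"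
        using \<mu>.prob_compl[OF Cs] one Cs by (auto simp: null_sets_def \<mu>.emeasure_eq_measure)
      ultimately have "(\<Union>A\<in>classes. N \<inter> A) \<union> (space \<mu> - \<Union>classes) \<in> null_sets \<mu>" by (rule null_sets.Un)
      moreover have "N \<subseteq> (\<Union>A\<in>classes. N \<inter> A) \<union> (space \<mu> - \<Union>classes)" by (auto simp: sp)
      ultimately have "N \<in> null_sets \<mu>" using null_sets_subset Nb s by metis
      with N show False by simp
    qed
    then obtain A where A: "A \<in> classes" "measure \<mu> (N \<inter> A) > 0" by blast
    show ?thesis
    proof (cases "leads_to \<rho> None (Some A)")
      case True
      then have "regular_class A" using A by (simp only: regular_class_def)
      from singular_superexponential[OF \<mu> this Nb A(2) a] show ?thesis .
    next
      case False
      have "measure \<mu> (N \<inter> A) \<le> measure \<mu> A" using A(1) s by (intro \<mu>.finite_measure_mono) auto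
      then have "measure \<mu> A > 0" using A(2) by linarith
      then show ?thesis by (intro zero unreachable_zero[OF \<mu> A(1) False])
    qed
  qed
qed

lemma rate_upper:
  assumes \<mu>: "\<mu> \<in> prob_measures" and a: "(a :: real) \<ge> 0" and less: "ennreal a < rate \<mu>"
    and iv: "measure \<mu> (\<Union>classes) < 1 \<Longrightarrow>
      \<exists>V. openin weak_topology V \<and> \<mu> \<in> V \<and> log_rate M (empirical X) V \<longlonglongrightarrow> - \<infinity>"
  shows "\<exists>V. openin weak_topology V \<and> \<mu> \<in> V \<and>
    (\<forall>\<^sub>F n in sequentially. prob {\<omega> \<in> space M. empirical X n \<omega> \<in> V} \<le> exp (- a * n))"
proof -
  interpret \<mu>: prob_space \<mu> using \<mu> by (simp add: space_prob_algebra)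
  consider (deficient) "measure \<mu> (\<Union>classes) < 1"
    | (bad) "measure \<mu> (\<Union>classes) = 1" "\<mu> \<notin> admissible_measures \<rho>"
    | (good) "measure \<mu> (\<Union>classes) = 1" "\<mu> \<in> admissible_measures \<rho>"
    using \<mu>.prob_le_1[of "\<Union>classes"] by linarith
  then show ?thesis
  proof cases
    case deficient
    from iv[OF this] obtain V where "openin weak_topology V" "\<mu> \<in> V" "log_rate M (empirical X) V \<longlonglongrightarrow> - \<infinity>" by blast
    then show ?thesis using log_rate_tendsto_MInfty by blast
  next
    case bad
    show ?thesis by (rule not_admissible_superexponential[OF \<mu> bad a])
  next
    case good
    then have "ennreal a < (\<integral>\<^sup>+A. rate_term \<mu> A \<partial>count_space classes)" using less by (simp add: rate_def)
    from rate_term_finite_approx[OF this] obtain S where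
      S: "finite S" "S \<subseteq> charged \<mu>" "ennreal a < (\<Sum>A\<in>S. class_rate A (part \<mu> A))" by blast
    show ?thesis
      by (rule upper_bound[OF \<mu> good(1) admissibleD(2)[OF good(2)] admissibleD(3)[OF good(2)] S(1,2) a S(3)])
  qed
qed

lemma part_mixture:
  assumes \<mu>: "\<mu> \<in> prob_measures" and \<nu>: "\<nu> \<in> prob_measures" and l: "0 \<le> l" "l \<le> 1" and A: "A \<in> classes"
    and f: "continuous_on UNIV f" "bounded (range f)"
  shows "part (mixture l \<mu> \<nu>) A f = l * part \<mu> A f + (1 - l) * part \<nu> A f"
proof -
  obtain D where D: "\<And>x. \<bar>f x\<bar> \<le> D" using f(2) by (auto simp: bounded_iff)
  have [measurable]: "f \<in> borel_measurable borel" "A \<in> sets borel" using f A by (auto intro: borel_measurable_continuous_onI)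
  show ?thesis
    unfolding part_def
  proof (rule integral_mixture[OF \<mu> \<nu> l])
    show "\<bar>indicator A x * f x\<bar> \<le> \<bar>D\<bar>" for x using D[of x] by (auto simp: indicator_def)
  qed simp
qed

lemma part_null:
  assumes \<mu>: "\<mu> \<in> prob_measures" and A: "A \<in> classes" and z: "measure \<mu> A = 0"
  shows "part \<mu> A f = 0"
proof -
  interpret \<mu>: prob_space \<mu> using \<mu> by (simp add: space_prob_algebra)
  have s: "sets \<mu> = sets borel" using \<mu> by (simp add: space_prob_algebra)
  have "A \<in> null_sets \<mu>" using z A s by (auto simp: null_sets_def \<mu>.emeasure_eq_measure)
  then have "AE x in \<mu>. x \<notin> A" by (rule AE_not_in)
  then have "AE x in \<mu>. indicator A x * f x = 0" by eventually_elim simp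
  then show ?thesis unfolding part_def by (rule integral_eq_zero_AE)
qed

lemma rate_term_mixture:
  assumes \<mu>: "\<mu> \<in> prob_measures" and \<nu>: "\<nu> \<in> prob_measures" and l: "0 < l" "l < 1" and A: "A \<in> classes"
    and reg: "measure (mixture l \<mu> \<nu>) A > 0 \<Longrightarrow> regular_class A"
  shows "rate_term (mixture l \<mu> \<nu>) A \<le> ennreal l * rate_term \<mu> A + ennreal (1 - l) * rate_term \<nu> A"
    and "measure \<mu> A = 0 \<or> measure \<nu> A = 0 \<Longrightarrow>
      rate_term (mixture l \<mu> \<nu>) A = ennreal l * rate_term \<mu> A + ennreal (1 - l) * rate_term \<nu> A"
proof -
  have m: "measure (mixture l \<mu> \<nu>) A = l * measure \<mu> A + (1 - l) * measure \<nu> A"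
    using measure_mixture[OF \<mu> \<nu> _ _ measurable_class[OF A]] l by simp
  have pm: "part (mixture l \<mu> \<nu>) A f = l * part \<mu> A f + (1 - l) * part \<nu> A f"
    if "continuous_on UNIV f" "bounded (range f)" for f
    using part_mixture[OF \<mu> \<nu> _ _ A that] l by simp
  show eq: "rate_term (mixture l \<mu> \<nu>) A = ennreal l * rate_term \<mu> A + ennreal (1 - l) * rate_term \<nu> A"
    if z: "measure \<mu> A = 0 \<or> measure \<nu> A = 0"
  proof -
    consider "measure \<mu> A = 0" "measure \<nu> A = 0" | "measure \<mu> A = 0" "measure \<nu> A > 0" | "measure \<mu> A > 0" "measure \<nu> A = 0"
      using z by (metis zero_less_measure_iff)
    then show ?thesis
    proof cases
      case 1
      then show ?thesis by (simp add: rate_term_def m)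
    next
      case 2
      then have "measure (mixture l \<mu> \<nu>) A > 0" using l by (simp add: m)
      then have "class_rate A (part (mixture l \<mu> \<nu>) A) = ennreal (1 - l) * class_rate A (part \<nu> A)"
        using l pm part_null[OF \<mu> A 2(1)] by (intro class_rate_scale reg) auto
      then show ?thesis using 2 l by (simp add: rate_term_def m)
    next
      case 3
      then have "measure (mixture l \<mu> \<nu>) A > 0" using l by (simp add: m)
      then have "class_rate A (part (mixture l \<mu> \<nu>) A) = ennreal l * class_rate A (part \<mu> A)"
        using l pm part_null[OF \<nu> A 3(2)] by (intro class_rate_scale reg) auto
      then show ?thesis using 3 l by (simp add: rate_term_def m)
    qed
  qed
  show "rate_term (mixture l \<mu> \<nu>) A \<le> ennreal l * rate_term \<mu> A + ennreal (1 - l) * rate_term \<nu> A"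
  proof (cases "measure \<mu> A = 0 \<or> measure \<nu> A = 0")
    case True
    then show ?thesis using eq by simp
  next
    case False
    then have pos: "measure \<mu> A > 0" "measure \<nu> A > 0" by (auto simp: zero_less_measure_iff)
    then have mp: "measure (mixture l \<mu> \<nu>) A > 0" using l by (simp add: m add_pos_pos)
    have r: "regular_class A" by (rule reg[OF mp])
    have "class_rate A (part (mixture l \<mu> \<nu>) A) \<le>
        class_rate A (\<lambda>f. l * part \<mu> A f) + class_rate A (\<lambda>f. (1 - l) * part \<nu> A f)"
      by (rule class_rate_add[OF r]) (rule pm)
    also have "class_rate A (\<lambda>f. l * part \<mu> A f) = ennreal l * class_rate A (part \<mu> A)"
      using l by (intro class_rate_scale r) auto
    also have "class_rate A (\<lambda>f. (1 - l) * part \<nu> A f) = ennreal (1 - l) * class_rate A (part \<nu> A)"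
      using l by (intro class_rate_scale r) auto
    finally show ?thesis using False mp by (simp add: rate_term_def)
  qed
qed

lemma rate_mixture:
  assumes \<mu>: "\<mu> \<in> admissible_measures \<rho>" and \<nu>: "\<nu> \<in> admissible_measures \<rho>" and l: "l \<in> {0..1}"
    and mix: "mixture l \<mu> \<nu> \<in> admissible_measures \<rho>"
  shows "rate (mixture l \<mu> \<nu>) \<le> ennreal l * rate \<mu> + ennreal (1 - l) * rate \<nu>"
    and "\<not> (\<exists>A\<in>classes. measure \<mu> A * measure \<nu> A > 0) \<Longrightarrow>
      rate (mixture l \<mu> \<nu>) = ennreal l * rate \<mu> + ennreal (1 - l) * rate \<nu>"
proof -
  note p\<mu> = admissibleD(1)[OF \<mu>] and p\<nu> = admissibleD(1)[OF \<nu>]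
  have s: "sets \<mu> = sets borel" "sets \<nu> = sets borel" using p\<mu> p\<nu> by (auto simp: space_prob_algebra)
  interpret \<mu>: prob_space \<mu> using p\<mu> by (simp add: space_prob_algebra)
  interpret \<nu>: prob_space \<nu> using p\<nu> by (simp add: space_prob_algebra)
  let ?C = "\<Union>classes"
  have Cb: "?C \<in> sets borel" using open_Union_classes by auto
  have "rate (mixture l \<mu> \<nu>) \<le> ennreal l * rate \<mu> + ennreal (1 - l) * rate \<nu> \<and>
    (\<not> (\<exists>A\<in>classes. measure \<mu> A * measure \<nu> A > 0) \<longrightarrow>
      rate (mixture l \<mu> \<nu>) = ennreal l * rate \<mu> + ennreal (1 - l) * rate \<nu>)"
  proof -
    consider "l = 0" | "l = 1" | "0 < l" "l < 1" using l by force
    then show ?thesis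
    proof cases
      case 1
      then show ?thesis using mixture_0[OF s] by simp
    next
      case 2
      then show ?thesis using mixture_1[OF s] by simp
    next
      case l': 3
      have mC: "measure (mixture l \<mu> \<nu>) ?C = l * measure \<mu> ?C + (1 - l) * measure \<nu> ?C"
        using measure_mixture[OF p\<mu> p\<nu> _ _ Cb] l' by simp
      show ?thesis
      proof (cases "measure \<mu> ?C = 1 \<and> measure \<nu> ?C = 1")
        case True
        have eq\<mu>: "rate \<mu> = (\<integral>\<^sup>+A. rate_term \<mu> A \<partial>count_space classes)" using True \<mu> by (simp add: rate_def)
        have eq\<nu>: "rate \<nu> = (\<integral>\<^sup>+A. rate_term \<nu> A \<partial>count_space classes)" using True \<nu> by (simp add: rate_def)
        have eqm: "rate (mixture l \<mu> \<nu>) = (\<integral>\<^sup>+A. rate_term (mixture l \<mu> \<nu>) A \<partial>count_space classes)"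
          using True mix mC by (simp add: rate_def)
        have rhs: "ennreal l * rate \<mu> + ennreal (1 - l) * rate \<nu> =
            (\<integral>\<^sup>+A. ennreal l * rate_term \<mu> A + ennreal (1 - l) * rate_term \<nu> A \<partial>count_space classes)"
          unfolding eq\<mu> eq\<nu> by (simp add: nn_integral_add nn_integral_cmult)
        have reg: "regular_class A" if "A \<in> classes" "measure (mixture l \<mu> \<nu>) A > 0" for A
          using admissibleD(2)[OF mix] that by (auto simp: charged_def)
        show ?thesis
        proof (intro conjI impI)
          show "rate (mixture l \<mu> \<nu>) \<le> ennreal l * rate \<mu> + ennreal (1 - l) * rate \<nu>"
            unfolding rhs eqm
            by (rule nn_integral_mono) (use rate_term_mixture(1)[OF p\<mu> p\<nu> l'] reg in auto)
          assume d: "\<not> (\<exists>A\<in>classes. measure \<mu> A * measure \<nu> A > 0)"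
          show "rate (mixture l \<mu> \<nu>) = ennreal l * rate \<mu> + ennreal (1 - l) * rate \<nu>"
            unfolding rhs eqm
          proof (rule nn_integral_cong)
            fix A assume "A \<in> space (count_space classes)"
            then have A: "A \<in> classes" by simp
            have "measure \<mu> A = 0 \<or> measure \<nu> A = 0"
              using d A by (metis mult_pos_pos zero_less_measure_iff)
            then show "rate_term (mixture l \<mu> \<nu>) A = ennreal l * rate_term \<mu> A + ennreal (1 - l) * rate_term \<nu> A"
              using rate_term_mixture(2)[OF p\<mu> p\<nu> l' A] reg[OF A] by blast
          qed
        qed
      next
        case False
        have le: "measure \<mu> ?C \<le> 1" "measure \<nu> ?C \<le> 1" by simp_all
        have top: "ennreal l * rate \<mu> + ennreal (1 - l) * rate \<nu> = \<infinity>"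
          using False l' by (auto simp: rate_def ennreal_mult_eq_top_iff)
        have "measure (mixture l \<mu> \<nu>) ?C \<noteq> 1"
        proof
          assume "measure (mixture l \<mu> \<nu>) ?C = 1"
          then have "l * (1 - measure \<mu> ?C) + (1 - l) * (1 - measure \<nu> ?C) = 0"
            unfolding mC by (simp add: algebra_simps)
          moreover have "0 \<le> l * (1 - measure \<mu> ?C)" "0 \<le> (1 - l) * (1 - measure \<nu> ?C)" using le l' by auto
          ultimately have "l * (1 - measure \<mu> ?C) = 0" "(1 - l) * (1 - measure \<nu> ?C) = 0" by linarith+
          then show False using False l' by auto
        qed
        then have "rate (mixture l \<mu> \<nu>) = \<infinity>" by (simp add: rate_def)
        then show ?thesis unfolding top by simp
      qed
    qed
  qed
  then show "rate (mixture l \<mu> \<nu>) \<le> ennreal l * rate \<mu> + ennreal (1 - l) * rate \<nu>"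
    "\<not> (\<exists>A\<in>classes. measure \<mu> A * measure \<nu> A > 0) \<Longrightarrow>
      rate (mixture l \<mu> \<nu>) = ennreal l * rate \<mu> + ennreal (1 - l) * rate \<nu>" by blast+
qed

end

theorem theorem1p6:
  fixes \<beta> :: "'a::euclidean_space measure"
    and p :: "'a \<Rightarrow> 'a measure"
    and \<rho> :: "'a option \<Rightarrow> 'a \<Rightarrow> real"
    and M :: "'w measure"
    and X :: "nat \<Rightarrow> 'w \<Rightarrow> 'a"
  assumes initial_law: "\<beta> \<in> prob_measures"
    and kernel: "p \<in> borel \<rightarrow>\<^sub>M prob_algebra borel"
    and density_nonneg: "\<And>x y. \<rho> x y \<ge> 0"
    and density_measurable: "(\<lambda>(x, y). \<rho> x y) \<in> borel_measurable (borel \<Otimes>\<^sub>M borel)"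
    and density: "\<And>x A. A \<in> sets borel \<Longrightarrow>
          emeasure (case x of None \<Rightarrow> \<beta> | Some z \<Rightarrow> p z) A = (\<integral>\<^sup>+y\<in>A. ennreal (\<rho> x y) \<partial>lborel)"
    and chain: "markov_chain M X \<beta> p"
    and i: "open {(x, y). \<rho> x y > 0}"
    and ii: "pseudo_uniform \<rho>"
    and iii: "emeasure lborel (frontier (\<Union>(comm_classes \<rho>))) = 0"
    and iv: "\<And>\<mu>. \<mu> \<in> prob_measures \<Longrightarrow> measure \<mu> (\<Union>(comm_classes \<rho>)) < 1 \<Longrightarrow>
          \<exists>V. openin weak_topology V \<and> \<mu> \<in> V \<and>
              log_rate M (empirical X) V \<longlonglongrightarrow> - \<infinity>"
  shows "\<exists>I :: 'a measure \<Rightarrow> ennreal.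
    weak_LDP M (empirical X) weak_topology I \<and>
    (\<forall>\<mu>\<in>prob_measures. \<mu> \<notin> admissible_measures \<rho> \<longrightarrow> I \<mu> = \<infinity>) \<and>
    (\<forall>\<mu>\<^sub>1\<in>admissible_measures \<rho>. \<forall>\<mu>\<^sub>2\<in>admissible_measures \<rho>. \<forall>l\<in>{0..1}.
       mixture l \<mu>\<^sub>1 \<mu>\<^sub>2 \<in> admissible_measures \<rho> \<longrightarrow>
       I (mixture l \<mu>\<^sub>1 \<mu>\<^sub>2) \<le> ennreal l * I \<mu>\<^sub>1 + ennreal (1 - l) * I \<mu>\<^sub>2) \<and>
    (\<forall>\<mu>\<^sub>1\<in>admissible_measures \<rho>. \<forall>\<mu>\<^sub>2\<in>admissible_measures \<rho>. \<forall>l\<in>{0..1}.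
       mixture l \<mu>\<^sub>1 \<mu>\<^sub>2 \<in> admissible_measures \<rho> \<longrightarrow>
       \<not> (\<exists>A\<in>comm_classes \<rho>. measure \<mu>\<^sub>1 A * measure \<mu>\<^sub>2 A > 0) \<longrightarrow>
       I (mixture l \<mu>\<^sub>1 \<mu>\<^sub>2) = ennreal l * I \<mu>\<^sub>1 + ennreal (1 - l) * I \<mu>\<^sub>2)"
proof -
  interpret class_chain \<beta> p \<rho> M X
    by unfold_locales (fact initial_law kernel density_nonneg density_measurable density chain i ii)+
  have "weak_LDP M (empirical X) weak_topology rate"
  proof (rule weak_LDP_localI)
    show "prob_space M" by unfold_locales
    show "\<forall>\<^sub>F n in sequentially. {\<omega> \<in> space M. empirical X n \<omega> \<in> V} \<in> sets M" if "openin weak_topology V" for V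
      by (rule eventually_sequentiallyI[of 1]) (rule measurable_empirical_open[OF measurable_X that])
    show "\<forall>\<^sub>F n in sequentially. exp (- a * n) \<le> measure M {\<omega> \<in> space M. empirical X n \<omega> \<in> V}"
      if "\<mu> \<in> V" "openin weak_topology V" "a \<ge> 0" "rate \<mu> < ennreal a" for \<mu> V and a :: real
      using rate_lower[OF that(4,2,1)] .
    show "\<exists>V. openin weak_topology V \<and> \<mu> \<in> V \<and>
        (\<forall>\<^sub>F n in sequentially. measure M {\<omega> \<in> space M. empirical X n \<omega> \<in> V} \<le> exp (- a * n))"
      if "\<mu> \<in> topspace weak_topology" "a \<ge> 0" "ennreal a < rate \<mu>" for \<mu> and a :: real
    proof (rule rate_upper[OF _ that(2,3)])
      show "\<mu> \<in> prob_measures" using that(1) by (simp add: topspace_weak_topology)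
      then show "\<exists>V. openin weak_topology V \<and> \<mu> \<in> V \<and> log_rate M (empirical X) V \<longlonglongrightarrow> - \<infinity>"
        if "measure \<mu> (\<Union>(comm_classes \<rho>)) < 1" using iv that by blast
    qed
  qed
  moreover have "\<forall>\<mu>\<in>prob_measures. \<mu> \<notin> admissible_measures \<rho> \<longrightarrow> rate \<mu> = \<infinity>"
    by (simp add: rate_def)
  ultimately show ?thesis
    using rate_mixture by (intro exI[of _ rate] conjI ballI impI) blast+
qed

end
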